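(* Let $f$ satisfy the adaptive harmonic model, let $\Phi$ be a stationary Gaussian noise that satisfies the noise conditions (i), (ii) and (iii) of the context, let $\psi$ be a regular analytic wavelet, and let $Y=f+\Phi$. Fix $t\in\mathbb{R}$. For any interval $I\subset(0,\infty)$ containing $s_f(t)=\arg\max_{s>0}S_f(t,s)$, with $I^c=(0,\infty)\setminus I$, denote $$\triangle_I=|W_f(t,s_f(t))|-\max_{s\in I^c}|W_f(t,s)|,\qquad \mu_I=\mathbb{E}\left[|W_\Phi(t,s_f(t))|\right]+\mathbb{E}\Big[\max_{s\in I^c}|W_\Phi(t,s)|\Big],$$ $$\sigma_I=\sqrt{\mathbb{E}\left[|W_\Phi(t,s_f(t))|^2\right]}+\max_{s\in I^c}\sqrt{\mathbb{E}\left[|W_\Phi(t,s)|^2\right]}.$$ If $\triangle_I>\mu_I$, then $$\mathbb{P}\left(s_Y(t)\in I\right)\ge 1-\exp\left(-\frac{(\triangle_I-\mu_I)^2}{\sigma_I^2}\right),$$ where $s_Y(t)=\arg\max_{s>0}S_Y(t,s)$.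
   Context: **Noise conditions.** (i) $\Phi=\{\Phi(t)\}_{t\in\mathbb{R}}$ is a real-valued, mean-square continuous, stationary Gaussian process whose covariance has a spectral density $p:\mathbb{R}\to(0,\infty)$, i.e. $\mathrm{Cov}(\Phi(t),\Phi(0))=\int_{\mathbb{R}}e^{it\lambda}p(\lambda)\,d\lambda$. (ii) There are $\gamma\in(0,2)$ and $C_1>0$ with $p(\lambda)\le C_1|\lambda|^{-(1+\gamma)}$ for all $\lambda\ne0$. (iii) One of the following holds: (long-range dependence) $p(\lambda)=L(|\lambda|^{-1})|\lambda|^{H-1}$ with $H\in(0,1)$ and $L:(0,\infty)\to(0,\infty)$ locally bounded and slowly varying at infinity, i.e. $L(cr)/L(r)\to1$ as $r\to\infty$ for every $c>0$; or (short-range dependence) $p$ is bounded and continuous at the origin. **Regular analytic wavelet.** $\psi\in L^1(\mathbb{R})\cap L^2(\mathbb{R})$ (complex-valued, nonzero), with Fourier transform $\widehat\psi(\omega)=\int_{\mathbb{R}}e^{-it\omega}\psi(t)\,dt$ satisfying $\widehat\psi(\omega)=0$ for $\omega\le0$ (analyticity); $\widehat\psi$ is three times differentiable on $(0,\infty)$ with $\sup_{\lambda>0}|\lambda^{q}\widehat\psi(\lambda)|<\infty$ for $q=1,2$; $\sup_{\lambda>0}|\lambda^{q}D\widehat\psi(\lambda)|<\infty$ for $q=0,1,2$; $\sup_{\lambda>0}|\lambda^{q}D^2\widehat\psi(\lambda)|<\infty$ for $q=2,3$; $\sup_{\lambda>0}|\lambda^{3}D^3\widehat\psi(\lambda)|<\infty$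 ($D^k$ is the $k$th derivative); and $|\widehat\psi|$ is unimodal (with a unique maximizer). **Analytic wavelet transform (AWT) and scalogram.** $W_f(t,s)=\int_{\mathbb{R}}f(\tau)\frac1s\overline{\psi\left(\frac{\tau-t}{s}\right)}d\tau$ for $t\in\mathbb{R}$, $s>0$ (assumed well defined); $W_\Phi$ and $W_Y$ are defined by the same formula, so $W_Y=W_f+W_\Phi$. One has $W_\Phi(t,s)=\int_0^\infty e^{it\lambda}\overline{\widehat\psi(s\lambda)}\sqrt{p(\lambda)}\,Z(d\lambda)$, where $Z$ is a complex Gaussian random measure on $\mathbb{R}$ with $Z(\Delta)=\overline{Z(-\Delta)}$, $\mathbb{E}[Z(\Delta)]=0$, $\mathbb{E}[Z(\Delta_1)\overline{Z(\Delta_2)}]=\mathrm{Leb}(\Delta_1\cap\Delta_2)$. Sample-path statements refer to the version of $W_\Phi$ with continuous sample paths on $\mathbb{R}\times(0,\infty)$. Scalograms: $S_f=|W_f|^2$, $S_Y=|W_Y|^2$. **Adaptive harmonic model (AHM).** $f(t)=\sum_{m=1}^M A_m(t)\cos(2\pi\phi_m(t))$, $M\ge1$, where $A_m\in C^1(\mathbb{R})$ are positive, $\phi_m\in C^2(\mathbb{R})$ are strictly increasing with $\phi_m'>0$, $|A_m'(t)|\le\epsilon\phi_m'(t)$ and $|\phi_m''(t)|\le\epsilon\phi_m'(t)$ for a small constant $\epsilon\ge0$, and, if $M>1$, $\phi_1'(t)<\cdots<\phi_M'(t)$ with $\phi_{m+1}'(t)-\phi_m'(t)\ge\delta(\phi_{m+1}'(t)+\phi_m'(t))$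 for some $\delta\in(0,1)$ and all $t$. **Conventions.** The maximizer $s_f(t)$ is taken to exist and be a single point. A maximum over $I^c$ is read as a supremum when not attained. $s_Y(t)$ is the (almost surely one-point) set of maximizers. *)

theory Defs
  imports "HOL-Probability.Probability"
begin

subsection \<open>Stationary Gaussian noise\<close>

text \<open>Almost surely constant variables are admitted as degenerate normal variables.\<close>

definition gaussian_variable :: "'a measure \<Rightarrow> ('a \<Rightarrow> real) \<Rightarrow> bool" where
  "gaussian_variable M X \<longleftrightarrow> X \<in> borel_measurable M \<and>
     ((\<exists>m \<sigma>. 0 < \<sigma> \<and> distributed M lborel X (normal_density m \<sigma>)) \<or>
      (\<exists>c. AE \<omega> in M. X \<omega> = c))"

definition gaussian_process :: "'a measure \<Rightarrow> (real \<Rightarrow> 'a \<Rightarrow> real) \<Rightarrow> bool" where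
  "gaussian_process M X \<longleftrightarrow>
     (\<forall>J c. finite J \<longrightarrow> gaussian_variable M (\<lambda>\<omega>. \<Sum>j\<in>J. c j * X j \<omega>))"

definition stationary_process :: "'a measure \<Rightarrow> (real \<Rightarrow> 'a \<Rightarrow> real) \<Rightarrow> bool" where
  "stationary_process M X \<longleftrightarrow>
     (\<forall>J h. finite J \<longrightarrow>
        distr M (PiM J (\<lambda>_. borel)) (\<lambda>\<omega>. \<lambda>j\<in>J. X (j + h) \<omega>) =
        distr M (PiM J (\<lambda>_. borel)) (\<lambda>\<omega>. \<lambda>j\<in>J. X j \<omega>))"

definition mean_square_continuous :: "'a measure \<Rightarrow> (real \<Rightarrow> 'a \<Rightarrow> real) \<Rightarrow> bool" where
  "mean_square_continuous M X \<longleftrightarrow>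
     (\<forall>t. ((\<lambda>u. \<integral>\<omega>. (X u \<omega> - X t \<omega>)\<^sup>2 \<partial>M) \<longlongrightarrow> 0) (at t))"

definition covariance :: "'a measure \<Rightarrow> ('a \<Rightarrow> real) \<Rightarrow> ('a \<Rightarrow> real) \<Rightarrow> real" where
  "covariance M X Y =
     (\<integral>\<omega>. (X \<omega> - (\<integral>\<omega>'. X \<omega>' \<partial>M)) * (Y \<omega> - (\<integral>\<omega>'. Y \<omega>' \<partial>M)) \<partial>M)"

definition has_spectral_density :: "'a measure \<Rightarrow> (real \<Rightarrow> 'a \<Rightarrow> real) \<Rightarrow> (real \<Rightarrow> real) \<Rightarrow> bool" where
  "has_spectral_density M X p \<longleftrightarrow> integrable lborel p \<and>
     (\<forall>t. complex_of_real (covariance M (X t) (X 0)) =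
          (\<integral>l. exp (\<i> * complex_of_real (t * l)) * complex_of_real (p l) \<partial>lborel))"

definition slowly_varying :: "(real \<Rightarrow> real) \<Rightarrow> bool" where
  "slowly_varying L \<longleftrightarrow> (\<forall>c>0. ((\<lambda>r. L (c * r) / L r) \<longlongrightarrow> 1) at_top)"

text \<open>The formula is required off the origin only, where its right-hand side is meaningful.\<close>

definition long_range_dependent :: "(real \<Rightarrow> real) \<Rightarrow> bool" where
  "long_range_dependent p \<longleftrightarrow>
     (\<exists>H L. 0 < H \<and> H < 1 \<and>
        (\<forall>r>0. 0 < L r) \<and>
        (\<forall>K. compact K \<and> K \<subseteq> {0<..} \<longrightarrow> bounded (L ` K)) \<and>
        slowly_varying L \<and>
        (\<forall>l. l \<noteq> 0 \<longrightarrow> p l = L (inverse \<bar>l\<bar>) * \<bar>l\<bar> powr (H - 1)))"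

definition short_range_dependent :: "(real \<Rightarrow> real) \<Rightarrow> bool" where
  "short_range_dependent p \<longleftrightarrow> bounded (range p) \<and> isCont p 0"

text \<open>The mean of the process is not assumed to vanish.\<close>

definition noise_conditions :: "'a measure \<Rightarrow> (real \<Rightarrow> 'a \<Rightarrow> real) \<Rightarrow> (real \<Rightarrow> real) \<Rightarrow> bool" where
  "noise_conditions M X p \<longleftrightarrow>
     gaussian_process M X \<and> stationary_process M X \<and> mean_square_continuous M X \<and>
     (\<forall>l. 0 < p l) \<and> has_spectral_density M X p \<and>
     (\<exists>\<gamma> C. 0 < \<gamma> \<and> \<gamma> < 2 \<and> 0 < C \<and> (\<forall>l. l \<noteq> 0 \<longrightarrow> p l \<le> C * \<bar>l\<bar> powr (- (1 + \<gamma>)))) \<and>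
     (long_range_dependent p \<or> short_range_dependent p)"


subsection \<open>Analytic wavelets and the wavelet transform\<close>

definition fourier :: "(real \<Rightarrow> complex) \<Rightarrow> real \<Rightarrow> complex" where
  "fourier g w = (\<integral>t. exp (- \<i> * complex_of_real (t * w)) * g t \<partial>lborel)"

definition nth_deriv :: "nat \<Rightarrow> (real \<Rightarrow> complex) \<Rightarrow> real \<Rightarrow> complex" where
  "nth_deriv k g = ((\<lambda>h x. vector_derivative h (at x)) ^^ k) g"

definition unimodal :: "(real \<Rightarrow> real) \<Rightarrow> bool" where
  "unimodal g \<longleftrightarrow>
     (\<exists>a. mono_on {..a} g \<and> antimono_on {a..} g \<and> (\<forall>x. x \<noteq> a \<longrightarrow> g x < g a))"

definition regular_analytic_wavelet :: "(real \<Rightarrow> complex) \<Rightarrow> bool" where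
  "regular_analytic_wavelet \<psi> \<longleftrightarrow>
     integrable lborel \<psi> \<and> integrable lborel (\<lambda>x. (cmod (\<psi> x))\<^sup>2) \<and>
     \<not> (AE x in lborel. \<psi> x = 0) \<and>
     (\<forall>w\<le>0. fourier \<psi> w = 0) \<and>
     (\<forall>k<3. \<forall>w>0. nth_deriv k (fourier \<psi>) differentiable (at w)) \<and>
     (\<forall>(k, q) \<in> {(0,1), (0,2), (1,0), (1,1), (1,2), (2,2), (2,3), (3,3)}.
        bdd_above ((\<lambda>w. cmod (complex_of_real (w ^ q) * nth_deriv k (fourier \<psi>) w)) ` {0<..})) \<and>
     unimodal (\<lambda>w. cmod (fourier \<psi> w))"

definition awt_integrand :: "(real \<Rightarrow> complex) \<Rightarrow> (real \<Rightarrow> real) \<Rightarrow> real \<Rightarrow> real \<Rightarrow> real \<Rightarrow> complex" where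
  "awt_integrand \<psi> f t s \<tau> =
     complex_of_real (f \<tau>) * complex_of_real (1 / s) * cnj (\<psi> ((\<tau> - t) / s))"

definition awt :: "(real \<Rightarrow> complex) \<Rightarrow> (real \<Rightarrow> real) \<Rightarrow> real \<Rightarrow> real \<Rightarrow> complex" where
  "awt \<psi> f t s = (\<integral>\<tau>. awt_integrand \<psi> f t s \<tau> \<partial>lborel)"

definition awt_well_defined :: "(real \<Rightarrow> complex) \<Rightarrow> (real \<Rightarrow> real) \<Rightarrow> bool" where
  "awt_well_defined \<psi> f \<longleftrightarrow> (\<forall>t. \<forall>s>0. integrable lborel (awt_integrand \<psi> f t s))"

lemma awt_add:
  assumes "integrable lborel (awt_integrand \<psi> f t s)"
    and "integrable lborel (awt_integrand \<psi> g t s)"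
  shows "awt \<psi> (\<lambda>\<tau>. f \<tau> + g \<tau>) t s = awt \<psi> f t s + awt \<psi> g t s"
proof -
  have "awt_integrand \<psi> (\<lambda>\<tau>. f \<tau> + g \<tau>) t s =
      (\<lambda>\<tau>. awt_integrand \<psi> f t s \<tau> + awt_integrand \<psi> g t s \<tau>)"
    by (rule ext) (simp only: awt_integrand_def of_real_add distrib_right)
  then show ?thesis
    unfolding awt_def using Bochner_Integration.integral_add[OF assms] by simp
qed

text \<open>
  The transform of the noise is the pathwise integral, which presupposes that the process is
  jointly measurable; the random field W agrees with it almost surely at each (t, s) and has
  continuous sample paths.
\<close>

definition continuous_awt_version ::
    "'a measure \<Rightarrow> (real \<Rightarrow> complex) \<Rightarrow> (real \<Rightarrow> 'a \<Rightarrow> real) \<Rightarrow> (real \<Rightarrow> real \<Rightarrow> 'a \<Rightarrow> complex) \<Rightarrow> bool" where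
  "continuous_awt_version M \<psi> X W \<longleftrightarrow>
     (\<lambda>(\<tau>, \<omega>). X \<tau> \<omega>) \<in> borel_measurable (lborel \<Otimes>\<^sub>M M) \<and>
     (\<forall>t. \<forall>s>0. W t s \<in> borel_measurable M \<and>
        (AE \<omega> in M. W t s \<omega> = awt \<psi> (\<lambda>\<tau>. X \<tau> \<omega>) t s)) \<and>
     (\<forall>\<omega>\<in>space M. continuous_on (UNIV \<times> {0<..}) (\<lambda>(t, s). W t s \<omega>))"

lemma awt_signal_plus_noise:
  assumes "continuous_awt_version M \<psi> X W" and "0 < s"
    and "integrable lborel (awt_integrand \<psi> f t s)"
    and "AE \<omega> in M. integrable lborel (awt_integrand \<psi> (\<lambda>\<tau>. X \<tau> \<omega>) t s)"
  shows "AE \<omega> in M. awt \<psi> (\<lambda>\<tau>. f \<tau> + X \<tau> \<omega>) t s = awt \<psi> f t s + W t s \<omega>"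
proof -
  have "AE \<omega> in M. W t s \<omega> = awt \<psi> (\<lambda>\<tau>. X \<tau> \<omega>) t s"
    using assms(1,2) by (simp add: continuous_awt_version_def)
  with assms(4) show ?thesis
    by eventually_elim (simp add: awt_add[OF assms(3)])
qed

definition scalogram :: "(real \<Rightarrow> real \<Rightarrow> complex) \<Rightarrow> real \<Rightarrow> real \<Rightarrow> real" where
  "scalogram W t s = (cmod (W t s))\<^sup>2"

definition argmax_scales :: "(real \<Rightarrow> real) \<Rightarrow> real set" where
  "argmax_scales g = {s. is_arg_max g (\<lambda>r. 0 < r) s}"


subsection \<open>The adaptive harmonic model\<close>

definition ahm_signal :: "nat \<Rightarrow> (nat \<Rightarrow> real \<Rightarrow> real) \<Rightarrow> (nat \<Rightarrow> real \<Rightarrow> real) \<Rightarrow> real \<Rightarrow> real" where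
  "ahm_signal N A \<phi> t = (\<Sum>m=1..N. A m t * cos (2 * pi * \<phi> m t))"

definition adaptive_harmonic_model ::
    "nat \<Rightarrow> (nat \<Rightarrow> real \<Rightarrow> real) \<Rightarrow> (nat \<Rightarrow> real \<Rightarrow> real) \<Rightarrow> real \<Rightarrow> real \<Rightarrow> bool" where
  "adaptive_harmonic_model N A \<phi> \<epsilon> \<delta> \<longleftrightarrow>
     1 \<le> N \<and> 0 \<le> \<epsilon> \<and>
     (\<forall>m\<in>{1..N}.
        A m C1_differentiable_on UNIV \<and> (\<forall>t. 0 < A m t) \<and>
        \<phi> m C1_differentiable_on UNIV \<and> deriv (\<phi> m) C1_differentiable_on UNIV \<and>
        strict_mono (\<phi> m) \<and> (\<forall>t. 0 < deriv (\<phi> m) t) \<and>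
        (\<forall>t. \<bar>deriv (A m) t\<bar> \<le> \<epsilon> * deriv (\<phi> m) t) \<and>
        (\<forall>t. \<bar>deriv (deriv (\<phi> m)) t\<bar> \<le> \<epsilon> * deriv (\<phi> m) t)) \<and>
     (1 < N \<longrightarrow> 0 < \<delta> \<and> \<delta> < 1 \<and>
        (\<forall>m\<in>{1..<N}. \<forall>t.
           deriv (\<phi> m) t < deriv (\<phi> (Suc m)) t \<and>
           \<delta> * (deriv (\<phi> (Suc m)) t + deriv (\<phi> m) t) \<le> deriv (\<phi> (Suc m)) t - deriv (\<phi> m) t))"


subsection \<open>The quantities attached to an interval of scales\<close>

text \<open>
  Suprema of nonnegative functions over the complementary scales are taken in the extended
  nonnegative reals: they may be infinite, and the supremum over an empty complement is 0.
\<close>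

definition sup_off :: "real set \<Rightarrow> (real \<Rightarrow> real) \<Rightarrow> ennreal" where
  "sup_off I g = (SUP s\<in>{0<..} - I. ennreal (g s))"

text \<open>
  Below, \<open>s\<^sub>0\<close> stands for the maximizing scale of the signal, so the supremum in
  \<open>gap_off\<close> is finite.
\<close>

definition gap_off :: "real set \<Rightarrow> (real \<Rightarrow> real \<Rightarrow> complex) \<Rightarrow> real \<Rightarrow> real \<Rightarrow> real" where
  "gap_off I W t s\<^sub>0 = cmod (W t s\<^sub>0) - enn2real (sup_off I (\<lambda>s. cmod (W t s)))"

definition mean_off ::
    "'a measure \<Rightarrow> real set \<Rightarrow> (real \<Rightarrow> real \<Rightarrow> 'a \<Rightarrow> complex) \<Rightarrow> real \<Rightarrow> real \<Rightarrow> ennreal" where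
  "mean_off M I W t s\<^sub>0 =
     (\<integral>\<^sup>+\<omega>. ennreal (cmod (W t s\<^sub>0 \<omega>)) \<partial>M) +
     (\<integral>\<^sup>+\<omega>. sup_off I (\<lambda>s. cmod (W t s \<omega>)) \<partial>M)"

definition sd_off ::
    "'a measure \<Rightarrow> real set \<Rightarrow> (real \<Rightarrow> real \<Rightarrow> 'a \<Rightarrow> complex) \<Rightarrow> real \<Rightarrow> real \<Rightarrow> ennreal" where
  "sd_off M I W t s\<^sub>0 =
     ennreal (sqrt (\<integral>\<omega>. (cmod (W t s\<^sub>0 \<omega>))\<^sup>2 \<partial>M)) +
     sup_off I (\<lambda>s. sqrt (\<integral>\<omega>. (cmod (W t s \<omega>))\<^sup>2 \<partial>M))"

end

theory Submission
  imports Defs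
begin

text \<open>
  If the maximizing scale of \<open>S\<^sub>Y\<close> lies outside \<open>I\<close>, then the gap is exceeded by
  \<open>G = \<bar>W\<^sub>\<Phi>(s\<^sub>f)\<bar> + sup \<bar>W\<^sub>\<Phi>(s)\<bar>\<close>, the supremum being over a countable dense set of scales
  outside \<open>I\<close>. The expectation of \<open>G\<close> is at most \<open>\<mu>\<^sub>I\<close>, so Gaussian concentration with the sharp
  constant \<open>exp (- r\<^sup>2 / (2 L\<^sup>2))\<close> for \<open>L\<close>-Lipschitz functions finishes the proof, once
  \<open>L = \<sigma>\<^sub>I / sqrt 2\<close>; the factor \<open>sqrt 2\<close> is gained because \<open>W\<^sub>\<Phi>\<close> is a circular complex Gaussian field.

  The concentration inequality is obtained from a Prekopa-Leindler inequality relative to the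
  Gaussian measure. In dimension one, comparison with a Gaussian density, whose superlevel sets are
  intervals, only needs the diameters of the other superlevel sets; the inequality then
  tensorizes, and applied to \<open>exp (- l F / n)\<close> and \<open>exp (l F - c)\<close> it bounds the Laplace transform of
  \<open>F\<close> as \<open>n\<close> tends to infinity.

  Finite families of scales are reduced to independent standard normal variables by
  orthonormalization in \<open>L\<^sup>2\<close>; the pathwise integrals are Gaussian because they are \<open>L\<^sup>2\<close> limits of
  linear combinations of the process.
\<close>

subsection \<open>Prekopa-Leindler inequality for the standard Gaussian measure\<close>

text \<open>The sharp constant dictates the unequal weights n and 1. Jensen's inequality bounds the
  first factor from below by \<open>exp (- l * E F)\<close>, so the Laplace transform is centred at
  the mean without symmetrization; the price is a factor 1 + 1/n in the variance, which disappears
  in the limit. Taking the Gaussian density itself as the third function in Prekopa-Leindler avoids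
  sup-convolutions and their measurability.

  Concentration is applied to finite sets of scales only. The mean e of the finite maximum never
  exceeds \<mu>, so the deviation \<Delta> - e is at least \<Delta> - \<mu> and one bound serves all
  finite sets; continuity from below then reaches the countable dense set.

  Circularity enters scale by scale: the norm at each scale has its own Lipschitz constant, the
  standard deviation divided by the square root of 2. The constant at the maximizing scale and the
  largest one off \<open>I\<close> are added, which is why \<sigma> in the exponent is a sum of
  standard deviations. Circularity itself is read off from the covariance by Fubini, with no
  spectral integral.\<close>

lemma layer_cake_lborel:
  fixes u :: "real \<Rightarrow> real"
  assumes u[measurable]: "u \<in> borel_measurable borel" and nonneg: "\<And>x. 0 \<le> u x" and "0 < a"
  shows "(\<integral>\<^sup>+s\<in>{0<..}. emeasure lborel {x. s * a < u x} \<partial>lborel) = (\<integral>\<^sup>+x. ennreal (u x / a) \<partial>lborel)"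
proof -
  have "(\<integral>\<^sup>+s\<in>{0<..}. emeasure lborel {x. s * a < u x} \<partial>lborel)
      = (\<integral>\<^sup>+s. (\<integral>\<^sup>+x. indicator {p. 0 < fst p \<and> fst p * a < u (snd p)} (s, x) \<partial>lborel) \<partial>lborel)"
  proof (rule nn_integral_cong)
    fix s :: real
    have "(\<integral>\<^sup>+x. indicator {p. 0 < fst p \<and> fst p * a < u (snd p)} (s, x) \<partial>lborel)
      = (\<integral>\<^sup>+x. indicator {x. s * a < u x} x * indicator {0<..} s \<partial>lborel)"
      by (rule nn_integral_cong) (auto split: split_indicator)
    then show "emeasure lborel {x. s * a < u x} * indicator {0<..} s =
      (\<integral>\<^sup>+x. indicator {p. 0 < fst p \<and> fst p * a < u (snd p)} (s, x) \<partial>lborel)"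
      by (simp add: nn_integral_multc)
  qed
  also have "\<dots> = (\<integral>\<^sup>+x. (\<integral>\<^sup>+s. indicator {p. 0 < fst p \<and> fst p * a < u (snd p)} (s, x) \<partial>lborel) \<partial>lborel)"
  proof (rule lborel_pair.Fubini'[symmetric])
    have "(\<lambda>p. indicator {p. 0 < fst p \<and> fst p * a < u (snd p)} p :: ennreal)
        \<in> borel_measurable (borel \<Otimes>\<^sub>M borel)"
      by measurable
    then show "(\<lambda>(x, y). indicator {p. 0 < fst p \<and> fst p * a < u (snd p)} (x, y) :: ennreal)
        \<in> borel_measurable (lborel \<Otimes>\<^sub>M lborel)"
      by (simp add: split_beta' measurable_cong_sets[OF sets_pair_measure_cong[OF sets_lborel sets_lborel] refl])
  qed
  also have "\<dots> = (\<integral>\<^sup>+x. ennreal (u x / a) \<partial>lborel)"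
  proof (rule nn_integral_cong)
    fix x
    have "(\<integral>\<^sup>+s. indicator {p. 0 < fst p \<and> fst p * a < u (snd p)} (s, x) \<partial>lborel)
      = (\<integral>\<^sup>+s. indicator {0<..<u x / a} s \<partial>lborel)"
      using \<open>0 < a\<close> by (intro nn_integral_cong) (auto split: split_indicator simp: field_simps)
    then show "(\<integral>\<^sup>+s. indicator {p. 0 < fst p \<and> fst p * a < u (snd p)} (s, x) \<partial>lborel) = ennreal (u x / a)"
      using nonneg[of x] \<open>0 < a\<close> by simp
  qed
  finally show ?thesis .
qed

text \<open>The bound forces \<open>n * Sup A + Sup B\<close> below R and
  \<open>n * Inf A + Inf B\<close> above -R, and each set has measure at most its diameter. This
  replaces the one-dimensional Brunn-Minkowski inequality when the set that contains the weighted
  means is a symmetric interval.\<close>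

lemma emeasure_sumset_le:
  fixes A B :: "real set"
  assumes "A \<noteq> {}" "B \<noteq> {}" and n: "0 < (n::nat)"
    and bd: "\<And>x y. x \<in> A \<Longrightarrow> y \<in> B \<Longrightarrow> \<bar>n * x + y\<bar> \<le> R"
  shows "of_nat n * emeasure lborel A + emeasure lborel B \<le> ennreal (2 * R)"
proof -
  obtain x0 y0 where x0: "x0 \<in> A" and y0: "y0 \<in> B" using assms by auto
  have le: "real n * x \<le> R + \<bar>y0\<bar>" "- (R + \<bar>y0\<bar>) \<le> real n * x" if "x \<in> A" for x
    using bd[OF that y0] by auto
  have A1: "bdd_above A" using le n by (intro bdd_aboveI[of _ "(R + \<bar>y0\<bar>) / n"]) (auto simp: field_simps)
  have A2: "bdd_below A" using le n by (intro bdd_belowI[of _ "- (R + \<bar>y0\<bar>) / n"]) (auto simp: field_simps)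
  have B1: "bdd_above B" using bd[OF x0] by (intro bdd_aboveI[of _ "R - n * x0"]) (fastforce simp: abs_le_iff)
  have B2: "bdd_below B" using bd[OF x0] by (intro bdd_belowI[of _ "- R - n * x0"]) (fastforce simp: abs_le_iff)
  have up: "n * Sup A + Sup B \<le> R"
  proof -
    have "Sup B \<le> R - real n * x" if "x \<in> A" for x
      using bd[OF that] \<open>B \<noteq> {}\<close> by (intro cSup_least) (fastforce simp: abs_le_iff)+
    then have "Sup A \<le> (R - Sup B) / n"
      using \<open>A \<noteq> {}\<close> n by (intro cSup_least) (force simp: field_simps)+
    then show ?thesis using n by (simp add: field_simps)
  qed
  have low: "- R \<le> n * Inf A + Inf B"
  proof -
    have "- R - real n * x \<le> Inf B" if "x \<in> A" for x
      using bd[OF that] \<open>B \<noteq> {}\<close> by (intro cInf_greatest) (fastforce simp: abs_le_iff)+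
    then have "(- R - Inf B) / n \<le> Inf A"
      using \<open>A \<noteq> {}\<close> n by (intro cInf_greatest) (force simp: field_simps)+
    then show ?thesis using n by (simp add: field_simps)
  qed
  have "Inf A \<le> Sup A" "Inf B \<le> Sup B"
    using A1 A2 B1 B2 assms by (auto intro: cInf_le_cSup)
  have "emeasure lborel A \<le> emeasure lborel {Inf A..Sup A}"
    using A1 A2 by (intro emeasure_mono) (auto intro: cInf_lower cSup_upper)
  moreover have "emeasure lborel B \<le> emeasure lborel {Inf B..Sup B}"
    using B1 B2 by (intro emeasure_mono) (auto intro: cInf_lower cSup_upper)
  ultimately have "of_nat n * emeasure lborel A + emeasure lborel B
     \<le> of_nat n * ennreal (Sup A - Inf A) + ennreal (Sup B - Inf B)"
    using \<open>Inf A \<le> Sup A\<close> \<open>Inf B \<le> Sup B\<close> by (intro add_mono mult_left_mono) auto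
  also have "\<dots> = ennreal (n * (Sup A - Inf A) + (Sup B - Inf B))"
    using \<open>Inf A \<le> Sup A\<close> \<open>Inf B \<le> Sup B\<close>
    by (simp add: ennreal_plus ennreal_mult ennreal_of_nat_eq_real_of_nat)
  also have "\<dots> \<le> ennreal (2 * R)"
    using up low by (intro ennreal_leI) (simp add: algebra_simps)
  finally show ?thesis .
qed

text \<open>After division by c, the tangent bound \<open>x \<le> exp (x - 1)\<close> turns the
  product into the exponential of n (x - 1) + (y - 1), which is at most 0 by hypothesis.\<close>

lemma weighted_am_gm:
  fixes a b c :: real
  assumes "0 \<le> a" "0 \<le> b" "real n * a + b \<le> (real n + 1) * c" "0 < n"
  shows "a ^ n * b \<le> c ^ (n + 1)"
proof (cases "c = 0")
  case True
  then have "n * a + b \<le> 0" using assms(3) by simp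
  moreover have "0 \<le> n * a" using assms by simp
  ultimately have "b = 0" using assms(2) by linarith
  then show ?thesis using True by simp
next
  case False
  have "0 \<le> real n * a" using assms by simp
  then have "0 \<le> (real n + 1) * c" using assms by linarith
  then have c: "0 < c" using False by (simp add: zero_le_mult_iff)
  define x y where "x = a / c" and "y = b / c"
  have x: "0 \<le> x" "0 \<le> y" "real n * x + y \<le> real n + 1"
    using assms c by (simp_all add: x_def y_def divide_simps)
  have "x \<le> exp (x - 1)" "y \<le> exp (y - 1)" using exp_ge_add_one_self[of "x - 1"] exp_ge_add_one_self[of "y - 1"] by auto
  then have "x ^ n * y \<le> exp (x - 1) ^ n * exp (y - 1)"
    using x by (intro mult_mono power_mono) auto
  also have "\<dots> = exp (n * (x - 1) + (y - 1))"
    by (simp add: exp_add exp_of_nat_mult)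
  also have "\<dots> \<le> 1" using x by (simp add: algebra_simps)
  finally have "(x ^ n * y) * c ^ (n+1) \<le> 1 * c ^ (n + 1)"
    using c by (intro mult_right_mono) auto
  moreover have "(x ^ n * y) * c ^ (n+1) = (x * c) ^ n * (y * c)"
    by (simp add: power_mult_distrib)
  moreover have "x * c = a" "y * c = b"
    using c by (auto simp: x_def y_def)
  ultimately show ?thesis by (simp only: mult_1_left)
qed

lemma borel_measurable_level_emeasure:
  fixes u :: "real \<Rightarrow> real"
  assumes u[measurable]: "u \<in> borel_measurable borel"
  shows "(\<lambda>s. emeasure lborel {x. s * a < u x}) \<in> borel_measurable borel"
proof -
  have "(\<lambda>s. \<integral>\<^sup>+x. indicator {p. fst p * a < u (snd p)} (s, x) \<partial>lborel) \<in> borel_measurable borel"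
    by measurable
  also have "(\<lambda>s. \<integral>\<^sup>+x. indicator {p. fst p * a < u (snd p)} (s, x) \<partial>lborel)
     = (\<lambda>s. emeasure lborel {x. s * a < u x})"
  proof
    fix s :: real
    have "(\<integral>\<^sup>+x. indicator {p. fst p * a < u (snd p)} (s, x) \<partial>lborel)
      = (\<integral>\<^sup>+x. indicator {x. s * a < u x} x \<partial>lborel)"
      by (rule nn_integral_cong) (auto split: split_indicator)
    then show "(\<integral>\<^sup>+x. indicator {p. fst p * a < u (snd p)} (s, x) \<partial>lborel) = emeasure lborel {x. s * a < u x}"
      by simp
  qed
  finally show ?thesis .
qed

lemma less_std_normal_density_iff:
  assumes "0 < c"
  shows "c < std_normal_density z \<longleftrightarrow> z\<^sup>2 < - 2 * ln (c * sqrt (2 * pi))"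
proof -
  have "c < std_normal_density z \<longleftrightarrow> c * sqrt (2 * pi) < exp (- z\<^sup>2 / 2)"
    by (simp add: std_normal_density_def field_simps)
  also have "\<dots> \<longleftrightarrow> ln (c * sqrt (2 * pi)) < - z\<^sup>2 / 2"
    using assms by (subst ln_less_cancel_iff[symmetric]) auto
  finally show ?thesis by auto
qed

text \<open>Comparing superlevel sets at relative heights s of the suprema keeps those of u and v
  nonempty for all s below 1, as \<open>emeasure_sumset_le\<close> requires. Integrating the
  resulting inequality over s gives an arithmetic mean bound, which \<open>weighted_am_gm\<close>
  converts into the product bound.\<close>

lemma prekopa_leindler_std_normal_density:
  fixes u v :: "real \<Rightarrow> real"
  assumes [measurable]: "u \<in> borel_measurable borel" "v \<in> borel_measurable borel"
    and u0: "\<And>x. 0 \<le> u x" and v0: "\<And>x. 0 \<le> v x" and n: "0 < n"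
    and le: "\<And>x y. u x ^ n * v y \<le> std_normal_density ((real n * x + y) / (real n + 1)) ^ (n + 1)"
  shows "(\<integral>\<^sup>+x. ennreal (u x) \<partial>lborel) ^ n * (\<integral>\<^sup>+x. ennreal (v x) \<partial>lborel) \<le> 1"
proof (cases "(\<forall>x. u x = 0) \<or> (\<forall>x. v x = 0)")
  case True
  then show ?thesis using n by (auto simp: zero_power)
next
  case False
  then obtain x0 y0 where x0: "0 < u x0" and y0: "0 < v y0"
    using u0 v0 by (metis order_le_less)
  have "std_normal_density z \<le> 1" for z
  proof -
    have "exp (- z\<^sup>2 / 2) \<le> 1" by simp
    also have "1 \<le> sqrt (2 * pi)" using pi_gt3 by simp
    finally show ?thesis by (simp add: std_normal_density_def field_simps)
  qed
  then have le1: "u x ^ n * v y \<le> 1" for x y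
    by (rule order_trans[OF le power_le_one[OF normal_density_nonneg]])
  \<comment> \<open>One point where the other function is positive bounds u, and likewise v, so both
    suprema are finite. Passing to the power n only increases values above 1.\<close>
  have ub: "u x \<le> 1 + 1 / v y0" for x
  proof (cases "u x \<le> 1")
    case False
    then have "u x \<le> u x ^ n" using n by (intro self_le_power) auto
    moreover have "u x ^ n \<le> 1 / v y0" using le1[of x y0] y0 by (simp add: field_simps)
    ultimately show ?thesis by linarith
  qed (use y0 in \<open>simp add: add_increasing2\<close>)
  have vb: "v y \<le> 1 / u x0 ^ n" for y
    using le1[of x0 y] x0 by (simp add: field_simps)
  define \<alpha> \<beta> where "\<alpha> = (SUP x. u x)" and "\<beta> = (SUP x. v x)"
  have bdd: "bdd_above (range u)" "bdd_above (range v)"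
    using ub vb by (auto intro!: bdd_aboveI2)
  have u\<alpha>: "u x \<le> \<alpha>" and v\<beta>: "v x \<le> \<beta>" for x
    unfolding \<alpha>_def \<beta>_def using bdd by (auto intro: cSUP_upper)
  have pos: "0 < \<alpha>" "0 < \<beta>" using u\<alpha>[of x0] v\<beta>[of y0] x0 y0 by auto
  \<comment> \<open>The weighted geometric mean of the suprema: the heights
    \<open>s * \<alpha>\<close>, \<open>s * \<beta>\<close> and \<open>s * \<kappa>\<close> then
    satisfy the product relation with equality, and the same relation cancels all normalizations at
    the end.\<close>
  define \<kappa> where "\<kappa> = root (n + 1) (\<alpha> ^ n * \<beta>)"
  have \<kappa>: "0 < \<kappa>" "\<kappa> ^ (n + 1) = \<alpha> ^ n * \<beta>"
    using pos by (auto simp: \<kappa>_def simp del: power_Suc)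
  have level: "of_nat n * emeasure lborel {x. s * \<alpha> < u x} + emeasure lborel {x. s * \<beta> < v x}
      \<le> (of_nat n + 1) * emeasure lborel {x. s * \<kappa> < std_normal_density x}" if s: "0 < s" "s < 1" for s
  proof -
    define r where "r = sqrt (- 2 * ln (s * \<kappa> * sqrt (2 * pi)))"
    have ne: "{x. s * \<alpha> < u x} \<noteq> {}" "{x. s * \<beta> < v x} \<noteq> {}"
    proof -
      have "s * \<alpha> < \<alpha>" "s * \<beta> < \<beta>" using s pos by auto
      then show "{x. s * \<alpha> < u x} \<noteq> {}" "{x. s * \<beta> < v x} \<noteq> {}"
        unfolding \<alpha>_def \<beta>_def using bdd
        by (auto simp: less_cSUP_iff)
    qed
    have in_C: "s * \<kappa> < std_normal_density ((real n * x + y) / (real n + 1))"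
      if "s * \<alpha> < u x" "s * \<beta> < v y" for x y
    proof -
      have "(s * \<kappa>) ^ (n + 1) = (s * \<alpha>) ^ n * (s * \<beta>)"
        using \<kappa>(2) by (simp add: power_mult_distrib)
      also have "0 < u x" using that(1) mult_pos_pos[OF s(1) pos(1)] by linarith
      then have "(s * \<alpha>) ^ n * (s * \<beta>) < u x ^ n * v y"
        using that s pos n by (intro mult_strict_mono power_strict_mono) auto
      also note le
      finally show ?thesis by (rule power_less_imp_less_base) simp
    qed
    have C: "s * \<kappa> < std_normal_density z \<longleftrightarrow> \<bar>z\<bar> < r" for z
      using less_std_normal_density_iff[OF mult_pos_pos[OF s(1) \<kappa>(1)], of z]
      by (simp only: r_def real_sqrt_less_iff flip: real_sqrt_abs)
    have "of_nat n * emeasure lborel {x. s * \<alpha> < u x} + emeasure lborel {x. s * \<beta> < v x}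
      \<le> ennreal (2 * ((real n + 1) * r))"
    proof (rule emeasure_sumset_le[OF ne n])
      fix x y assume "x \<in> {x. s * \<alpha> < u x}" "y \<in> {x. s * \<beta> < v x}"
      then have "\<bar>(real n * x + y) / (real n + 1)\<bar> < r" using in_C C by auto
      then show "\<bar>real n * x + y\<bar> \<le> (real n + 1) * r"
        by (simp add: abs_divide divide_less_eq mult.commute)
    qed
    also obtain x y where "s * \<alpha> < u x" "s * \<beta> < v y" using ne by auto
    then have "0 \<le> r" using in_C C by (smt (verit))
    have "ennreal (2 * ((real n + 1) * r)) = ennreal ((real n + 1) * (r - (- r)))"
      by (rule arg_cong[where f = ennreal]) algebra
    also have "\<dots> = ennreal (real n + 1) * ennreal (r - (- r))"
      using \<open>0 \<le> r\<close> by (intro ennreal_mult) auto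
    also have "ennreal (real n + 1) = of_nat n + 1"
      by (simp add: ennreal_plus ennreal_of_nat_eq_real_of_nat)
    also have "ennreal (r - (- r)) = emeasure lborel {- r<..<r}"
      using \<open>0 \<le> r\<close> by (subst emeasure_lborel_Ioo) auto
    also have "{- r<..<r} = {x. s * \<kappa> < std_normal_density x}"
      by (auto simp: C abs_less_iff)
    finally show ?thesis .
  qed
  have m[measurable]: "(\<lambda>s. emeasure lborel {x. s * \<alpha> < u x}) \<in> borel_measurable borel"
    "(\<lambda>s. emeasure lborel {x. s * \<beta> < v x}) \<in> borel_measurable borel"
    "(\<lambda>s. emeasure lborel {x. s * \<kappa> < std_normal_density x}) \<in> borel_measurable borel"
    by (intro borel_measurable_level_emeasure; simp)+
  have "of_nat n * (\<integral>\<^sup>+x. ennreal (u x / \<alpha>) \<partial>lborel) + (\<integral>\<^sup>+x. ennreal (v x / \<beta>) \<partial>lborel)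
     = (\<integral>\<^sup>+s\<in>{0<..}. (of_nat n * emeasure lborel {x. s * \<alpha> < u x} + emeasure lborel {x. s * \<beta> < v x}) \<partial>lborel)"
    using pos u0 v0
    by (simp add: layer_cake_lborel[symmetric] distrib_right nn_integral_add nn_integral_cmult mult.assoc)
  also have "\<dots> \<le> (\<integral>\<^sup>+s\<in>{0<..}. ((of_nat n + 1) * emeasure lborel {x. s * \<kappa> < std_normal_density x}) \<partial>lborel)"
  proof (rule nn_integral_mono)
    fix s :: real
    \<comment> \<open>From relative height 1 on, the left-hand side vanishes because u and v stay
      below their suprema.\<close>
    have "{x. s * \<alpha> < u x} = {}" "{x. s * \<beta> < v x} = {}" if "1 \<le> s"
      using u\<alpha> v\<beta> pos that
      by (auto simp: not_less intro: order_trans[OF _ mult_right_mono[OF that]])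
    then show "(of_nat n * emeasure lborel {x. s * \<alpha> < u x} + emeasure lborel {x. s * \<beta> < v x}) * indicator {0<..} s
      \<le> (of_nat n + 1) * emeasure lborel {x. s * \<kappa> < std_normal_density x} * indicator {0<..} s"
      using level[of s] by (cases "s < 1") (auto split: split_indicator)
  qed
  also have "\<dots> = (of_nat n + 1) * (\<integral>\<^sup>+x. ennreal (std_normal_density x / \<kappa>) \<partial>lborel)"
    using \<kappa>(1) by (simp add: layer_cake_lborel[symmetric] nn_integral_cmult mult.assoc)
  also have "(\<integral>\<^sup>+x. ennreal (std_normal_density x / \<kappa>) \<partial>lborel) = ennreal (1 / \<kappa>)"
    using \<kappa>(1) by (subst nn_integral_eq_integral)
      (auto simp: integrable_normal_density integral_normal_density)
  also have "(of_nat n + 1) * ennreal (1 / \<kappa>) = ennreal ((real n + 1) * (1 / \<kappa>))"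
    using \<kappa>(1) by (subst ennreal_mult) (auto simp: ennreal_plus ennreal_of_nat_eq_real_of_nat)
  finally have main: "of_nat n * (\<integral>\<^sup>+x. ennreal (u x / \<alpha>) \<partial>lborel) + (\<integral>\<^sup>+x. ennreal (v x / \<beta>) \<partial>lborel)
     \<le> ennreal ((real n + 1) * (1 / \<kappa>))" .
  define P Q where "P = enn2real (\<integral>\<^sup>+x. ennreal (u x / \<alpha>) \<partial>lborel)" and "Q = enn2real (\<integral>\<^sup>+x. ennreal (v x / \<beta>) \<partial>lborel)"
  have fin: "of_nat n * (\<integral>\<^sup>+x. ennreal (u x / \<alpha>) \<partial>lborel) < \<top>" "(\<integral>\<^sup>+x. ennreal (v x / \<beta>) \<partial>lborel) < \<top>"
    using le_less_trans[OF main ennreal_less_top] by (simp_all only: ennreal_add_less_top)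
  then have P: "(\<integral>\<^sup>+x. ennreal (u x / \<alpha>) \<partial>lborel) = ennreal P" and Q: "(\<integral>\<^sup>+x. ennreal (v x / \<beta>) \<partial>lborel) = ennreal Q"
    using n by (auto simp: P_def Q_def ennreal_mult_less_top)
  have PQ: "0 \<le> P" "0 \<le> Q" by (auto simp: P_def Q_def)
  have "real n * P + Q \<le> (real n + 1) * (1 / \<kappa>)"
    using main PQ \<kappa>(1) unfolding P Q ennreal_of_nat_eq_real_of_nat
    by (simp flip: ennreal_mult ennreal_plus)
  then have "P ^ n * Q \<le> (1 / \<kappa>) ^ (n + 1)"
    using PQ n by (intro weighted_am_gm)
  then have "(\<alpha> ^ n * \<beta>) * (P ^ n * Q) \<le> (\<alpha> ^ n * \<beta>) * (1 / \<kappa>) ^ (n + 1)"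
    using pos by (intro mult_left_mono) auto
  also have "\<dots> = (\<kappa> * (1 / \<kappa>)) ^ (n + 1)"
    by (simp only: \<kappa>(2) power_mult_distrib)
  also have "\<dots> = 1" using \<kappa>(1) by simp
  also have "(\<alpha> ^ n * \<beta>) * (P ^ n * Q) = (\<alpha> * P) ^ n * (\<beta> * Q)"
    by (simp add: power_mult_distrib)
  finally have "ennreal ((\<alpha> * P) ^ n * (\<beta> * Q)) \<le> 1" by simp
  moreover have "(\<integral>\<^sup>+x. ennreal (u x) \<partial>lborel) = ennreal (\<alpha> * P)"
  proof -
    have "(\<integral>\<^sup>+x. ennreal (u x) \<partial>lborel) = (\<integral>\<^sup>+x. ennreal \<alpha> * ennreal (u x / \<alpha>) \<partial>lborel)"
      using pos u0 by (intro nn_integral_cong) (simp flip: ennreal_mult)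
    then show ?thesis using pos PQ by (simp add: nn_integral_cmult P ennreal_mult)
  qed
  moreover have "(\<integral>\<^sup>+x. ennreal (v x) \<partial>lborel) = ennreal (\<beta> * Q)"
  proof -
    have "(\<integral>\<^sup>+x. ennreal (v x) \<partial>lborel) = (\<integral>\<^sup>+x. ennreal \<beta> * ennreal (v x / \<beta>) \<partial>lborel)"
      using pos v0 by (intro nn_integral_cong) (simp flip: ennreal_mult)
    then show ?thesis using pos PQ by (simp add: nn_integral_cmult Q ennreal_mult)
  qed
  ultimately show ?thesis
    using pos PQ by (simp add: ennreal_power flip: ennreal_mult)
qed

text \<open>With m the weighted mean, n x^2 + y^2 = (n + 1) m^2 + n / (n + 1) (x - y)^2. The last
  term is the origin of the constant n / (2 (n + 1)) in the following statements.\<close>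

lemma std_normal_density_power_mult:
  "std_normal_density x ^ n * std_normal_density y * exp (real n / (2 * (real n + 1)) * (x - y)\<^sup>2)
    = std_normal_density ((real n * x + y) / (real n + 1)) ^ (n + 1)"
proof -
  let ?N = "real n + 1"
  have N: "?N \<noteq> 0" by (simp add: add_nonneg_eq_0_iff)
  have "- (real n * x\<^sup>2 + y\<^sup>2) / 2 + real n / (2 * ?N) * (x - y)\<^sup>2 = - (((real n * x + y) / ?N)\<^sup>2 * ?N / 2)"
    using N by (simp add: divide_simps) (simp add: power2_eq_square algebra_simps)
  then have "exp (- x\<^sup>2 / 2) ^ n * exp (- y\<^sup>2 / 2) * exp (real n / (2 * ?N) * (x - y)\<^sup>2)
      = exp (- ((real n * x + y) / ?N)\<^sup>2 / 2) ^ (n + 1)"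
    unfolding exp_of_nat_mult[symmetric] exp_add[symmetric]
    by (intro arg_cong[of _ _ exp]) (simp add: field_simps)
  then show ?thesis
    by (simp add: std_normal_density_def power_divide divide_simps)
qed

text \<open>Multiplying f and g by the Gaussian density absorbs the factor in
  \<open>(x - y)\<^sup>2\<close> and reduces the claim to Lebesgue measure.\<close>

lemma prekopa_leindler_std_normal_1d:
  fixes f g :: "real \<Rightarrow> ennreal"
  assumes [measurable]: "f \<in> borel_measurable borel" "g \<in> borel_measurable borel" and n: "0 < n"
    and le: "\<And>x y. f x ^ n * g y \<le> ennreal (exp (real n / (2 * (real n + 1)) * (x - y)\<^sup>2))"
  shows "(\<integral>\<^sup>+x. f x \<partial>std_normal_distribution) ^ n * (\<integral>\<^sup>+x. g x \<partial>std_normal_distribution) \<le> 1"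
proof (cases "(\<forall>x. f x = 0) \<or> (\<forall>x. g x = 0)")
  case True
  then show ?thesis using n by (auto simp: zero_power)
next
  case False
  then obtain x0 y0 where x0: "f x0 \<noteq> 0" and y0: "g y0 \<noteq> 0" by auto
  \<comment> \<open>Neither function vanishes identically, so finiteness of all products makes each
    function finite everywhere and allows the change to real values.\<close>
  have "f x ^ n * g y < \<top>" for x y
    using le_less_trans[OF le ennreal_less_top] .
  then have fin: "f x < \<top>" "g y < \<top>" for x y
    using x0 y0 n by (auto simp: ennreal_mult_less_top power_less_top_ennreal less_top[symmetric])
       (metis ennreal_mult_eq_top_iff not_less_zero power_eq_0_iff power_eq_top_ennreal)+
  define u v where "u x = enn2real (f x) * std_normal_density x"
    and "v x = enn2real (g x) * std_normal_density x" for x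
  have [measurable]: "u \<in> borel_measurable borel" "v \<in> borel_measurable borel"
    by (simp_all add: u_def[abs_def] v_def[abs_def])
  have f: "ennreal (u x) = ennreal (std_normal_density x) * f x"
    and g: "ennreal (v x) = ennreal (std_normal_density x) * g x" for x
    using fin by (simp_all add: u_def v_def ennreal_mult mult.commute)
  have "(\<integral>\<^sup>+x. ennreal (u x) \<partial>lborel) ^ n * (\<integral>\<^sup>+x. ennreal (v x) \<partial>lborel) \<le> 1"
  proof (rule prekopa_leindler_std_normal_density[OF _ _ _ _ n])
    fix x y
    have "ennreal (enn2real (f x) ^ n * enn2real (g y)) = f x ^ n * g y"
      using fin by (simp add: ennreal_mult flip: ennreal_power)
    also note le
    finally have "enn2real (f x) ^ n * enn2real (g y) \<le> exp (real n / (2 * (real n + 1)) * (x - y)\<^sup>2)"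
      by simp
    then have "(std_normal_density x ^ n * std_normal_density y) * (enn2real (f x) ^ n * enn2real (g y)) \<le>
       (std_normal_density x ^ n * std_normal_density y) * exp (real n / (2 * (real n + 1)) * (x - y)\<^sup>2)"
      by (intro mult_left_mono) auto
    also note std_normal_density_power_mult
    finally show "u x ^ n * v y \<le> std_normal_density ((real n * x + y) / (real n + 1)) ^ (n + 1)"
      by (simp add: u_def v_def power_mult_distrib mult_ac)
  qed (auto simp: u_def v_def)
  then show ?thesis by (simp add: nn_integral_density f g)
qed

text \<open>The squared distance is a sum over coordinates. The inequality for the fibres over fixed
  values y and z of the new coordinate makes the fibre integrals, as functions of y and z, satisfy
  the one-dimensional hypothesis.\<close>

lemma prekopa_leindler_std_normal_PiM:
  fixes f g :: "('i \<Rightarrow> real) \<Rightarrow> ennreal"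
  assumes J: "finite J" and n: "0 < n"
    and "f \<in> borel_measurable (PiM J (\<lambda>_. borel))" "g \<in> borel_measurable (PiM J (\<lambda>_. borel))"
    and "\<And>x y. x \<in> space (PiM J (\<lambda>_. borel)) \<Longrightarrow> y \<in> space (PiM J (\<lambda>_. borel)) \<Longrightarrow>
      f x ^ n * g y \<le> ennreal (exp (real n / (2 * (real n + 1)) * (\<Sum>i\<in>J. (x i - y i)\<^sup>2)))"
  shows "(\<integral>\<^sup>+x. f x \<partial>PiM J (\<lambda>_. std_normal_distribution)) ^ n *
    (\<integral>\<^sup>+x. g x \<partial>PiM J (\<lambda>_. std_normal_distribution)) \<le> 1"
  using J assms(3-)
proof (induction J arbitrary: f g rule: finite_induct)
  case empty
  have "f (\<lambda>_. undefined) ^ n * g (\<lambda>_. undefined) \<le> 1"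
    using empty(3)[of "\<lambda>_. undefined" "\<lambda>_. undefined"] by (simp add: space_PiM)
  then show ?case
    by (simp add: PiM_empty nn_integral_count_space_finite)
next
  case (insert i J)
  interpret N: prob_space std_normal_distribution
    by (rule prob_space_normal_density) simp
  interpret N: product_prob_space "\<lambda>_. std_normal_distribution" UNIV ..
  let ?P = "PiM J (\<lambda>_. std_normal_distribution)"
  let ?c = "real n / (2 * (real n + 1))"
  have sP: "sets (PiM K (\<lambda>_. std_normal_distribution)) = sets (PiM K (\<lambda>_. borel))" for K :: "'i set"
    by (rule sets_PiM_cong) auto
  have [measurable]: "f \<in> borel_measurable (PiM (insert i J) (\<lambda>_. borel))"
    "g \<in> borel_measurable (PiM (insert i J) (\<lambda>_. borel))" by fact+
  have upd: "(\<lambda>x. h (x(i := y))) \<in> borel_measurable (PiM J (\<lambda>_. borel))"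
    if [measurable]: "h \<in> borel_measurable (PiM (insert i J) (\<lambda>_. borel))" for h :: "('i \<Rightarrow> real) \<Rightarrow> ennreal" and y
    by measurable
  have mI: "(\<lambda>y. \<integral>\<^sup>+x. h (x(i := y)) \<partial>?P) \<in> borel_measurable borel"
    if [measurable]: "h \<in> borel_measurable (PiM (insert i J) (\<lambda>_. borel))" for h :: "('i \<Rightarrow> real) \<Rightarrow> ennreal"
  proof -
    interpret P: prob_space ?P by (rule prob_space_PiM) unfold_locales
    have "(\<lambda>(y, x). h (x(i := y))) \<in> borel_measurable (borel \<Otimes>\<^sub>M PiM J (\<lambda>_. borel))"
      by measurable
    then have "(\<lambda>(y, x). h (x(i := y))) \<in> borel_measurable (borel \<Otimes>\<^sub>M ?P)"
      by (simp cong: measurable_cong_sets add: sP sets_pair_measure_cong[OF refl sP])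
    then show ?thesis by (rule P.borel_measurable_nn_integral)
  qed
  have eq: "(\<integral>\<^sup>+x. h x \<partial>PiM (insert i J) (\<lambda>_. std_normal_distribution))
     = (\<integral>\<^sup>+y. (\<integral>\<^sup>+x. h (x(i := y)) \<partial>?P) \<partial>std_normal_distribution)"
    if "h \<in> borel_measurable (PiM (insert i J) (\<lambda>_. borel))" for h :: "('i \<Rightarrow> real) \<Rightarrow> ennreal"
    using that insert(1,2) by (intro N.product_nn_integral_insert_rev) (simp_all cong: measurable_cong_sets add: sP)
  show ?case unfolding eq[OF insert.prems(1)] eq[OF insert.prems(2)]
  proof (rule prekopa_leindler_std_normal_1d[OF mI[OF insert.prems(1)] mI[OF insert.prems(2)] n])
    fix y z :: real
    \<comment> \<open>For fixed y and z this constant cancels the share of the new coordinate in the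
      distance, so that g scaled by it meets the induction hypothesis.\<close>
    let ?e = "ennreal (exp (- ?c * (y - z)\<^sup>2))"
    have "(\<integral>\<^sup>+x. f (x(i := y)) \<partial>?P) ^ n * (\<integral>\<^sup>+x. ?e * g (x(i := z)) \<partial>?P) \<le> 1"
    proof (rule insert.IH)
      fix a b :: "'i \<Rightarrow> real" assume ab: "a \<in> space (PiM J (\<lambda>_. borel))" "b \<in> space (PiM J (\<lambda>_. borel))"
      then have "f (a(i := y)) ^ n * g (b(i := z)) \<le>
         ennreal (exp (?c * (\<Sum>j\<in>insert i J. ((a(i := y)) j - (b(i := z)) j)\<^sup>2)))"
        by (intro insert.prems) (auto simp: space_PiM PiE_def extensional_def)
      also have "(\<Sum>j\<in>insert i J. ((a(i := y)) j - (b(i := z)) j)\<^sup>2) = (y - z)\<^sup>2 + (\<Sum>j\<in>J. (a j - b j)\<^sup>2)"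
        using insert(1,2) by (auto intro!: sum.cong)
      finally have "?e * (f (a(i := y)) ^ n * g (b(i := z)))
          \<le> ?e * ennreal (exp (?c * ((y - z)\<^sup>2 + (\<Sum>j\<in>J. (a j - b j)\<^sup>2))))"
        by (rule mult_left_mono) simp
      also have "\<dots> = ennreal (exp (?c * (\<Sum>j\<in>J. (a j - b j)\<^sup>2)))"
        by (simp add: algebra_simps flip: ennreal_mult exp_add)
      finally show "f (a(i := y)) ^ n * (?e * g (b(i := z))) \<le> ennreal (exp (?c * (\<Sum>j\<in>J. (a j - b j)\<^sup>2)))"
        by (simp add: mult_ac)
    qed (use upd[OF insert.prems(1)] upd[OF insert.prems(2)] in \<open>auto intro: borel_measurable_times_ennreal simp del: fun_upd_apply\<close>)
    also have "(\<integral>\<^sup>+x. ?e * g (x(i := z)) \<partial>?P) = ?e * (\<integral>\<^sup>+x. g (x(i := z)) \<partial>?P)"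
      using upd[OF insert.prems(2)] by (intro nn_integral_cmult) (simp cong: measurable_cong_sets add: sP)
    finally have "ennreal (exp (?c * (y - z)\<^sup>2)) * (?e * ((\<integral>\<^sup>+x. f (x(i := y)) \<partial>?P) ^ n * (\<integral>\<^sup>+x. g (x(i := z)) \<partial>?P)))
        \<le> ennreal (exp (?c * (y - z)\<^sup>2)) * 1"
      by (intro mult_left_mono) (simp_all only: mult.left_commute zero_le)
    moreover have "ennreal (exp (?c * (y - z)\<^sup>2)) * ?e = 1"
      by (simp flip: ennreal_mult exp_add)
    ultimately show "(\<integral>\<^sup>+x. f (x(i := y)) \<partial>?P) ^ n * (\<integral>\<^sup>+x. g (x(i := z)) \<partial>?P)
        \<le> ennreal (exp (?c * (y - z)\<^sup>2))"
      by (simp add: mult.assoc[symmetric])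
  qed
qed

subsection \<open>Gaussian concentration\<close>

text \<open>Coercion to \<open>ennreal\<close> cuts off the negative part of f, hence an inequality
  only.\<close>

lemma ennreal_integral_le_nn_integral:
  fixes f :: "'a \<Rightarrow> real"
  assumes "integrable M f"
  shows "ennreal (\<integral>x. f x \<partial>M) \<le> (\<integral>\<^sup>+x. ennreal (f x) \<partial>M)"
proof -
  have "(\<integral>\<^sup>+x. ennreal (f x) \<partial>M) < \<top>"
    using integrableD(2)[OF assms] by (simp add: top.not_eq_extremum)
  then have "(\<integral>\<^sup>+x. ennreal (f x) \<partial>M) = ennreal (enn2real (\<integral>\<^sup>+x. ennreal (f x) \<partial>M))"
    by simp
  also have "\<dots> \<ge> ennreal (\<integral>x. f x \<partial>M)"
    unfolding real_lebesgue_integral_def[OF assms] by (rule ennreal_leI) simp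
  finally show ?thesis .
qed

text \<open>For each n, Prekopa-Leindler is applied to \<open>exp (- l * F / n)\<close> and
  \<open>exp (l * F - d)\<close>. The n-th power of the first undoes the division by n, so the pair
  compares F at two points, where the Lipschitz bound acts.\<close>

lemma integral_exp_lipschitz_std_normal_PiM:
  fixes J :: "'i set" and F :: "('i \<Rightarrow> real) \<Rightarrow> real"
  defines "P \<equiv> PiM J (\<lambda>_. std_normal_distribution)"
  assumes J: "finite J" and F: "F \<in> borel_measurable (PiM J (\<lambda>_. borel))" "integrable P F" and "0 \<le> L" "0 \<le> l"
    and lip: "\<And>x y. F y - F x \<le> L * sqrt (\<Sum>i\<in>J. (x i - y i)\<^sup>2)"
  shows "(\<integral>\<^sup>+x. ennreal (exp (l * F x)) \<partial>P) \<le> ennreal (exp (l * (\<integral>x. F x \<partial>P) + l\<^sup>2 * L\<^sup>2 / 2))"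
proof -
  interpret P: prob_space P
    unfolding P_def by (intro prob_space_PiM prob_space_normal_density) simp
  have sP: "sets P = sets (PiM J (\<lambda>_. borel))"
    unfolding P_def by (rule sets_PiM_cong) auto
  have [measurable]: "F \<in> borel_measurable (PiM J (\<lambda>_. borel))" "F \<in> borel_measurable P"
    using F by (simp_all cong: measurable_cong_sets add: sP)
  let ?I = "\<integral>\<^sup>+x. ennreal (exp (l * F x)) \<partial>P" and ?m = "\<integral>x. F x \<partial>P"
  have bound: "?I \<le> ennreal (exp (l * ?m + l\<^sup>2 * L\<^sup>2 / 2 * (1 + 1 / real n)))" if n: "0 < n" for n :: nat
  proof -
    define c where "c = real n / (2 * (real n + 1))"
    \<comment> \<open>Completing the square: d is the least constant with
      \<open>l * L * r \<le> c * r\<^sup>2 + d\<close> for all real r when l and L are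
      nonnegative.\<close>
    define d where "d = l\<^sup>2 * L\<^sup>2 / 2 * (1 + 1 / real n)"
    have c: "0 < c" "d = (l * L)\<^sup>2 / (4 * c)"
      using n by (auto simp: c_def d_def field_simps power2_eq_square)
    have "(\<integral>\<^sup>+x. ennreal (exp (- l * F x / n)) \<partial>P) ^ n * (\<integral>\<^sup>+x. ennreal (exp (l * F x - d)) \<partial>P) \<le> 1"
      unfolding P_def
    proof (rule prekopa_leindler_std_normal_PiM[OF J n])
      fix x y
      let ?r = "sqrt (\<Sum>i\<in>J. (x i - y i)\<^sup>2)"
      have "l * (F y - F x) \<le> l * (L * ?r)" using lip \<open>0 \<le> l\<close> by (rule mult_left_mono)
      also have "l * (L * ?r) \<le> c * ?r\<^sup>2 + d"
      proof -
        have "0 \<le> (2 * c * ?r - l * L)\<^sup>2 / (4 * c)" using c by simp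
        also have "\<dots> = c * ?r\<^sup>2 + d - l * (L * ?r)"
          using c(1) unfolding c(2) by (simp add: power2_eq_square field_simps)
        finally show ?thesis by simp
      qed
      also have "?r\<^sup>2 = (\<Sum>i\<in>J. (x i - y i)\<^sup>2)" by (simp add: sum_nonneg)
      finally have "- l * F x + (l * F y - d) \<le> c * (\<Sum>i\<in>J. (x i - y i)\<^sup>2)" by (simp add: algebra_simps)
      moreover have "exp (- l * F x / n) ^ n = exp (- l * F x)"
        using n by (simp flip: exp_of_nat_mult)
      ultimately show "ennreal (exp (- l * F x / n)) ^ n * ennreal (exp (l * F y - d))
          \<le> ennreal (exp (real n / (2 * (real n + 1)) * (\<Sum>i\<in>J. (x i - y i)\<^sup>2)))"
        unfolding c_def[symmetric]
        by (simp only: ennreal_power exp_ge_zero flip: ennreal_mult exp_add) (intro ennreal_leI, simp)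
    qed measurable
    \<comment> \<open>Jensen's inequality by the tangent of the exponential at the mean;
      integrability of F suffices, and the exponential integral may be infinite at this
      stage.\<close>
    moreover have "ennreal (exp (- l * ?m / n)) \<le> (\<integral>\<^sup>+x. ennreal (exp (- l * F x / n)) \<partial>P)"
    proof -
      have "ennreal (\<integral>x. exp (- l * ?m / n) * (1 + (- l * F x / n - - l * ?m / n)) \<partial>P)
        \<le> (\<integral>\<^sup>+x. ennreal (exp (- l * ?m / n) * (1 + (- l * F x / n - - l * ?m / n))) \<partial>P)"
        using F(2) by (intro ennreal_integral_le_nn_integral) auto
      also have "\<dots> \<le> (\<integral>\<^sup>+x. ennreal (exp (- l * F x / n)) \<partial>P)"
      proof (intro nn_integral_mono ennreal_leI)
        fix x
        have "exp (- l * ?m / n) * (1 + (- l * F x / n - - l * ?m / n))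
            \<le> exp (- l * ?m / n) * exp (- l * F x / n - - l * ?m / n)"
          by (intro mult_left_mono exp_ge_add_one_self) simp
        then show "exp (- l * ?m / n) * (1 + (- l * F x / n - - l * ?m / n)) \<le> exp (- l * F x / n)"
          by (simp flip: exp_add)
      qed
      also have "(\<integral>x. exp (- l * ?m / n) * (1 + (- l * F x / n - - l * ?m / n)) \<partial>P) = exp (- l * ?m / n)"
        using F(2) by (simp add: P.prob_space)
      finally show ?thesis .
    qed
    then have "ennreal (exp (- l * ?m / n)) ^ n \<le> (\<integral>\<^sup>+x. ennreal (exp (- l * F x / n)) \<partial>P) ^ n"
      by (intro power_mono) auto
    moreover have "ennreal (exp (- l * ?m / n)) ^ n = ennreal (exp (- l * ?m))"
      using n by (simp add: ennreal_power flip: exp_of_nat_mult)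
    ultimately have "ennreal (exp (- l * ?m)) * (\<integral>\<^sup>+x. ennreal (exp (l * F x - d)) \<partial>P) \<le> 1"
      by (metis (no_types, lifting) mult_right_mono order_trans zero_le)
    also have "(\<integral>\<^sup>+x. ennreal (exp (l * F x - d)) \<partial>P) = (\<integral>\<^sup>+x. ennreal (exp (- d)) * ennreal (exp (l * F x)) \<partial>P)"
      by (intro nn_integral_cong) (simp flip: ennreal_mult exp_add)
    also have "\<dots> = ennreal (exp (- d)) * ?I" by (intro nn_integral_cmult) measurable
    finally have "ennreal (exp (l * ?m + d)) * (ennreal (exp (- l * ?m)) * (ennreal (exp (- d)) * ?I)) \<le> ennreal (exp (l * ?m + d)) * 1"
      by (rule mult_left_mono) simp
    then show ?thesis
      unfolding d_def[symmetric] by (simp add: mult.assoc[symmetric] flip: ennreal_mult exp_add)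
  qed
  have "(\<lambda>n. ennreal (exp (l * ?m + l\<^sup>2 * L\<^sup>2 / 2 * (1 + 1 / real n)))) \<longlonglongrightarrow>
      ennreal (exp (l * ?m + l\<^sup>2 * L\<^sup>2 / 2 * (1 + 0)))"
    by (intro tendsto_intros tendsto_ennrealI lim_1_over_n)
  moreover have "\<forall>\<^sub>F n in sequentially. ?I \<le> ennreal (exp (l * ?m + l\<^sup>2 * L\<^sup>2 / 2 * (1 + 1 / real n)))"
    using eventually_gt_at_top[of 0] by eventually_elim (rule bound)
  ultimately show ?thesis
    by (intro tendsto_lowerbound[where F = sequentially]) auto
qed

theorem std_normal_PiM_concentration:
  fixes J :: "'i set" and F :: "('i \<Rightarrow> real) \<Rightarrow> real"
  defines "P \<equiv> PiM J (\<lambda>_. std_normal_distribution)"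
  assumes J: "finite J" and F: "F \<in> borel_measurable (PiM J (\<lambda>_. borel))" "integrable P F" and L: "0 < L"
    and lip: "\<And>x y. F y - F x \<le> L * sqrt (\<Sum>i\<in>J. (x i - y i)\<^sup>2)"
    and r: "0 \<le> r"
  shows "measure P {x \<in> space P. (\<integral>x. F x \<partial>P) + r \<le> F x} \<le> exp (- r\<^sup>2 / (2 * L\<^sup>2))"
proof -
  interpret P: prob_space P
    unfolding P_def by (intro prob_space_PiM prob_space_normal_density) simp
  have sP: "sets P = sets (PiM J (\<lambda>_. borel))"
    unfolding P_def by (rule sets_PiM_cong) auto
  have [measurable]: "F \<in> borel_measurable P"
    using F by (simp cong: measurable_cong_sets add: sP)
  \<comment> \<open>The minimizer of \<open>- l * r + l\<^sup>2 * L\<^sup>2 / 2\<close>, the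
    exponent left by the Chernoff bound.\<close>
  define l where "l = r / L\<^sup>2"
  have l: "0 \<le> l" using r L by (simp add: l_def)
  let ?m = "\<integral>x. F x \<partial>P"
  have "emeasure P {x \<in> space P. ?m + r \<le> F x} = (\<integral>\<^sup>+x. indicator {x \<in> space P. ?m + r \<le> F x} x \<partial>P)"
    by (subst nn_integral_indicator) auto
  also have "\<dots> \<le> (\<integral>\<^sup>+x. ennreal (exp (- l * (?m + r))) * ennreal (exp (l * F x)) \<partial>P)"
  proof (rule nn_integral_mono)
    fix x
    have "1 \<le> exp (- l * (?m + r) + l * F x)" if "?m + r \<le> F x"
      using mult_left_mono[OF that l] by simp
    then show "indicator {x \<in> space P. ?m + r \<le> F x} x \<le> ennreal (exp (- l * (?m + r))) * ennreal (exp (l * F x))"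
      by (auto split: split_indicator simp flip: ennreal_mult exp_add)
  qed
  also have "\<dots> = ennreal (exp (- l * (?m + r))) * (\<integral>\<^sup>+x. ennreal (exp (l * F x)) \<partial>P)"
    by (intro nn_integral_cmult) measurable
  also have "\<dots> \<le> ennreal (exp (- l * (?m + r))) * ennreal (exp (l * ?m + l\<^sup>2 * L\<^sup>2 / 2))"
    using integral_exp_lipschitz_std_normal_PiM[OF J F[unfolded P_def] _ l lip] L
    by (intro mult_left_mono) (auto simp: P_def)
  also have "\<dots> = ennreal (exp (- r\<^sup>2 / (2 * L\<^sup>2)))"
    using L by (simp add: l_def power2_eq_square field_simps flip: ennreal_mult exp_add)
  finally show ?thesis by (simp add: P.emeasure_eq_measure)
qed

subsection \<open>Independence from characteristic functions\<close>

text \<open>Normalized by its integral, w is a probability density, and under it X has the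
  characteristic function of \<mu>; Levy's uniqueness theorem identifies the law. A weight of
  integral zero vanishes almost surely and cannot be normalized, so it is treated apart.\<close>

lemma (in prob_space) weighted_char_determines_distr:
  fixes w X :: "'a \<Rightarrow> real"
  assumes [measurable]: "w \<in> borel_measurable M" "X \<in> borel_measurable M" and \<mu>: "real_distribution \<mu>"
    and w: "\<And>\<omega>. 0 \<le> w \<omega>" "integrable M w"
    and char: "\<And>u. (\<integral>\<omega>. complex_of_real (w \<omega>) * iexp (u * X \<omega>) \<partial>M) = complex_of_real (\<integral>\<omega>. w \<omega> \<partial>M) * char \<mu> u"
    and B[measurable]: "B \<in> sets borel"
  shows "(\<integral>\<omega>. w \<omega> * indicator B (X \<omega>) \<partial>M) = (\<integral>\<omega>. w \<omega> \<partial>M) * measure \<mu> B"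
proof (cases "(\<integral>\<omega>. w \<omega> \<partial>M) = 0")
  case True
  then have "AE \<omega> in M. w \<omega> = 0"
    using integral_nonneg_eq_0_iff_AE[OF w(2)] w(1) by simp
  then have "AE \<omega> in M. w \<omega> * indicator B (X \<omega>) = 0" by eventually_elim simp
  then have "(\<integral>\<omega>. w \<omega> * indicator B (X \<omega>) \<partial>M) = 0" by (rule integral_eq_zero_AE)
  then show ?thesis by (simp add: True)
next
  case False
  define c where "c = (\<integral>\<omega>. w \<omega> \<partial>M)"
  have c: "0 < c" using False w(1) by (simp add: c_def integral_nonneg order_less_le)
  define D where "D = density M (\<lambda>\<omega>. ennreal (w \<omega> / c))"
  have mD[measurable_cong]: "sets D = sets M" by (simp add: D_def)
  have "prob_space D"
  proof
    have "emeasure D (space D) = (\<integral>\<^sup>+\<omega>. ennreal (w \<omega> / c) \<partial>M)"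
      by (simp add: D_def emeasure_density nn_integral_set_ennreal cong: nn_integral_cong)
    also have "\<dots> = ennreal (\<integral>\<omega>. w \<omega> / c \<partial>M)"
      using w c by (intro nn_integral_eq_integral) auto
    also have "\<dots> = 1" using c by (simp add: c_def[symmetric])
    finally show "emeasure D (space D) = 1" .
  qed
  then interpret D: prob_space D .
  have "X \<in> borel_measurable D" by measurable
  then have rd: "real_distribution (distr D borel X)" by (rule D.real_distribution_distr)
  have "char (distr D borel X) = char \<mu>"
  proof
    fix u
    have "char (distr D borel X) u = (\<integral>\<omega>. iexp (u * X \<omega>) \<partial>D)"
      by (simp add: char_def integral_distr)
    also have "\<dots> = (\<integral>\<omega>. (w \<omega> / c) *\<^sub>R iexp (u * X \<omega>) \<partial>M)"
      unfolding D_def using w(1) c by (intro integral_density) auto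
    also have "\<dots> = (\<integral>\<omega>. (complex_of_real (w \<omega>) * iexp (u * X \<omega>)) / c \<partial>M)"
      by (intro Bochner_Integration.integral_cong) (auto simp: scaleR_conv_of_real)
    also have "\<dots> = char \<mu> u"
      using c char[of u] by (simp add: c_def[symmetric])
    finally show "char (distr D borel X) u = char \<mu> u" .
  qed
  then have "distr D borel X = \<mu>" by (intro Levy_uniqueness rd \<mu>)
  then have "measure \<mu> B = measure (distr D borel X) B" by simp
  also have "\<dots> = (\<integral>x. indicator B x \<partial>distr D borel X)" using B by simp
  also have "\<dots> = (\<integral>\<omega>. indicator B (X \<omega>) \<partial>D)"
    using B by (intro integral_distr) measurable
  also have "\<dots> = (\<integral>\<omega>. (w \<omega> / c) *\<^sub>R indicator B (X \<omega>) \<partial>M)"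
    unfolding D_def using w(1) c B by (intro integral_density) auto
  also have "\<dots> = (\<integral>\<omega>. (w \<omega> * indicator B (X \<omega>)) / c \<partial>M)" by simp
  also have "\<dots> = (\<integral>\<omega>. w \<omega> * indicator B (X \<omega>) \<partial>M) / c" by simp
  finally show ?thesis using c by (simp add: c_def[symmetric])
qed

text \<open>A complex weight is no density, but \<open>1 + Re Z\<close> is nonnegative when Z has
  norm at most 1. Its weighted characteristic function follows from those of 1, Z and the conjugate
  of Z; subtracting the result for the constant weight 1 leaves \<open>Re Z\<close>.\<close>

lemma (in prob_space) Re_weighted_char_determines_distr:
  fixes Z :: "'a \<Rightarrow> complex" and X :: "'a \<Rightarrow> real"
  assumes [measurable]: "Z \<in> borel_measurable M" "X \<in> borel_measurable M" and \<mu>: "real_distribution \<mu>"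
    and Z: "\<And>\<omega>. cmod (Z \<omega>) \<le> 1"
    and char: "\<And>u. (\<integral>\<omega>. Z \<omega> * iexp (u * X \<omega>) \<partial>M) = (\<integral>\<omega>. Z \<omega> \<partial>M) * char \<mu> u"
    and char1: "\<And>u. (\<integral>\<omega>. iexp (u * X \<omega>) \<partial>M) = char \<mu> u"
    and B[measurable]: "B \<in> sets borel"
  shows "Re (\<integral>\<omega>. Z \<omega> * indicator B (X \<omega>) \<partial>M) = Re (\<integral>\<omega>. Z \<omega> \<partial>M) * measure \<mu> B"
proof -
  interpret \<mu>: real_distribution \<mu> by fact
  have bdd: "integrable M g" if "g \<in> borel_measurable M" "\<And>\<omega>. cmod (g \<omega>) \<le> 1" for g :: "'a \<Rightarrow> complex"
    using that by (intro integrable_const_bound[of _ 1]) auto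
  have [measurable]: "(\<lambda>\<omega>. cnj (Z \<omega>)) \<in> borel_measurable M"
    by (rule measurable_compose[OF _ borel_measurable_continuous_onI]) (auto intro: continuous_intros)
  have [simp]: "integrable M Z" by (intro bdd Z) measurable
  have [simp]: "integrable M (\<lambda>\<omega>. Re (Z \<omega>))" by (rule integrable_Re) simp
  have iZ: "integrable M (\<lambda>\<omega>. Z \<omega> * iexp (u * X \<omega>))" "integrable M (\<lambda>\<omega>. cnj (Z \<omega>) * iexp (u * X \<omega>))"
    for u
    by (rule bdd, measurable, simp add: norm_mult Z)+
  have iexp: "integrable M (\<lambda>\<omega>. iexp (u * X \<omega>))" for u
    by (rule bdd) auto
  have cnj_char: "cnj (char \<mu> (- u)) = char \<mu> u" for u
    unfolding char_def by (subst Bochner_Integration.integral_cnj[symmetric]) (simp add: exp_cnj del: Bochner_Integration.integral_cnj)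
  have conj: "(\<integral>\<omega>. cnj (Z \<omega>) * iexp (u * X \<omega>) \<partial>M) = cnj (\<integral>\<omega>. Z \<omega> \<partial>M) * char \<mu> u" for u
  proof -
    have "(\<integral>\<omega>. cnj (Z \<omega>) * iexp (u * X \<omega>) \<partial>M) = cnj (\<integral>\<omega>. Z \<omega> * iexp (- u * X \<omega>) \<partial>M)"
      by (subst Bochner_Integration.integral_cnj[symmetric]) (simp add: exp_cnj del: Bochner_Integration.integral_cnj)
    then show ?thesis by (simp only: char complex_cnj_mult cnj_char)
  qed
  have Re_eq: "complex_of_real (1 + Re z) * e = e + (z * e + cnj z * e) / 2" for z e
  proof -
    have "e + (z * e + cnj z * e) / 2 = e + (z + cnj z) * e / 2" by (simp add: algebra_simps)
    then show ?thesis by (simp add: complex_add_cnj algebra_simps)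
  qed
  have "(\<integral>\<omega>. (1 + Re (Z \<omega>)) * indicator B (X \<omega>) \<partial>M) = (\<integral>\<omega>. 1 + Re (Z \<omega>) \<partial>M) * measure \<mu> B"
  proof (rule weighted_char_determines_distr[OF _ _ \<mu> _ _ _ B])
    show "0 \<le> 1 + Re (Z \<omega>)" for \<omega>
      using abs_Re_le_cmod[of "Z \<omega>"] Z[of \<omega>] by linarith
    fix u
    have "(\<integral>\<omega>. complex_of_real (1 + Re (Z \<omega>)) * iexp (u * X \<omega>) \<partial>M)
      = (\<integral>\<omega>. iexp (u * X \<omega>) + (Z \<omega> * iexp (u * X \<omega>) + cnj (Z \<omega>) * iexp (u * X \<omega>)) / 2 \<partial>M)"
      by (simp only: Re_eq)
    also have "\<dots> = (1 + ((\<integral>\<omega>. Z \<omega> \<partial>M) + cnj (\<integral>\<omega>. Z \<omega> \<partial>M)) / 2) * char \<mu> u"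
      using iZ[of u] iexp[of u] char[of u] char1[of u] conj[of u] by (simp add: field_simps)
    also have "1 + ((\<integral>\<omega>. Z \<omega> \<partial>M) + cnj (\<integral>\<omega>. Z \<omega> \<partial>M)) / 2 = complex_of_real (\<integral>\<omega>. 1 + Re (Z \<omega>) \<partial>M)"
      by (simp add: prob_space complex_add_cnj)
    finally show "(\<integral>\<omega>. complex_of_real (1 + Re (Z \<omega>)) * iexp (u * X \<omega>) \<partial>M) =
         complex_of_real (\<integral>\<omega>. 1 + Re (Z \<omega>) \<partial>M) * char \<mu> u" .
  qed auto
  moreover have "(\<integral>\<omega>. 1 * indicator B (X \<omega>) \<partial>M) = (\<integral>\<omega>. 1 \<partial>M) * measure \<mu> B"
    by (rule weighted_char_determines_distr[OF _ _ \<mu> _ _ _ B]) (auto simp: char1[simplified] prob_space)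
  moreover have "integrable M (\<lambda>\<omega>. Re (Z \<omega>) * indicator B (X \<omega>))"
    using B integrable_real_mult_indicator[of "X -` B \<inter> space M" M "\<lambda>\<omega>. Re (Z \<omega>)"]
    by (simp add: indicator_def cong: Bochner_Integration.integrable_cong)
  moreover have "integrable M (\<lambda>\<omega>. indicator B (X \<omega>) :: real)"
    using B by (intro integrable_const_bound[of _ 1]) (auto split: split_indicator)
  ultimately have "(\<integral>\<omega>. Re (Z \<omega>) * indicator B (X \<omega>) \<partial>M) = (\<integral>\<omega>. Re (Z \<omega>) \<partial>M) * measure \<mu> B"
    by (simp add: distrib_right prob_space)
  moreover have "integrable M (\<lambda>\<omega>. Z \<omega> * indicator B (X \<omega>))"
    using B by (intro bdd) (auto split: split_indicator simp: Z)
  then have "Re (\<integral>\<omega>. Z \<omega> * indicator B (X \<omega>) \<partial>M) = (\<integral>\<omega>. Re (Z \<omega> * indicator B (X \<omega>)) \<partial>M)"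
    by (rule integral_Re[symmetric])
  moreover have "Re (Z \<omega> * indicator B (X \<omega>)) = Re (Z \<omega>) * indicator B (X \<omega>)" for \<omega>
    by (simp split: split_indicator)
  ultimately show ?thesis by simp
qed

text \<open>The imaginary part of Z is the real part of \<open>- \<i> * Z\<close>, which has the
  same norm.\<close>

lemma (in prob_space) complex_weighted_char_determines_distr:
  fixes Z :: "'a \<Rightarrow> complex" and X :: "'a \<Rightarrow> real"
  assumes [measurable]: "Z \<in> borel_measurable M" "X \<in> borel_measurable M" and \<mu>: "real_distribution \<mu>"
    and Z: "\<And>\<omega>. cmod (Z \<omega>) \<le> 1"
    and char: "\<And>u. (\<integral>\<omega>. Z \<omega> * iexp (u * X \<omega>) \<partial>M) = (\<integral>\<omega>. Z \<omega> \<partial>M) * char \<mu> u"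
    and char1: "\<And>u. (\<integral>\<omega>. iexp (u * X \<omega>) \<partial>M) = char \<mu> u"
    and B[measurable]: "B \<in> sets borel"
  shows "(\<integral>\<omega>. Z \<omega> * indicator B (X \<omega>) \<partial>M) = (\<integral>\<omega>. Z \<omega> \<partial>M) * complex_of_real (measure \<mu> B)"
proof (rule complex_eqI)
  show "Re (\<integral>\<omega>. Z \<omega> * indicator B (X \<omega>) \<partial>M) = Re ((\<integral>\<omega>. Z \<omega> \<partial>M) * complex_of_real (measure \<mu> B))"
    using Re_weighted_char_determines_distr[OF assms] by simp
  have "Re (\<integral>\<omega>. - \<i> * Z \<omega> * indicator B (X \<omega>) \<partial>M) = Re (\<integral>\<omega>. - \<i> * Z \<omega> \<partial>M) * measure \<mu> B"
    by (rule Re_weighted_char_determines_distr[OF _ _ \<mu> _ _ _ B]) (auto simp: norm_mult Z char[simplified] char1[simplified] mult.assoc)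
  then show "Im (\<integral>\<omega>. Z \<omega> * indicator B (X \<omega>) \<partial>M) = Im ((\<integral>\<omega>. Z \<omega> \<partial>M) * complex_of_real (measure \<mu> B))"
    by (simp add: mult.assoc)
qed

text \<open>Exponentials are exchanged for indicators one coordinate at a time. At each exchange the
  factors of all other coordinates form a complex weight of norm at most 1, to which the preceding
  lemma applies; after the last one the measures of all boxes are known.\<close>

lemma (in prob_space) distr_eq_PiM_if_char_eq_prod:
  fixes X :: "'i \<Rightarrow> 'a \<Rightarrow> real"
  assumes J: "finite J" and X[measurable]: "\<And>i. i \<in> J \<Longrightarrow> X i \<in> borel_measurable M"
    and \<mu>: "\<And>i. real_distribution (\<mu> i)"
    and char: "\<And>u. (\<integral>\<omega>. iexp (\<Sum>i\<in>J. u i * X i \<omega>) \<partial>M) = (\<Prod>i\<in>J. char (\<mu> i) (u i))"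
  shows "distr M (PiM J (\<lambda>_. borel)) (\<lambda>\<omega>. \<lambda>i\<in>J. X i \<omega>) = PiM J \<mu>"
proof -
  interpret \<mu>: real_distribution "\<mu> i" for i by fact
  interpret P: product_sigma_finite \<mu> ..
  have claim: "(\<integral>\<omega>. (\<Prod>i\<in>K. indicator (A i) (X i \<omega>)) * iexp (\<Sum>i\<in>J - K. u i * X i \<omega>) \<partial>M)
      = complex_of_real (\<Prod>i\<in>K. measure (\<mu> i) (A i)) * (\<Prod>i\<in>J - K. char (\<mu> i) (u i))"
    if "K \<subseteq> J" "\<And>i. i \<in> K \<Longrightarrow> A i \<in> sets borel" for K A u
    using finite_subset[OF that(1) J] that
  proof (induction K arbitrary: u rule: finite_induct)
    case empty
    then show ?case using char[of u] by simp
  next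
    case (insert k K)
    have kJ: "k \<in> J - K" "finite (J - K)" and JK: "J - K - {k} = J - insert k K"
      using insert J by auto
    define Z where "Z \<omega> = (\<Prod>i\<in>K. indicator (A i) (X i \<omega>)) * iexp (\<Sum>i\<in>J - insert k K. u i * X i \<omega>)" for \<omega>
    have X'[measurable]: "X k \<in> borel_measurable M" "\<And>i. i \<in> K \<Longrightarrow> X i \<in> borel_measurable M"
      "\<And>i. i \<in> J - insert k K \<Longrightarrow> X i \<in> borel_measurable M"
      "\<And>i. i \<in> K \<Longrightarrow> A i \<in> sets borel"
      using insert X by auto
    have [measurable]: "Z \<in> borel_measurable M"
      unfolding Z_def by measurable
    have Z1: "cmod (Z \<omega>) \<le> 1" for \<omega>
      by (auto simp: Z_def norm_mult prod_norm[symmetric] intro!: prod_le_1 split: split_indicator)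
    have Ze: "(\<integral>\<omega>. Z \<omega> * iexp (v * X k \<omega>) \<partial>M)
      = complex_of_real (\<Prod>i\<in>K. measure (\<mu> i) (A i)) * (\<Prod>i\<in>J - insert k K. char (\<mu> i) (u i)) * char (\<mu> k) v" for v
    proof -
      have "(\<Sum>i\<in>J - K. (u(k := v)) i * X i \<omega>) = v * X k \<omega> + (\<Sum>i\<in>J - insert k K. u i * X i \<omega>)" for \<omega>
        using kJ by (subst sum.remove[of _ k]) (auto simp: JK intro!: sum.cong)
      then have "(\<integral>\<omega>. Z \<omega> * iexp (v * X k \<omega>) \<partial>M) =
        (\<integral>\<omega>. (\<Prod>i\<in>K. indicator (A i) (X i \<omega>)) * iexp (\<Sum>i\<in>J - K. (u(k := v)) i * X i \<omega>) \<partial>M)"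
        by (simp add: Z_def exp_add distrib_left mult_ac del: fun_upd_apply)
      also have "\<dots> = complex_of_real (\<Prod>i\<in>K. measure (\<mu> i) (A i)) * (\<Prod>i\<in>J - K. char (\<mu> i) ((u(k := v)) i))"
        using insert by (intro insert.IH) auto
      also have "(\<Prod>i\<in>J - K. char (\<mu> i) ((u(k := v)) i)) = char (\<mu> k) v * (\<Prod>i\<in>J - insert k K. char (\<mu> i) (u i))"
        using kJ by (subst prod.remove[of _ k]) (auto simp: JK intro!: prod.cong)
      finally show ?thesis by (simp add: mult_ac)
    qed
    have Z0: "(\<integral>\<omega>. Z \<omega> \<partial>M) = complex_of_real (\<Prod>i\<in>K. measure (\<mu> i) (A i)) * (\<Prod>i\<in>J - insert k K. char (\<mu> i) (u i))"
      using Ze[of 0] by (simp add: \<mu>.char_zero)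
    \<comment> \<open>The marginal law is recovered by setting every other frequency to 0, where
      characteristic functions equal 1.\<close>
    have marg: "(\<integral>\<omega>. iexp (v * X k \<omega>) \<partial>M) = char (\<mu> k) v" for v
    proof -
      have "(\<Sum>i\<in>J. ((\<lambda>_. 0)(k := v)) i * X i \<omega>) = v * X k \<omega>" for \<omega>
        using kJ J by (subst sum.remove[of _ k]) (auto intro!: sum.neutral)
      moreover have "(\<Prod>i\<in>J. char (\<mu> i) (((\<lambda>_. 0)(k := v)) i)) = char (\<mu> k) v"
        using kJ J by (subst prod.remove[of _ k]) (auto simp: \<mu>.char_zero intro!: prod.neutral)
      ultimately show ?thesis using char[of "(\<lambda>_. 0)(k := v)"] by (simp del: fun_upd_apply)
    qed
    have "(\<integral>\<omega>. Z \<omega> * indicator (A k) (X k \<omega>) \<partial>M) = (\<integral>\<omega>. Z \<omega> \<partial>M) * complex_of_real (measure (\<mu> k) (A k))"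
      using Ze Z0 insert by (intro complex_weighted_char_determines_distr \<mu> Z1 marg) auto
    then show ?case
      using insert(1,2) by (simp add: Z0) (simp add: Z_def mult_ac)
  qed
  show ?thesis
  proof (rule P.PiM_eqI[OF J])
    show "sets (distr M (Pi\<^sub>M J (\<lambda>_. borel)) (\<lambda>\<omega>. \<lambda>i\<in>J. X i \<omega>)) = sets (Pi\<^sub>M J \<mu>)"
      by (simp, rule sets_PiM_cong) auto
    fix A assume "\<And>i. i \<in> J \<Longrightarrow> A i \<in> sets (\<mu> i)"
    then have A[measurable]: "\<And>i. i \<in> J \<Longrightarrow> A i \<in> sets borel" by simp
    let ?E = "{\<omega> \<in> space M. \<forall>i\<in>J. X i \<omega> \<in> A i}"
    have E[measurable]: "?E \<in> sets M" using J by measurable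
    have "complex_of_real (measure M ?E) = (\<integral>\<omega>. complex_of_real (indicator ?E \<omega>) \<partial>M)"
      by simp
    also have "\<dots> = (\<integral>\<omega>. (\<Prod>i\<in>J. indicator (A i) (X i \<omega>)) \<partial>M)"
      using J by (intro Bochner_Integration.integral_cong refl) (auto simp: indicator_def prod_zero_iff)
    also have "\<dots> = complex_of_real (\<Prod>i\<in>J. measure (\<mu> i) (A i))"
      using claim[of J A] A by simp
    finally have "measure M ?E = (\<Prod>i\<in>J. measure (\<mu> i) (A i))"
      using of_real_eq_iff by blast
    moreover have "(\<lambda>\<omega>. \<lambda>i\<in>J. X i \<omega>) -` Pi\<^sub>E J A \<inter> space M = ?E"
      by (auto simp: PiE_iff)
    ultimately show "emeasure (distr M (Pi\<^sub>M J (\<lambda>_. borel)) (\<lambda>\<omega>. \<lambda>i\<in>J. X i \<omega>)) (Pi\<^sub>E J A) = (\<Prod>i\<in>J. emeasure (\<mu> i) (A i))"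
      using J by (subst emeasure_distr) (auto intro!: sets_PiM_I_finite measurable_restrict
        simp: emeasure_eq_measure \<mu>.emeasure_eq_measure prod_ennreal)
  qed
qed

subsection \<open>Orthonormalization of square-integrable variables\<close>

definition square_integrable :: "'a measure \<Rightarrow> ('a \<Rightarrow> real) \<Rightarrow> bool" where
  "square_integrable M f \<longleftrightarrow> f \<in> borel_measurable M \<and> integrable M (\<lambda>x. (f x)\<^sup>2)"

lemma square_integrable_measurable: "square_integrable M f \<Longrightarrow> f \<in> borel_measurable M"
  by (simp add: square_integrable_def)

lemma square_integrable_integrable_power2: "square_integrable M f \<Longrightarrow> integrable M (\<lambda>x. (f x)\<^sup>2)"
  by (simp add: square_integrable_def)

lemma square_integrable_integrable_mult:
  assumes "square_integrable M f" "square_integrable M g"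
  shows "integrable M (\<lambda>x. f x * g x)"
proof (rule Bochner_Integration.integrable_bound)
  show "integrable M (\<lambda>x. (f x)\<^sup>2 + (g x)\<^sup>2)"
    using assms by (auto simp: square_integrable_def)
  have "\<bar>a * b\<bar> \<le> a\<^sup>2 + b\<^sup>2" for a b :: real
  proof -
    have "2 * (\<bar>a\<bar> * \<bar>b\<bar>) \<le> a\<^sup>2 + b\<^sup>2"
      using zero_le_power2[of "\<bar>a\<bar> - \<bar>b\<bar>"] by (simp add: power2_diff)
    moreover have "0 \<le> \<bar>a\<bar> * \<bar>b\<bar>" by simp
    ultimately show ?thesis unfolding abs_mult by linarith
  qed
  then show "AE x in M. norm (f x * g x) \<le> norm ((f x)\<^sup>2 + (g x)\<^sup>2)" by simp
qed (use assms in \<open>auto simp: square_integrable_def\<close>)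

lemma square_integrable_cmult:
  "square_integrable M f \<Longrightarrow> square_integrable M (\<lambda>x. c * f x)"
  by (auto simp: square_integrable_def power_mult_distrib)

lemma square_integrable_add:
  assumes "square_integrable M f" "square_integrable M g"
  shows "square_integrable M (\<lambda>x. f x + g x)"
  using assms square_integrable_integrable_mult[OF assms]
  by (auto simp: square_integrable_def power2_sum mult.assoc)

lemma square_integrable_sum:
  assumes "\<And>i. i \<in> J \<Longrightarrow> square_integrable M (f i)"
  shows "square_integrable M (\<lambda>x. \<Sum>i\<in>J. f i x)"
  using assms
proof (induction J rule: infinite_finite_induct)
  case (insert i J)
  then show ?case by (simp add: square_integrable_add)
qed (auto simp: square_integrable_def)

lemma (in finite_measure) square_integrable_integrable:
  "square_integrable M f \<Longrightarrow> integrable M f"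
  using square_integrable_integrable_mult[of M f "\<lambda>_. 1"] by (simp add: square_integrable_def)

text \<open>Membership is equality of functions, not almost sure equality: an element over a finite
  index set is literally one of the combinations over which \<open>gaussian_process\<close>
  quantifies.\<close>

definition lin_span :: "'i set \<Rightarrow> ('i \<Rightarrow> 'a \<Rightarrow> real) \<Rightarrow> ('a \<Rightarrow> real) set" where
  "lin_span J X = range (\<lambda>c x. \<Sum>i\<in>J. c i * X i x)"

lemma lin_span_mono:
  assumes "finite K" "J \<subseteq> K"
  shows "lin_span J X \<subseteq> lin_span K X"
proof
  fix Y assume "Y \<in> lin_span J X"
  then obtain c where "Y = (\<lambda>x. \<Sum>i\<in>J. c i * X i x)" by (auto simp: lin_span_def)
  also have "\<dots> = (\<lambda>x. \<Sum>i\<in>K. (if i \<in> J then c i else 0) * X i x)"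
    using assms by (intro ext sum.mono_neutral_cong_left) auto
  finally show "Y \<in> lin_span K X" by (auto simp: lin_span_def)
qed

lemma lin_span_base:
  assumes "finite J" "i \<in> J"
  shows "X i \<in> lin_span J X"
proof -
  have "X i = (\<lambda>x. \<Sum>k\<in>J. (if k = i then 1 else 0) * X k x)"
    using assms by (simp add: mult_delta_left)
  then show ?thesis by (auto simp: lin_span_def)
qed

lemma lin_span_sum:
  assumes "\<And>k. k \<in> K \<Longrightarrow> Y k \<in> lin_span J X"
  shows "(\<lambda>x. \<Sum>k\<in>K. a k * Y k x) \<in> lin_span J X"
proof -
  have "\<forall>k\<in>K. \<exists>c. Y k = (\<lambda>x. \<Sum>i\<in>J. c i * X i x)"
    using assms by (auto simp: lin_span_def)
  then obtain c where c: "\<And>k. k \<in> K \<Longrightarrow> Y k = (\<lambda>x. \<Sum>i\<in>J. c k i * X i x)" by metis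
  have "(\<lambda>x. \<Sum>k\<in>K. a k * Y k x) = (\<lambda>x. \<Sum>i\<in>J. (\<Sum>k\<in>K. a k * c k i) * X i x)"
  proof
    fix x
    have "(\<Sum>k\<in>K. a k * Y k x) = (\<Sum>k\<in>K. \<Sum>i\<in>J. a k * c k i * X i x)"
      by (intro sum.cong) (auto simp: c sum_distrib_left mult.assoc)
    also have "\<dots> = (\<Sum>i\<in>J. (\<Sum>k\<in>K. a k * c k i) * X i x)"
      by (subst sum.swap) (simp add: sum_distrib_right)
    finally show "(\<Sum>k\<in>K. a k * Y k x) = (\<Sum>i\<in>J. (\<Sum>k\<in>K. a k * c k i) * X i x)" .
  qed
  then show ?thesis by (auto simp: lin_span_def)
qed

lemma lin_span_lincomb:
  assumes "Y \<in> lin_span J X" "Z \<in> lin_span J X"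
  shows "(\<lambda>x. a * Y x + b * Z x) \<in> lin_span J X"
  using lin_span_sum[of UNIV "\<lambda>k. if k then Y else Z" J X "\<lambda>k. if k then a else b"] assms
  by (simp add: UNIV_bool add.commute)

lemma square_integrable_lin_span:
  assumes "\<And>i. i \<in> J \<Longrightarrow> square_integrable M (X i)" "Y \<in> lin_span J X"
  shows "square_integrable M Y"
  using assms by (auto simp: lin_span_def intro!: square_integrable_sum square_integrable_cmult)

text \<open>Gram-Schmidt for possibly dependent variables: an index enters \<open>K\<close> only if
  its residual has positive norm. Otherwise the residual vanishes almost surely, which is why the
  representation holds only almost everywhere. The orthonormal variables stay in the span, so joint
  Gaussianity passes to them.\<close>

lemma gram_schmidt_square_integrable:
  assumes J: "finite J" and X: "\<And>i. i \<in> J \<Longrightarrow> square_integrable M (X i)"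
  shows "\<exists>K \<xi> a. K \<subseteq> J \<and> (\<forall>j\<in>K. \<xi> j \<in> lin_span J X) \<and>
    (\<forall>j\<in>K. \<forall>k\<in>K. (\<integral>x. \<xi> j x * \<xi> k x \<partial>M) = (if j = k then 1 else 0)) \<and>
    (\<forall>i\<in>J. AE x in M. X i x = (\<Sum>j\<in>K. a i j * \<xi> j x))" (is "?Q J")
  using J X
proof (induction J rule: finite_induct)
  case empty
  then show ?case by auto
next
  case (insert i J)
  have IH: "?Q J" by (rule insert.IH) (simp add: insert.prems)
  obtain K \<xi> a where KJ: "K \<subseteq> J" and sp0: "\<forall>j\<in>K. \<xi> j \<in> lin_span J X"
    and orth0: "\<forall>j\<in>K. \<forall>k\<in>K. (\<integral>x. \<xi> j x * \<xi> k x \<partial>M) = (if j = k then 1 else 0)"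
    and rep0: "\<forall>i\<in>J. AE x in M. X i x = (\<Sum>j\<in>K. a i j * \<xi> j x)"
    using IH by (elim exE conjE) (rule that)
  note sp = bspec[OF sp0] and orth = bspec[OF bspec[OF orth0]] and rep = bspec[OF rep0]
  have K: "finite K" "i \<notin> K" using KJ insert finite_subset by auto
  have sp': "\<xi> j \<in> lin_span (insert i J) X" if "j \<in> K" for j
    using sp[OF that] lin_span_mono[of "insert i J" J X] insert(1) by auto
  have sq: "square_integrable M (\<xi> j)" if "j \<in> K" for j
    using square_integrable_lin_span[OF insert.prems sp'[OF that]] by simp
  define \<alpha> where "\<alpha> j = (\<integral>x. X i x * \<xi> j x \<partial>M)" for j
  define r where "r x = X i x - (\<Sum>j\<in>K. \<alpha> j * \<xi> j x)" for x
  have r_span: "r \<in> lin_span (insert i J) X"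
  proof -
    have "(\<lambda>x. 1 * X i x + (- 1) * (\<Sum>j\<in>K. \<alpha> j * \<xi> j x)) \<in> lin_span (insert i J) X"
      using insert(1) sp' by (intro lin_span_lincomb lin_span_base lin_span_sum) auto
    also have "(\<lambda>x. 1 * X i x + (- 1) * (\<Sum>j\<in>K. \<alpha> j * \<xi> j x)) = r"
      by (auto simp: r_def)
    finally show ?thesis .
  qed
  have r_sq: "square_integrable M r"
    using square_integrable_lin_span[OF insert.prems r_span] by simp
  have r_orth: "(\<integral>x. r x * \<xi> k x \<partial>M) = 0" if k: "k \<in> K" for k
  proof -
    have "(\<integral>x. r x * \<xi> k x \<partial>M) = (\<integral>x. X i x * \<xi> k x - (\<Sum>j\<in>K. \<alpha> j * (\<xi> j x * \<xi> k x)) \<partial>M)"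
      by (simp add: r_def left_diff_distrib sum_distrib_right mult.assoc)
    also have "\<dots> = \<alpha> k - (\<Sum>j\<in>K. \<alpha> j * (if j = k then 1 else 0))"
      using k sq insert.prems orth
      by (simp add: square_integrable_integrable_mult \<alpha>_def cong: sum.cong)
    also have "\<dots> = 0" using k K by (simp add: mult_delta_right)
    finally show ?thesis .
  qed
  show ?case
  proof (cases "(\<integral>x. (r x)\<^sup>2 \<partial>M) = 0")
    case True
    then have "AE x in M. (r x)\<^sup>2 = 0"
      using r_sq by (subst integral_nonneg_eq_0_iff_AE[symmetric]) (auto simp: square_integrable_def)
    then have "AE x in M. X i x = (\<Sum>j\<in>K. \<alpha> j * \<xi> j x)"
      by eventually_elim (simp add: r_def)
    then show ?thesis
      using KJ sp' orth rep insert(2) by (intro exI[of _ K] exI[of _ \<xi>] exI[of _ "a(i := \<alpha>)"]) auto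
  next
    case False
    define s where "s = sqrt (\<integral>x. (r x)\<^sup>2 \<partial>M)"
    have s: "0 < s" "s * s = (\<integral>x. (r x)\<^sup>2 \<partial>M)"
      using False by (auto simp: s_def integral_nonneg order_less_le)
    define \<xi>' where "\<xi>' = \<xi>(i := \<lambda>x. r x / s)"
    have "\<xi>' j \<in> lin_span (insert i J) X" if "j \<in> insert i K" for j
      using sp' that lin_span_lincomb[OF r_span r_span, of "1/s" 0] by (auto simp: \<xi>'_def)
    moreover have "(\<integral>x. \<xi>' j x * \<xi>' k x \<partial>M) = (if j = k then 1 else 0)"
      if "j \<in> insert i K" "k \<in> insert i K" for j k
    proof -
      have "(\<integral>x. r x / s * (r x / s) \<partial>M) = (\<integral>x. (r x)\<^sup>2 \<partial>M) / (s * s)"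
        by (simp add: power2_eq_square)
      also have "\<dots> = 1" using s(1) by (simp flip: s(2))
      finally have "(\<integral>x. r x / s * (r x / s) \<partial>M) = 1" .
      moreover have "(\<integral>x. \<xi> j x * (r x / s) \<partial>M) = 0" if "j \<in> K" for j
        using r_orth[OF that] by (simp add: mult.commute)
      ultimately show ?thesis
        using that K orth r_orth by (auto simp: \<xi>'_def)
    qed
    \<comment> \<open>On the new unit vector \<open>X i\<close> has coefficient \<open>s\<close>,
      the norm of its residual. Earlier variables get coefficient 0 there, since
      \<open>a k i\<close> is arbitrary while \<open>i\<close> lies outside
      \<open>K\<close>.\<close>
    moreover have "AE x in M. X k x = (\<Sum>j\<in>insert i K. (if k = i then \<alpha>(i := s) else (a k)(i := 0)) j * \<xi>' j x)"
      if k: "k \<in> insert i J" for k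
    proof (cases "k = i")
      case True
      have "(\<Sum>j\<in>K. (\<alpha>(i := s)) j * \<xi>' j x) = (\<Sum>j\<in>K. \<alpha> j * \<xi> j x)" for x
        using K by (intro sum.cong) (auto simp: \<xi>'_def)
      then show ?thesis using K s True by (simp add: \<xi>'_def r_def)
    next
      case False
      have "(\<Sum>j\<in>K. ((a k)(i := 0)) j * \<xi>' j x) = (\<Sum>j\<in>K. a k j * \<xi> j x)" for x
        using K by (intro sum.cong) (auto simp: \<xi>'_def)
      then show ?thesis using K False rep[of k] k by simp
    qed
    ultimately show ?thesis
      using KJ by (intro exI[of _ "insert i K"] exI[of _ \<xi>'] exI[of _ "\<lambda>k. if k = i then \<alpha>(i := s) else (a k)(i := 0)"]) auto
  qed
qed

text \<open>A rotation by the unit number \<theta> makes the sum real, with coefficients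
  \<open>Re (\<theta> * z j)\<close>. Their squares are half of \<open>(cmod (z j))\<^sup>2\<close>
  plus half of the real part of a multiple of \<open>(z j)\<^sup>2\<close>; the latter sum to zero,
  which produces the factor 1/2 before Cauchy-Schwarz.\<close>

lemma norm_sum_isotropic_le:
  fixes z :: "'i \<Rightarrow> complex" and x :: "'i \<Rightarrow> real"
  assumes "(\<Sum>j\<in>K. (z j)\<^sup>2) = 0"
  shows "cmod (\<Sum>j\<in>K. z j * complex_of_real (x j)) \<le> sqrt ((\<Sum>j\<in>K. (cmod (z j))\<^sup>2) / 2) * sqrt (\<Sum>j\<in>K. (x j)\<^sup>2)"
proof -
  define w where "w = (\<Sum>j\<in>K. z j * complex_of_real (x j))"
  define \<theta> where "\<theta> = (if w = 0 then 1 else cnj w / cmod w)"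
  have \<theta>: "cmod \<theta> = 1" "\<theta> * w = cmod w"
    by (auto simp: \<theta>_def norm_divide complex_norm_square[symmetric] power2_eq_square mult.commute[of "cnj w"])
  have Re2: "(Re v)\<^sup>2 = ((cmod v)\<^sup>2 + Re (v\<^sup>2)) / 2" for v :: complex
    unfolding cmod_power2 by (simp add: power2_eq_square)
  have "(\<Sum>j\<in>K. (Re (\<theta> * z j))\<^sup>2) = (\<Sum>j\<in>K. ((cmod (z j))\<^sup>2 + Re (\<theta>\<^sup>2 * (z j)\<^sup>2)) / 2)"
    by (simp only: Re2 norm_mult power_mult_distrib \<theta>(1) power_one mult_1_left)
  also have "\<dots> = ((\<Sum>j\<in>K. (cmod (z j))\<^sup>2) + Re (\<theta>\<^sup>2 * (\<Sum>j\<in>K. (z j)\<^sup>2))) / 2"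
    by (simp add: sum_divide_distrib[symmetric] sum.distrib sum_distrib_left)
  finally have sq: "(\<Sum>j\<in>K. (Re (\<theta> * z j))\<^sup>2) = (\<Sum>j\<in>K. (cmod (z j))\<^sup>2) / 2"
    using assms by simp
  have "cmod w = Re (\<theta> * w)" by (simp add: \<theta>(2))
  also have "\<dots> = (\<Sum>j\<in>K. Re (\<theta> * z j) * x j)"
    by (simp add: w_def sum_distrib_left mult.assoc[symmetric])
  also have "\<dots> \<le> sqrt ((\<Sum>j\<in>K. Re (\<theta> * z j) * x j)\<^sup>2)" by simp
  also have "\<dots> \<le> sqrt ((\<Sum>j\<in>K. (Re (\<theta> * z j))\<^sup>2) * (\<Sum>j\<in>K. (x j)\<^sup>2))"
    by (intro real_sqrt_le_mono Cauchy_Schwarz_ineq_sum)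
  finally show ?thesis by (simp only: sq w_def real_sqrt_mult)
qed

subsection \<open>Concentration for circular Gaussian families\<close>

lemma Max_insert_0_image_le_add:
  fixes f g :: "'s \<Rightarrow> real"
  assumes "finite S" "0 \<le> C" "\<And>s. s \<in> S \<Longrightarrow> f s \<le> g s + C"
  shows "Max (insert 0 (f ` S)) \<le> Max (insert 0 (g ` S)) + C"
proof -
  have "0 \<le> Max (insert 0 (g ` S))" using assms by (intro Max_ge) auto
  moreover have "f s \<le> Max (insert 0 (g ` S)) + C" if "s \<in> S" for s
  proof -
    have "g s \<le> Max (insert 0 (g ` S))" using assms(1) that by (intro Max_ge) auto
    then show ?thesis using assms(3)[OF that] by linarith
  qed
  ultimately show ?thesis
    using assms(1,2) by (subst Max_le_iff) auto
qed

text \<open>Inserting 0 gives the maximum a value for empty \<open>S\<close>, as happens when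
  \<open>I\<close> contains all scales, and otherwise changes nothing because norms are
  nonnegative.\<close>

definition norm_max :: "('s \<Rightarrow> complex) \<Rightarrow> 's \<Rightarrow> 's set \<Rightarrow> real" where
  "norm_max w s\<^sub>0 S = cmod (w s\<^sub>0) + Max (insert 0 ((\<lambda>s. cmod (w s)) ` S))"

lemma norm_max_measurable[measurable (raw)]:
  assumes "finite S" and [measurable]: "\<And>s. s \<in> insert s\<^sub>0 S \<Longrightarrow> (\<lambda>x. w x s) \<in> borel_measurable M"
  shows "(\<lambda>x. norm_max (w x) s\<^sub>0 S) \<in> borel_measurable M"
proof -
  have "(\<lambda>x. Max (insert 0 ((\<lambda>s. cmod (w x s)) ` S))) \<in> borel_measurable M"
    using assms
  proof (induction S rule: finite_induct)
    case (insert s S)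
    have "Max (insert 0 ((\<lambda>s. cmod (w x s)) ` insert s S)) = max (cmod (w x s)) (Max (insert 0 ((\<lambda>s. cmod (w x s)) ` S)))" for x
      using insert(1) by (simp add: insert_commute[of 0])
    moreover have "(\<lambda>x. Max (insert 0 ((\<lambda>s. cmod (w x s)) ` S))) \<in> borel_measurable M"
      using insert by auto
    moreover have "(\<lambda>x. w x s) \<in> borel_measurable M"
      using insert.prems by simp
    ultimately show ?case by simp
  qed simp
  then show ?thesis unfolding norm_max_def using assms by (intro borel_measurable_add) auto
qed

lemma norm_max_nonneg: "finite S \<Longrightarrow> 0 \<le> norm_max w s\<^sub>0 S"
  unfolding norm_max_def by (intro add_nonneg_nonneg Max_ge) auto

lemma norm_max_le_sum:
  assumes "finite S"
  shows "norm_max w s\<^sub>0 S \<le> cmod (w s\<^sub>0) + (\<Sum>s\<in>S. cmod (w s))"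
proof -
  have "cmod (w s) \<le> (\<Sum>s\<in>S. cmod (w s))" if "s \<in> S" for s
    using assms that by (intro member_le_sum) auto
  moreover have "0 \<le> (\<Sum>s\<in>S. cmod (w s))" by (intro sum_nonneg) auto
  ultimately show ?thesis
    unfolding norm_max_def using assms by (intro add_left_mono, subst Max_le_iff) auto
qed

text \<open>
  The characteristic-function hypothesis says that the family is centred and jointly Gaussian.
  Circularity (\<open>E[W s\<^sup>2] = 0\<close>) halves the variance of every real projection, whence
  \<open>(\<sigma>\<^sub>0 + \<sigma>)\<^sup>2\<close> instead of \<open>2 (\<sigma>\<^sub>0 + \<sigma>)\<^sup>2\<close> in the exponent.
\<close>
theorem (in prob_space) circular_gaussian_norm_max_concentration:
  fixes W :: "'s \<Rightarrow> 'a \<Rightarrow> complex"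
  assumes S: "finite S"
    and sq: "\<And>s. s \<in> insert s\<^sub>0 S \<Longrightarrow> square_integrable M (\<lambda>\<omega>. Re (W s \<omega>))"
      "\<And>s. s \<in> insert s\<^sub>0 S \<Longrightarrow> square_integrable M (\<lambda>\<omega>. Im (W s \<omega>))"
    and gauss: "\<And>c. (\<integral>\<omega>. iexp (Re (\<Sum>s\<in>insert s\<^sub>0 S. c s * W s \<omega>)) \<partial>M)
        = exp (- (\<integral>\<omega>. (Re (\<Sum>s\<in>insert s\<^sub>0 S. c s * W s \<omega>))\<^sup>2 \<partial>M) / 2)"
    and circular: "\<And>s. s \<in> insert s\<^sub>0 S \<Longrightarrow> (\<integral>\<omega>. (W s \<omega>)\<^sup>2 \<partial>M) = 0"
    and sd0: "sqrt (\<integral>\<omega>. (cmod (W s\<^sub>0 \<omega>))\<^sup>2 \<partial>M) \<le> \<sigma>\<^sub>0"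
    and sd: "\<And>s. s \<in> S \<Longrightarrow> sqrt (\<integral>\<omega>. (cmod (W s \<omega>))\<^sup>2 \<partial>M) \<le> \<sigma>"
    and \<sigma>: "0 \<le> \<sigma>" "0 < \<sigma>\<^sub>0 + \<sigma>" and r: "0 \<le> r"
  shows "prob {\<omega> \<in> space M. expectation (\<lambda>\<omega>. norm_max (\<lambda>s. W s \<omega>) s\<^sub>0 S) + r \<le> norm_max (\<lambda>s. W s \<omega>) s\<^sub>0 S}
    \<le> exp (- (r\<^sup>2 / (\<sigma>\<^sub>0 + \<sigma>)\<^sup>2))"
proof -
  let ?T = "insert s\<^sub>0 S"
  \<comment> \<open>Real and imaginary parts become separate real variables, with
    \<open>True\<close> marking the real part.\<close>
  define J where "J = ?T \<times> (UNIV :: bool set)"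
  define X where "X p = (if snd p then (\<lambda>\<omega>. Re (W (fst p) \<omega>)) else (\<lambda>\<omega>. Im (W (fst p) \<omega>)))" for p
  have J: "finite J" using S by (simp add: J_def)
  have Xsq: "square_integrable M (X p)" if "p \<in> J" for p
    using sq that by (cases p) (auto simp: J_def X_def)
  obtain K \<xi> a where KJ: "K \<subseteq> J" and span0: "\<forall>j\<in>K. \<xi> j \<in> lin_span J X"
    and orth0: "\<forall>j\<in>K. \<forall>k\<in>K. (\<integral>x. \<xi> j x * \<xi> k x \<partial>M) = (if j = k then 1 else 0)"
    and rep0: "\<forall>i\<in>J. AE x in M. X i x = (\<Sum>j\<in>K. a i j * \<xi> j x)"
    by (rule exE[OF gram_schmidt_square_integrable[OF J Xsq]], assumption) (elim exE conjE, rule that)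
  note span = bspec[OF span0] and orth = bspec[OF bspec[OF orth0]] and rep = bspec[OF rep0]
  have K: "finite K" using KJ J by (rule finite_subset)
  have \<xi>sq: "square_integrable M (\<xi> j)" if "j \<in> K" for j
    using square_integrable_lin_span[OF Xsq span[OF that]] .
  have \<xi>m[measurable]: "\<xi> j \<in> borel_measurable M" if "j \<in> K" for j
    using \<xi>sq[OF that] by (rule square_integrable_measurable)
  have int_comb: "(\<integral>x. (\<Sum>j\<in>K. u j * \<xi> j x) * (\<Sum>j\<in>K. v j * \<xi> j x) \<partial>M) = (\<Sum>j\<in>K. u j * v j)" for u v
  proof -
    have "(\<integral>x. (\<Sum>j\<in>K. u j * \<xi> j x) * (\<Sum>j\<in>K. v j * \<xi> j x) \<partial>M)
        = (\<integral>x. (\<Sum>j\<in>K. \<Sum>k\<in>K. (u j * v k) * (\<xi> j x * \<xi> k x)) \<partial>M)"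
      by (simp add: sum_product mult_ac)
    also have "\<dots> = (\<Sum>j\<in>K. \<Sum>k\<in>K. (u j * v k) * (if j = k then 1 else 0))"
      using \<xi>sq by (simp add: square_integrable_integrable_mult orth cong: sum.cong)
    also have "\<dots> = (\<Sum>j\<in>K. u j * v j)"
      using K by (intro sum.cong refl) (simp add: mult_delta_right)
    finally show ?thesis .
  qed
  define z where "z s j = Complex (a (s, True) j) (a (s, False) j)" for s j
  have W_rep: "AE \<omega> in M. W s \<omega> = (\<Sum>j\<in>K. z s j * complex_of_real (\<xi> j \<omega>))" if "s \<in> ?T" for s
  proof -
    have "(s, True) \<in> J" "(s, False) \<in> J" using that by (auto simp: J_def)
    from rep[OF this(1)] rep[OF this(2)] show ?thesis
      by eventually_elim (simp add: X_def z_def complex_eq_iff)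
  qed
  have char\<xi>: "(\<integral>\<omega>. iexp (\<Sum>j\<in>K. u j * \<xi> j \<omega>) \<partial>M) = (\<Prod>j\<in>K. char std_normal_distribution (u j))" for u
  proof -
    obtain b where b: "(\<lambda>\<omega>. \<Sum>j\<in>K. u j * \<xi> j \<omega>) = (\<lambda>\<omega>. \<Sum>p\<in>J. b p * X p \<omega>)"
      using lin_span_sum[of K \<xi> J X u] span by (auto simp: lin_span_def)
    \<comment> \<open>The minus sign compensates the one in Re (c w) = Re c Re w - Im c Im w, so
      every real combination of real and imaginary parts has the form covered by the Gaussian
      hypothesis.\<close>
    define c where "c s = Complex (b (s, True)) (- b (s, False))" for s
    have "(\<Sum>p\<in>J. b p * X p \<omega>) = Re (\<Sum>s\<in>?T. c s * W s \<omega>)" for \<omega>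
      unfolding J_def sum.cartesian_product' Re_sum
      by (intro sum.cong) (simp_all add: UNIV_bool X_def c_def)
    then have eq: "(\<Sum>j\<in>K. u j * \<xi> j \<omega>) = Re (\<Sum>s\<in>?T. c s * W s \<omega>)" for \<omega>
      using fun_cong[OF b] by simp
    have "(\<integral>\<omega>. iexp (\<Sum>j\<in>K. u j * \<xi> j \<omega>) \<partial>M) = exp (- (\<integral>\<omega>. (\<Sum>j\<in>K. u j * \<xi> j \<omega>)\<^sup>2 \<partial>M) / 2)"
      unfolding eq by (rule gauss)
    also have "(\<integral>\<omega>. (\<Sum>j\<in>K. u j * \<xi> j \<omega>)\<^sup>2 \<partial>M) = (\<Sum>j\<in>K. (u j)\<^sup>2)"
      using int_comb[of u u] by (simp add: power2_eq_square)
    also have "exp (- (\<Sum>j\<in>K. (u j)\<^sup>2) / 2) = (\<Prod>j\<in>K. exp (- (u j)\<^sup>2 / 2))"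
      using K by (simp add: sum_divide_distrib flip: exp_sum sum_negf)
    also have "complex_of_real (\<Prod>j\<in>K. exp (- (u j)\<^sup>2 / 2)) = (\<Prod>j\<in>K. char std_normal_distribution (u j))"
      by (simp only: char_std_normal_distribution of_real_prod)
    finally show ?thesis .
  qed
  let ?P = "PiM K (\<lambda>_. std_normal_distribution)"
  have sP: "sets ?P = sets (PiM K (\<lambda>_. borel))" by (rule sets_PiM_cong) auto
  define \<Xi> where "\<Xi> \<omega> = (\<lambda>j\<in>K. \<xi> j \<omega>)" for \<omega>
  have [measurable]: "\<Xi> \<in> M \<rightarrow>\<^sub>M PiM K (\<lambda>_. borel)" unfolding \<Xi>_def by measurable
  have distr: "distr M (PiM K (\<lambda>_. borel)) \<Xi> = ?P"
    unfolding \<Xi>_def using K \<xi>m char\<xi> real_dist_normal_dist by (intro distr_eq_PiM_if_char_eq_prod) auto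
  define F where "F x = norm_max (\<lambda>s. \<Sum>j\<in>K. z s j * complex_of_real (x j)) s\<^sub>0 S" for x
  have F[measurable]: "F \<in> borel_measurable (PiM K (\<lambda>_. borel))"
    unfolding F_def using S by measurable
  have AE_F: "AE \<omega> in M. norm_max (\<lambda>s. W s \<omega>) s\<^sub>0 S = F (\<Xi> \<omega>)"
  proof -
    have "AE \<omega> in M. \<forall>s\<in>?T. W s \<omega> = (\<Sum>j\<in>K. z s j * complex_of_real (\<xi> j \<omega>))"
      using S W_rep by (intro AE_finite_allI) auto
    then show ?thesis
    proof eventually_elim
      case (elim \<omega>)
      have "(\<Sum>j\<in>K. z s j * complex_of_real (\<Xi> \<omega> j)) = (\<Sum>j\<in>K. z s j * complex_of_real (\<xi> j \<omega>))" for s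
        by (intro sum.cong) (auto simp: \<Xi>_def)
      then show ?case using elim by (auto simp: F_def norm_max_def cong: image_cong)
    qed
  qed
  have Wm[measurable]: "W s \<in> borel_measurable M" if "s \<in> ?T" for s
    using sq[OF that] by (simp add: square_integrable_def borel_measurable_complex_iff)
  have cmod_int: "integrable M (\<lambda>\<omega>. cmod (W s \<omega>))" if "s \<in> ?T" for s
  proof (rule Bochner_Integration.integrable_bound)
    show "integrable M (\<lambda>\<omega>. \<bar>Re (W s \<omega>)\<bar> + \<bar>Im (W s \<omega>)\<bar>)"
      using square_integrable_integrable[OF sq(1)[OF that]] square_integrable_integrable[OF sq(2)[OF that]]
      by simp
    show "AE \<omega> in M. norm (cmod (W s \<omega>)) \<le> norm (\<bar>Re (W s \<omega>)\<bar> + \<bar>Im (W s \<omega>)\<bar>)"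
      using cmod_le[of "W s _"] by simp
  qed (use that in measurable)
  have G_int: "integrable M (\<lambda>\<omega>. norm_max (\<lambda>s. W s \<omega>) s\<^sub>0 S)"
  proof (rule Bochner_Integration.integrable_bound)
    show "integrable M (\<lambda>\<omega>. cmod (W s\<^sub>0 \<omega>) + (\<Sum>s\<in>S. cmod (W s \<omega>)))"
      using cmod_int by auto
    show "AE \<omega> in M. norm (norm_max (\<lambda>s. W s \<omega>) s\<^sub>0 S) \<le> norm (cmod (W s\<^sub>0 \<omega>) + (\<Sum>s\<in>S. cmod (W s \<omega>)))"
      using norm_max_le_sum[OF S] norm_max_nonneg[OF S] by (auto simp: sum_nonneg intro!: abs_leI order_trans[OF _ abs_ge_self] )
  qed (use S in measurable)
  have G_m[measurable]: "(\<lambda>\<omega>. norm_max (\<lambda>s. W s \<omega>) s\<^sub>0 S) \<in> borel_measurable M"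
    using G_int by simp
  have F\<Xi>[measurable]: "(\<lambda>\<omega>. F (\<Xi> \<omega>)) \<in> borel_measurable M" by measurable
  have F_int: "integrable ?P F"
    unfolding distr[symmetric]
    using integrable_cong_AE[THEN iffD1, OF G_m F\<Xi> AE_F G_int] by (subst integrable_distr_eq) auto
  have EF: "(\<integral>x. F x \<partial>?P) = expectation (\<lambda>\<omega>. norm_max (\<lambda>s. W s \<omega>) s\<^sub>0 S)"
    unfolding distr[symmetric] using integral_cong_AE[OF G_m F\<Xi> AE_F] by (subst integral_distr) auto
  \<comment> \<open>Orthonormality turns the second moments of \<open>W s\<close> into sums over its
    coefficients, so circularity becomes isotropy of the coefficient vector.\<close>
  have isotropic: "(\<Sum>j\<in>K. (z s j)\<^sup>2) = 0"
    and variance: "(\<Sum>j\<in>K. (cmod (z s j))\<^sup>2) = (\<integral>\<omega>. (cmod (W s \<omega>))\<^sup>2 \<partial>M)" if s: "s \<in> ?T" for s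
  proof -
    let ?a = "\<lambda>j. a (s, True) j" and ?b = "\<lambda>j. a (s, False) j"
    let ?R = "\<lambda>\<omega>. \<Sum>j\<in>K. ?a j * \<xi> j \<omega>" and ?I = "\<lambda>\<omega>. \<Sum>j\<in>K. ?b j * \<xi> j \<omega>"
    have W: "AE \<omega> in M. W s \<omega> = Complex (?R \<omega>) (?I \<omega>)"
      using W_rep[OF s] by eventually_elim (simp add: z_def complex_eq_iff)
    have sqRI: "square_integrable M ?R" "square_integrable M ?I"
      using \<xi>sq by (auto intro!: square_integrable_sum square_integrable_cmult)
    note [simp] = square_integrable_integrable_mult[OF sqRI(1) sqRI(1)] square_integrable_integrable_mult[OF sqRI(1) sqRI(2)]
      square_integrable_integrable_mult[OF sqRI(2) sqRI(2)]
    have [measurable]: "?R \<in> borel_measurable M" "?I \<in> borel_measurable M"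
      using sqRI by (auto simp: square_integrable_def)
    have "0 = (\<integral>\<omega>. (W s \<omega>)\<^sup>2 \<partial>M)" using circular[OF s] by simp
    also have "\<dots> = (\<integral>\<omega>. complex_of_real (?R \<omega> * ?R \<omega> - ?I \<omega> * ?I \<omega>) + \<i> * complex_of_real (2 * (?R \<omega> * ?I \<omega>)) \<partial>M)"
    proof (rule integral_cong_AE)
      show "AE \<omega> in M. (W s \<omega>)\<^sup>2 = complex_of_real (?R \<omega> * ?R \<omega> - ?I \<omega> * ?I \<omega>) + \<i> * complex_of_real (2 * (?R \<omega> * ?I \<omega>))"
        using W by eventually_elim (simp add: power2_eq_square complex_eq_iff)
    qed (use s in measurable)
    also have "\<dots> = complex_of_real (\<integral>\<omega>. ?R \<omega> * ?R \<omega> - ?I \<omega> * ?I \<omega> \<partial>M) + \<i> * complex_of_real (\<integral>\<omega>. 2 * (?R \<omega> * ?I \<omega>) \<partial>M)"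
      by (simp only: Bochner_Integration.integral_add integral_mult_right_zero integral_complex_of_real
         integrable_mult_right complex_of_real_integrable_eq Bochner_Integration.integrable_diff
         square_integrable_integrable_mult[OF sqRI(1) sqRI(1)] square_integrable_integrable_mult[OF sqRI(1) sqRI(2)]
         square_integrable_integrable_mult[OF sqRI(2) sqRI(2)])
    also have "\<dots> = complex_of_real ((\<Sum>j\<in>K. ?a j * ?a j) - (\<Sum>j\<in>K. ?b j * ?b j)) + \<i> * complex_of_real (2 * (\<Sum>j\<in>K. ?a j * ?b j))"
      by (simp only: Bochner_Integration.integral_diff integral_mult_right_zero int_comb
         square_integrable_integrable_mult[OF sqRI(1) sqRI(1)] square_integrable_integrable_mult[OF sqRI(2) sqRI(2)])
    finally have "(\<Sum>j\<in>K. ?a j * ?a j) - (\<Sum>j\<in>K. ?b j * ?b j) = 0" "(\<Sum>j\<in>K. ?a j * ?b j) = 0"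
      by (simp_all add: complex_eq_iff)
    then show "(\<Sum>j\<in>K. (z s j)\<^sup>2) = 0"
      by (simp add: complex_eq_iff z_def power2_eq_square sum_subtractf sum.distrib mult.commute
          flip: sum_distrib_left)
    have "(\<integral>\<omega>. (cmod (W s \<omega>))\<^sup>2 \<partial>M) = (\<integral>\<omega>. ?R \<omega> * ?R \<omega> + ?I \<omega> * ?I \<omega> \<partial>M)"
    proof (rule integral_cong_AE)
      show "AE \<omega> in M. (cmod (W s \<omega>))\<^sup>2 = ?R \<omega> * ?R \<omega> + ?I \<omega> * ?I \<omega>"
        using W by eventually_elim (simp only: cmod_power2 complex.sel, simp add: power2_eq_square)
    qed (use s in measurable)
    also have "\<dots> = (\<Sum>j\<in>K. ?a j * ?a j) + (\<Sum>j\<in>K. ?b j * ?b j)"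
      by (simp only: Bochner_Integration.integral_add int_comb
         square_integrable_integrable_mult[OF sqRI(1) sqRI(1)] square_integrable_integrable_mult[OF sqRI(2) sqRI(2)])
    also have "\<dots> = (\<Sum>j\<in>K. (cmod (z s j))\<^sup>2)"
      by (simp only: z_def cmod_power2 complex.sel sum.distrib, simp add: power2_eq_square)
    finally show "(\<Sum>j\<in>K. (cmod (z s j))\<^sup>2) = (\<integral>\<omega>. (cmod (W s \<omega>))\<^sup>2 \<partial>M)" ..
  qed
  \<comment> \<open>Isotropy gives each norm a Lipschitz constant equal to its standard deviation
    over \<open>sqrt 2\<close>. The root cancels the 2 in the exponent of the general concentration
    bound.\<close>
  define L where "L = (\<sigma>\<^sub>0 + \<sigma>) / sqrt 2"
  have lip: "F y - F x \<le> L * sqrt (\<Sum>j\<in>K. (x j - y j)\<^sup>2)" for x y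
  proof -
    let ?d = "sqrt (\<Sum>j\<in>K. (x j - y j)\<^sup>2)"
    have d: "0 \<le> ?d" by (simp add: sum_nonneg)
    have diff: "cmod (\<Sum>j\<in>K. z s j * complex_of_real (y j)) \<le> cmod (\<Sum>j\<in>K. z s j * complex_of_real (x j)) + \<tau> / sqrt 2 * ?d"
      if "s \<in> ?T" "sqrt (\<integral>\<omega>. (cmod (W s \<omega>))\<^sup>2 \<partial>M) \<le> \<tau>" for s \<tau>
    proof -
      have "cmod (\<Sum>j\<in>K. z s j * complex_of_real (y j)) - cmod (\<Sum>j\<in>K. z s j * complex_of_real (x j))
        \<le> cmod ((\<Sum>j\<in>K. z s j * complex_of_real (y j)) - (\<Sum>j\<in>K. z s j * complex_of_real (x j)))"
        by (rule norm_triangle_ineq2)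
      also have "(\<Sum>j\<in>K. z s j * complex_of_real (y j)) - (\<Sum>j\<in>K. z s j * complex_of_real (x j))
         = (\<Sum>j\<in>K. z s j * complex_of_real (y j - x j))"
        by (simp add: sum_subtractf[symmetric] right_diff_distrib)
      also have "cmod \<dots> \<le> sqrt ((\<Sum>j\<in>K. (cmod (z s j))\<^sup>2) / 2) * sqrt (\<Sum>j\<in>K. (y j - x j)\<^sup>2)"
        by (rule norm_sum_isotropic_le[OF isotropic[OF that(1)]])
      also have "(\<Sum>j\<in>K. (y j - x j)\<^sup>2) = (\<Sum>j\<in>K. (x j - y j)\<^sup>2)" by (simp add: power2_commute)
      also have "sqrt ((\<Sum>j\<in>K. (cmod (z s j))\<^sup>2) / 2) * ?d \<le> \<tau> / sqrt 2 * ?d"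
        using that(2) d by (intro mult_right_mono) (simp_all add: variance[OF that(1)] real_sqrt_divide divide_right_mono)
      finally show ?thesis by simp
    qed
    have "F y \<le> F x + (\<sigma>\<^sub>0 / sqrt 2 * ?d + \<sigma> / sqrt 2 * ?d)"
    proof -
      have "Max (insert 0 ((\<lambda>s. cmod (\<Sum>j\<in>K. z s j * complex_of_real (y j))) ` S))
        \<le> Max (insert 0 ((\<lambda>s. cmod (\<Sum>j\<in>K. z s j * complex_of_real (x j))) ` S)) + \<sigma> / sqrt 2 * ?d"
        using S \<sigma>(1) d diff sd by (intro Max_insert_0_image_le_add) auto
      then show ?thesis using diff[OF insertI1 sd0] by (simp add: F_def norm_max_def)
    qed
    also have "\<sigma>\<^sub>0 / sqrt 2 * ?d + \<sigma> / sqrt 2 * ?d = L * ?d" by (simp add: L_def add_divide_distrib distrib_right)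
    finally show ?thesis by simp
  qed
  have "measure ?P {x \<in> space ?P. (\<integral>x. F x \<partial>?P) + r \<le> F x} \<le> exp (- r\<^sup>2 / (2 * L\<^sup>2))"
    using \<sigma> by (intro std_normal_PiM_concentration K F F_int lip r) (simp add: L_def)
  also have "2 * L\<^sup>2 = (\<sigma>\<^sub>0 + \<sigma>)\<^sup>2" by (simp add: L_def power_divide)
  also have "measure ?P {x \<in> space ?P. (\<integral>x. F x \<partial>?P) + r \<le> F x}
    = prob {\<omega> \<in> space M. expectation (\<lambda>\<omega>. norm_max (\<lambda>s. W s \<omega>) s\<^sub>0 S) + r \<le> norm_max (\<lambda>s. W s \<omega>) s\<^sub>0 S}"
  proof -
    let ?e = "expectation (\<lambda>\<omega>. norm_max (\<lambda>s. W s \<omega>) s\<^sub>0 S)"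
    have "measure ?P {x \<in> space ?P. ?e + r \<le> F x} = prob {\<omega> \<in> space M. ?e + r \<le> F (\<Xi> \<omega>)}"
      unfolding distr[symmetric]
      by (subst measure_distr) (auto intro!: arg_cong[where f = prob] measurable_space[of \<Xi>])
    also have "\<dots> = prob {\<omega> \<in> space M. ?e + r \<le> norm_max (\<lambda>s. W s \<omega>) s\<^sub>0 S}"
      using AE_F by (intro finite_measure_eq_AE) auto
    finally show ?thesis by (simp add: EF)
  qed
  finally show ?thesis by simp
qed

subsection \<open>Integrals of second-order processes\<close>

text \<open>Joint measurability makes pathwise integrals random variables; the uniform second-moment
  bound lets integrals of \<open>X\<close> against an integrable kernel be dominated by that
  kernel.\<close>

locale second_order_process = prob_space +
  fixes X :: "real \<Rightarrow> 'a \<Rightarrow> real" and C :: real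
  assumes joint[measurable]: "(\<lambda>(\<tau>, \<omega>). X \<tau> \<omega>) \<in> borel_measurable (lborel \<Otimes>\<^sub>M M)"
    and X_sq: "\<And>\<tau>. square_integrable M (X \<tau>)"
    and X_bound: "\<And>\<tau>. (\<integral>\<omega>. (X \<tau> \<omega>)\<^sup>2 \<partial>M) \<le> C"
begin

sublocale lborel_pair: pair_sigma_finite lborel M ..

text \<open>A pathwise integral, equal to 0 on paths where the integrand is not integrable; for
  integrable \<open>h\<close> these form a null set. The type is generic so that real and complex
  kernels are treated together.\<close>

definition stoch_int :: "(real \<Rightarrow> 'b) \<Rightarrow> 'a \<Rightarrow> 'b::{real_normed_field, banach, second_countable_topology}" where
  "stoch_int h \<omega> = (\<integral>\<tau>. h \<tau> * of_real (X \<tau> \<omega>) \<partial>lborel)"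

lemma joint_swap[measurable]: "(\<lambda>(\<omega>, \<tau>). X \<tau> \<omega>) \<in> borel_measurable (M \<Otimes>\<^sub>M lborel)"
  using joint by (subst measurable_pair_swap_iff) (simp add: split_beta')

lemma X_measurable[measurable]: "X \<tau> \<in> borel_measurable M"
  using X_sq by (rule square_integrable_measurable)

lemma stoch_int_measurable[measurable]:
  assumes "integrable lborel h"
  shows "stoch_int h \<in> borel_measurable M"
proof -
  have [measurable]: "h \<in> borel_measurable lborel" using assms by simp
  have "(\<lambda>(\<omega>, \<tau>). h \<tau> * of_real (X \<tau> \<omega>)) \<in> borel_measurable (M \<Otimes>\<^sub>M lborel)"
    by measurable
  then show ?thesis
    unfolding stoch_int_def[abs_def] by (rule lborel.borel_measurable_lebesgue_integral)
qed

text \<open>Products of \<open>U\<close> with \<open>X \<tau>\<close> are dominated by the sum of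
  their squares, so their absolute first moments are bounded by one constant \<open>D\<close> for
  all \<tau>. Integrability of \<open>h\<close> then gives Fubini on the product space.\<close>

lemma
  fixes h :: "real \<Rightarrow> 'b::{real_normed_field, banach, second_countable_topology}"
  assumes h: "integrable lborel h" and U: "U \<in> borel_measurable M" "integrable M (\<lambda>\<omega>. (norm (U \<omega>))\<^sup>2)"
  shows stoch_int_Fubini: "(\<integral>\<omega>. U \<omega> * stoch_int h \<omega> \<partial>M) = (\<integral>\<tau>. h \<tau> * (\<integral>\<omega>. U \<omega> * of_real (X \<tau> \<omega>) \<partial>M) \<partial>lborel)"
    and stoch_int_integrand_integrable: "integrable lborel (\<lambda>\<tau>. h \<tau> * (\<integral>\<omega>. U \<omega> * of_real (X \<tau> \<omega>) \<partial>M))"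
    and AE_stoch_int_integrand_integrable: "AE \<omega> in M. integrable lborel (\<lambda>\<tau>. h \<tau> * (U \<omega> * of_real (X \<tau> \<omega>)))"
proof -
  have [measurable]: "h \<in> borel_measurable lborel" "U \<in> borel_measurable M" using h U by simp_all
  let ?f = "\<lambda>\<tau> \<omega>. h \<tau> * (U \<omega> * of_real (X \<tau> \<omega>))"
  define D where "D = (\<integral>\<omega>. (norm (U \<omega>))\<^sup>2 \<partial>M) + C"
  have Usq: "square_integrable M (\<lambda>\<omega>. norm (U \<omega>))" "square_integrable M (\<lambda>\<omega>. \<bar>X \<tau> \<omega>\<bar>)" for \<tau>
    using U X_sq by (auto simp: square_integrable_def)
  have UX: "integrable M (\<lambda>\<omega>. U \<omega> * of_real (X \<tau> \<omega>))" for \<tau>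
    by (rule Bochner_Integration.integrable_bound[OF square_integrable_integrable_mult[OF Usq]]) (auto simp: norm_mult)
  have D: "(\<integral>\<omega>. norm (U \<omega>) * \<bar>X \<tau> \<omega>\<bar> \<partial>M) \<le> D" for \<tau>
  proof -
    have "(\<integral>\<omega>. norm (U \<omega>) * \<bar>X \<tau> \<omega>\<bar> \<partial>M) \<le> (\<integral>\<omega>. (norm (U \<omega>))\<^sup>2 + (X \<tau> \<omega>)\<^sup>2 \<partial>M)"
    proof (rule integral_mono[OF square_integrable_integrable_mult[OF Usq]])
      show "integrable M (\<lambda>\<omega>. (norm (U \<omega>))\<^sup>2 + (X \<tau> \<omega>)\<^sup>2)"
        using U X_sq by (auto simp: square_integrable_def)
      show "norm (U \<omega>) * \<bar>X \<tau> \<omega>\<bar> \<le> (norm (U \<omega>))\<^sup>2 + (X \<tau> \<omega>)\<^sup>2" for \<omega>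
      proof -
        have "2 * (norm (U \<omega>) * \<bar>X \<tau> \<omega>\<bar>) \<le> (norm (U \<omega>))\<^sup>2 + (X \<tau> \<omega>)\<^sup>2"
          using zero_le_power2[of "norm (U \<omega>) - \<bar>X \<tau> \<omega>\<bar>"] by (simp add: power2_diff)
        moreover have "0 \<le> norm (U \<omega>) * \<bar>X \<tau> \<omega>\<bar>" by simp
        ultimately show ?thesis by linarith
      qed
    qed
    also have "\<dots> \<le> D" using U X_sq X_bound by (simp add: D_def square_integrable_def)
    finally show ?thesis .
  qed
  have joint': "(\<lambda>(\<tau>, \<omega>). ?f \<tau> \<omega>) \<in> borel_measurable (lborel \<Otimes>\<^sub>M M)" by measurable
  have int: "integrable (lborel \<Otimes>\<^sub>M M) (\<lambda>(\<tau>, \<omega>). ?f \<tau> \<omega>)"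
  proof (rule lborel_pair.Fubini_integrable[OF joint'])
    have "integrable lborel (\<lambda>\<tau>. norm (h \<tau>) * (\<integral>\<omega>. norm (U \<omega>) * \<bar>X \<tau> \<omega>\<bar> \<partial>M))"
    proof (rule Bochner_Integration.integrable_bound)
      show "integrable lborel (\<lambda>\<tau>. norm (h \<tau>) * D)" using h by simp
      show "AE \<tau> in lborel. norm (norm (h \<tau>) * (\<integral>\<omega>. norm (U \<omega>) * \<bar>X \<tau> \<omega>\<bar> \<partial>M)) \<le> norm (norm (h \<tau>) * D)"
        using D by (intro AE_I2) (auto simp: abs_mult integral_nonneg intro!: mult_left_mono intro: order_trans[OF _ abs_ge_self])
    qed measurable
    then show "integrable lborel (\<lambda>\<tau>. \<integral>\<omega>. norm (case (\<tau>, \<omega>) of (\<tau>, \<omega>) \<Rightarrow> ?f \<tau> \<omega>) \<partial>M)"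
      by (simp add: norm_mult)
    show "AE \<tau> in lborel. integrable M (\<lambda>\<omega>. case (\<tau>, \<omega>) of (\<tau>, \<omega>) \<Rightarrow> ?f \<tau> \<omega>)"
      using UX by simp
  qed
  show "AE \<omega> in M. integrable lborel (\<lambda>\<tau>. h \<tau> * (U \<omega> * of_real (X \<tau> \<omega>)))"
    using lborel_pair.AE_integrable_snd[OF int] .
  have eq: "(\<integral>\<tau>. ?f \<tau> \<omega> \<partial>lborel) = U \<omega> * stoch_int h \<omega>" for \<omega>
    by (simp add: stoch_int_def mult.left_commute)
  have eq2: "(\<integral>\<omega>. ?f \<tau> \<omega> \<partial>M) = h \<tau> * (\<integral>\<omega>. U \<omega> * of_real (X \<tau> \<omega>) \<partial>M)" for \<tau>
    by simp
  show "integrable lborel (\<lambda>\<tau>. h \<tau> * (\<integral>\<omega>. U \<omega> * of_real (X \<tau> \<omega>) \<partial>M))"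
    using lborel_pair.integrable_fst[OF int] unfolding eq2 .
  show "(\<integral>\<omega>. U \<omega> * stoch_int h \<omega> \<partial>M) = (\<integral>\<tau>. h \<tau> * (\<integral>\<omega>. U \<omega> * of_real (X \<tau> \<omega>) \<partial>M) \<partial>lborel)"
    using lborel_pair.integral_fst[OF int] lborel_pair.integral_snd[OF int] unfolding eq eq2 by simp
qed

lemma AE_integrable_integrand:
  fixes h :: "real \<Rightarrow> 'b::{real_normed_field, banach, second_countable_topology}"
  assumes h: "integrable lborel h"
  shows "AE \<omega> in M. integrable lborel (\<lambda>\<tau>. h \<tau> * of_real (X \<tau> \<omega>))"
  using AE_stoch_int_integrand_integrable[OF h, of "\<lambda>_. 1"] by simp

text \<open>The factor \<open>norm (h \<tau>)\<close> is split into two square roots; Cauchy-Schwarz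
  in \<tau> on each path and Tonelli bound the second moment by C times the squared integral of
  \<open>norm h\<close>.\<close>

lemma stoch_int_square_integrable:
  fixes h :: "real \<Rightarrow> 'b::{real_normed_field, banach, second_countable_topology}"
  assumes h: "integrable lborel h"
  shows "square_integrable M (\<lambda>\<omega>. norm (stoch_int h \<omega>))"
proof -
  have [measurable]: "h \<in> borel_measurable lborel" "stoch_int h \<in> borel_measurable M" using h by simp_all
  let ?H = "\<integral>\<^sup>+\<tau>. ennreal (norm (h \<tau>)) \<partial>lborel"
  have H: "?H < \<top>" using h by (simp add: integrable_iff_bounded)
  have bound: "ennreal ((norm (stoch_int h \<omega>))\<^sup>2) \<le> ?H * (\<integral>\<^sup>+\<tau>. ennreal (norm (h \<tau>) * (X \<tau> \<omega>)\<^sup>2) \<partial>lborel)"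
    if \<omega>[measurable]: "\<omega> \<in> space M" for \<omega>
  proof -
    have [measurable]: "(\<lambda>\<tau>. X \<tau> \<omega>) \<in> borel_measurable lborel"
      using measurable_compose[OF measurable_Pair1'[OF \<omega>, of lborel] joint_swap] by simp
    have "ennreal (norm (stoch_int h \<omega>)) \<le> (\<integral>\<^sup>+\<tau>. ennreal (norm (h \<tau> * of_real (X \<tau> \<omega>))) \<partial>lborel)"
    proof (cases "integrable lborel (\<lambda>\<tau>. h \<tau> * of_real (X \<tau> \<omega>))")
      case True
      then show ?thesis unfolding stoch_int_def by (rule integral_norm_bound_ennreal)
    qed (simp add: stoch_int_def not_integrable_integral_eq)
    also have "\<dots> = (\<integral>\<^sup>+\<tau>. ennreal (sqrt (norm (h \<tau>))) * ennreal (sqrt (norm (h \<tau>)) * \<bar>X \<tau> \<omega>\<bar>) \<partial>lborel)"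
      by (intro nn_integral_cong) (simp add: norm_mult mult.assoc[symmetric] flip: ennreal_mult)
    finally have "(ennreal (norm (stoch_int h \<omega>)))\<^sup>2 \<le> (\<integral>\<^sup>+\<tau>. ennreal (sqrt (norm (h \<tau>))) * ennreal (sqrt (norm (h \<tau>)) * \<bar>X \<tau> \<omega>\<bar>) \<partial>lborel)\<^sup>2"
      by (intro power_mono) auto
    also have "\<dots> \<le> (\<integral>\<^sup>+\<tau>. (ennreal (sqrt (norm (h \<tau>))))\<^sup>2 \<partial>lborel) * (\<integral>\<^sup>+\<tau>. (ennreal (sqrt (norm (h \<tau>)) * \<bar>X \<tau> \<omega>\<bar>))\<^sup>2 \<partial>lborel)"
      by (intro Cauchy_Schwarz_nn_integral) measurable
    finally show ?thesis by (simp add: ennreal_power power_mult_distrib)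
  qed
  have "(\<integral>\<^sup>+\<omega>. (\<integral>\<^sup>+\<tau>. ennreal (norm (h \<tau>) * (X \<tau> \<omega>)\<^sup>2) \<partial>lborel) \<partial>M) = (\<integral>\<^sup>+\<tau>. (\<integral>\<^sup>+\<omega>. ennreal (norm (h \<tau>) * (X \<tau> \<omega>)\<^sup>2) \<partial>M) \<partial>lborel)"
    by (rule lborel_pair.Fubini') measurable
  also have "\<dots> \<le> (\<integral>\<^sup>+\<tau>. ennreal (norm (h \<tau>)) * ennreal C \<partial>lborel)"
  proof (rule nn_integral_mono)
    fix \<tau>
    have "(\<integral>\<^sup>+\<omega>. ennreal (norm (h \<tau>) * (X \<tau> \<omega>)\<^sup>2) \<partial>M) = ennreal (norm (h \<tau>)) * (\<integral>\<^sup>+\<omega>. ennreal ((X \<tau> \<omega>)\<^sup>2) \<partial>M)"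
      by (simp add: ennreal_mult nn_integral_cmult)
    also have "(\<integral>\<^sup>+\<omega>. ennreal ((X \<tau> \<omega>)\<^sup>2) \<partial>M) = ennreal (\<integral>\<omega>. (X \<tau> \<omega>)\<^sup>2 \<partial>M)"
      using X_sq by (intro nn_integral_eq_integral) (auto simp: square_integrable_def)
    also have "ennreal (norm (h \<tau>)) * \<dots> \<le> ennreal (norm (h \<tau>)) * ennreal C"
      using X_bound by (intro mult_left_mono ennreal_leI) auto
    finally show "(\<integral>\<^sup>+\<omega>. ennreal (norm (h \<tau>) * (X \<tau> \<omega>)\<^sup>2) \<partial>M) \<le> ennreal (norm (h \<tau>)) * ennreal C" .
  qed
  also have "\<dots> = ?H * ennreal C" by (intro nn_integral_multc) measurable
  finally have fub: "(\<integral>\<^sup>+\<omega>. (\<integral>\<^sup>+\<tau>. ennreal (norm (h \<tau>) * (X \<tau> \<omega>)\<^sup>2) \<partial>lborel) \<partial>M) \<le> ?H * ennreal C" .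
  have "(\<integral>\<^sup>+\<omega>. ennreal ((norm (stoch_int h \<omega>))\<^sup>2) \<partial>M) \<le> (\<integral>\<^sup>+\<omega>. ?H * (\<integral>\<^sup>+\<tau>. ennreal (norm (h \<tau>) * (X \<tau> \<omega>)\<^sup>2) \<partial>lborel) \<partial>M)"
    using bound by (intro nn_integral_mono)
  also have "\<dots> = ?H * (\<integral>\<^sup>+\<omega>. (\<integral>\<^sup>+\<tau>. ennreal (norm (h \<tau>) * (X \<tau> \<omega>)\<^sup>2) \<partial>lborel) \<partial>M)"
    by (intro nn_integral_cmult) measurable
  also have "\<dots> \<le> ?H * (?H * ennreal C)"
    using fub by (rule mult_left_mono) simp
  also have "?H * (?H * ennreal C) < \<top>" using H by (simp add: ennreal_mult_less_top)
  finally show ?thesis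
    unfolding square_integrable_def by (auto intro!: integrableI_bounded)
qed

end

section \<open>Gaussian variables and approximation of stochastic integrals\<close>

lemma (in prob_space) gaussian_variable_square_integrable:
  assumes "gaussian_variable M Z"
  shows "square_integrable M Z"
proof -
  have [measurable]: "Z \<in> borel_measurable M" using assms by (simp add: gaussian_variable_def)
  from assms consider m \<sigma> where "0 < \<sigma>" "distributed M lborel Z (normal_density m \<sigma>)" | c where "AE \<omega> in M. Z \<omega> = c"
    by (auto simp: gaussian_variable_def)
  then have "integrable M (\<lambda>\<omega>. (Z \<omega>)\<^sup>2)"
  proof cases
    case 1
    have "integrable lborel (\<lambda>x. normal_density m \<sigma> x * (x - m) ^ 2)" "integrable lborel (\<lambda>x. normal_density m \<sigma> x * x)"
      "integrable lborel (normal_density m \<sigma>)"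
      using 1(1) integrable_normal_moment[of \<sigma> m 2] integrable_normal_moment_nz_1[of \<sigma> m] by auto
    then have "integrable lborel (\<lambda>x. normal_density m \<sigma> x * (x - m) ^ 2 + 2 * m * (normal_density m \<sigma> x * x) - m\<^sup>2 * normal_density m \<sigma> x)"
      by auto
    then have "integrable lborel (\<lambda>x. normal_density m \<sigma> x * x\<^sup>2)"
      by (rule back_subst[of "integrable lborel"]) (auto simp: power2_eq_square algebra_simps)
    then show ?thesis
      using distributed_integrable[OF 1(2), of "\<lambda>x. x\<^sup>2"] by simp
  next
    case 2
    then have "AE \<omega> in M. (Z \<omega>)\<^sup>2 = c\<^sup>2" by eventually_elim simp
    then show ?thesis by (subst integrable_cong_AE[of _ _ "\<lambda>_. c\<^sup>2"]) auto
  qed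
  then show ?thesis by (simp add: square_integrable_def)
qed

lemma (in prob_space) gaussian_variable_char:
  assumes "gaussian_variable M Z"
  shows "(\<integral>\<omega>. iexp (Z \<omega>) \<partial>M) = iexp (expectation Z) * exp (- variance Z / 2)"
proof -
  have [measurable]: "Z \<in> borel_measurable M" using assms by (simp add: gaussian_variable_def)
  from assms consider m \<sigma> where "0 < \<sigma>" "distributed M lborel Z (normal_density m \<sigma>)" | c where "AE \<omega> in M. Z \<omega> = c"
    by (auto simp: gaussian_variable_def)
  then show ?thesis
  proof cases
    case 1
    have m: "expectation Z = m" and v: "variance Z = \<sigma>\<^sup>2"
      using normal_distributed_expectation[OF 1] normal_distributed_variance[OF 1] .
    define S where "S \<omega> = (Z \<omega> - m) / \<sigma>" for \<omega>
    have D: "distributed M lborel S std_normal_density"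
      using 1(2) unfolding normal_standard_normal_convert[OF 1(1)] S_def[abs_def] .
    have [measurable]: "S \<in> borel_measurable M" by (simp add: S_def[abs_def])
    have distr: "distr M borel S = std_normal_distribution"
      using distributed_distr_eq_density[OF D] by (simp cong: distr_cong)
    have "(\<integral>\<omega>. iexp (Z \<omega>) \<partial>M) = (\<integral>\<omega>. iexp m * iexp (\<sigma> * S \<omega>) \<partial>M)"
      using 1(1) by (intro Bochner_Integration.integral_cong) (auto simp: S_def simp flip: exp_add distrib_left of_real_mult of_real_add)
    also have "\<dots> = iexp m * (\<integral>\<omega>. iexp (\<sigma> * S \<omega>) \<partial>M)" by simp
    also have "(\<integral>\<omega>. iexp (\<sigma> * S \<omega>) \<partial>M) = char std_normal_distribution \<sigma>"
      unfolding distr[symmetric] char_def by (subst integral_distr) auto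
    finally show ?thesis by (simp only: char_std_normal_distribution v) (simp only: m)
  next
    case 2
    have "expectation Z = (\<integral>\<omega>. c \<partial>M)" using 2 by (intro integral_cong_AE) auto
    then have m: "expectation Z = c" by (simp add: prob_space)
    have "variance Z = (\<integral>\<omega>. 0 \<partial>M)" unfolding m using 2 by (intro integral_cong_AE) auto
    then have v: "variance Z = 0" by simp
    have "(\<integral>\<omega>. iexp (Z \<omega>) \<partial>M) = (\<integral>\<omega>. iexp c \<partial>M)"
      using 2 by (intro integral_cong_AE) auto
    then show ?thesis unfolding v unfolding m by (simp add: prob_space)
  qed
qed

text \<open>The weighted Young inequality with parameter e. The bound is linear in e, so it tends to
  zero with e for fixed f.\<close>

lemma square_integrable_mult_abs_le:
  assumes f: "square_integrable M f" and g: "square_integrable M g" and e: "0 < e" and le: "(\<integral>x. (g x)\<^sup>2 \<partial>M) \<le> e\<^sup>2"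
  shows "(\<integral>x. \<bar>f x * g x\<bar> \<partial>M) \<le> e * ((\<integral>x. (f x)\<^sup>2 \<partial>M) + 1) / 2"
proof -
  have fi: "integrable M (\<lambda>x. (f x)\<^sup>2)" "integrable M (\<lambda>x. (g x)\<^sup>2)"
    using f g by (auto simp: square_integrable_def)
  have "(\<integral>x. \<bar>f x * g x\<bar> \<partial>M) \<le> (\<integral>x. (e * (f x)\<^sup>2 + (g x)\<^sup>2 / e) / 2 \<partial>M)"
  proof (rule integral_mono)
    show "integrable M (\<lambda>x. \<bar>f x * g x\<bar>)"
      using square_integrable_integrable_mult[OF f g] by simp
    show "integrable M (\<lambda>x. (e * (f x)\<^sup>2 + (g x)\<^sup>2 / e) / 2)" using fi by simp
    show "\<bar>f x * g x\<bar> \<le> (e * (f x)\<^sup>2 + (g x)\<^sup>2 / e) / 2" for x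
    proof -
      have "0 \<le> (e * \<bar>f x\<bar> - \<bar>g x\<bar>)\<^sup>2 / (2 * e)" using e by simp
      also have "\<dots> = (e * (f x)\<^sup>2 + (g x)\<^sup>2 / e) / 2 - \<bar>f x * g x\<bar>"
        using e by (simp add: power2_diff power_mult_distrib abs_mult field_simps power2_eq_square)
      finally show ?thesis by simp
    qed
  qed
  also have "\<dots> = (e * (\<integral>x. (f x)\<^sup>2 \<partial>M) + (\<integral>x. (g x)\<^sup>2 \<partial>M) / e) / 2" using fi by simp
  also have "\<dots> \<le> (e * (\<integral>x. (f x)\<^sup>2 \<partial>M) + e) / 2"
    using le e by (simp add: divide_le_eq power2_eq_square)
  finally show ?thesis by (simp add: distrib_left)
qed

context second_order_process
begin

text \<open>
  Maurey's empirical method: the next sampling point is chosen so that the error of the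
  empirical sum, averaged over sampling points distributed like \<open>\<bar>h\<bar>\<close>, grows by a bounded
  amount only.
\<close>

lemma stoch_int_empirical:
  fixes h :: "real \<Rightarrow> real" and N :: nat
  assumes h: "integrable lborel h" and pos: "0 < (\<integral>\<tau>. \<bar>h \<tau>\<bar> \<partial>lborel)"
  shows "\<exists>J Z. finite J \<and> Z \<in> lin_span J X \<and>
    (\<integral>\<omega>. (real N * stoch_int h \<omega> - Z \<omega>)\<^sup>2 \<partial>M) \<le> real N * ((\<integral>\<tau>. \<bar>h \<tau>\<bar> \<partial>lborel)\<^sup>2 * C + 1)"
proof (induction N)
  case 0
  have "(\<lambda>_. 0) \<in> lin_span {} X" by (simp add: lin_span_def)
  then show ?case by (intro exI[of _ "{}"] exI[of _ "\<lambda>_. 0"]) simp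
next
  case (Suc N)
  define c where "c = (\<integral>\<tau>. \<bar>h \<tau>\<bar> \<partial>lborel)"
  define Y where "Y = stoch_int h"
  have c: "0 < c" using pos by (simp add: c_def)
  from Suc obtain J Z where J: "finite J" and Z: "Z \<in> lin_span J X"
    and le: "(\<integral>\<omega>. (real N * Y \<omega> - Z \<omega>)\<^sup>2 \<partial>M) \<le> real N * (c\<^sup>2 * C + 1)"
    unfolding c_def Y_def by blast
  have Ysq: "square_integrable M Y"
    using stoch_int_square_integrable[OF h] stoch_int_measurable[OF h] by (simp add: square_integrable_def Y_def)
  have Zsq: "square_integrable M Z" using square_integrable_lin_span[OF X_sq Z] .
  define R where "R \<omega> = real N * Y \<omega> - Z \<omega>" for \<omega>
  have Rsq: "square_integrable M R"
    using square_integrable_add[OF square_integrable_cmult[OF Ysq, of "real N"] square_integrable_cmult[OF Zsq, of "-1"]]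
    by (simp add: R_def[abs_def])
  define S where "S \<omega> = R \<omega> + Y \<omega>" for \<omega>
  have Ssq: "square_integrable M S" using square_integrable_add[OF Rsq Ysq] by (simp add: S_def[abs_def])
  note int = square_integrable_integrable_power2[OF Ysq] square_integrable_integrable_power2[OF Rsq]
    square_integrable_integrable_power2[OF Ssq] square_integrable_integrable_power2[OF X_sq]
    square_integrable_integrable_mult[OF Ssq X_sq] square_integrable_integrable_mult[OF Ssq Ysq]
  \<comment> \<open>The importance weight: if \<tau> is drawn with density
    \<open>\<bar>h \<tau>\<bar> / c\<close>, then \<open>a \<tau> * X \<tau>\<close> has average
    \<open>Y\<close>.\<close>
  define a where "a \<tau> = c * sgn (h \<tau>)" for \<tau>
  \<comment> \<open>The average of the new error over \<tau> is at most the old one plus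
    \<open>c\<^sup>2 * C\<close>. The slack 1 permits weak inequalities throughout: if no \<tau>
    were suitable, multiplying by \<open>\<bar>h \<tau>\<bar>\<close> and integrating would give a
    number at least 1 smaller than itself.\<close>
  have "\<exists>\<tau>. (\<integral>\<omega>. (S \<omega> - a \<tau> * X \<tau> \<omega>)\<^sup>2 \<partial>M) \<le> (\<integral>\<omega>. (R \<omega>)\<^sup>2 \<partial>M) + (c\<^sup>2 * C + 1)"
  proof (rule ccontr)
    assume "\<not> ?thesis"
    then have less: "(\<integral>\<omega>. (R \<omega>)\<^sup>2 \<partial>M) + (c\<^sup>2 * C + 1) \<le> (\<integral>\<omega>. (S \<omega> - a \<tau> * X \<tau> \<omega>)\<^sup>2 \<partial>M)" for \<tau>
      by (meson linorder_not_le nless_le)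
    have expand: "(\<integral>\<omega>. (S \<omega> - a \<tau> * X \<tau> \<omega>)\<^sup>2 \<partial>M)
        = (\<integral>\<omega>. (S \<omega>)\<^sup>2 \<partial>M) - 2 * a \<tau> * (\<integral>\<omega>. S \<omega> * X \<tau> \<omega> \<partial>M) + (a \<tau>)\<^sup>2 * (\<integral>\<omega>. (X \<tau> \<omega>)\<^sup>2 \<partial>M)" for \<tau>
    proof -
      have "(\<integral>\<omega>. (S \<omega> - a \<tau> * X \<tau> \<omega>)\<^sup>2 \<partial>M)
         = (\<integral>\<omega>. (S \<omega>)\<^sup>2 - 2 * a \<tau> * (S \<omega> * X \<tau> \<omega>) + (a \<tau>)\<^sup>2 * (X \<tau> \<omega>)\<^sup>2 \<partial>M)"
        by (intro Bochner_Integration.integral_cong refl) (simp add: power2_eq_square algebra_simps)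
      then show ?thesis using int by simp
    qed
    have pointwise: "\<bar>h \<tau>\<bar> * ((\<integral>\<omega>. (R \<omega>)\<^sup>2 \<partial>M) + (c\<^sup>2 * C + 1))
      \<le> \<bar>h \<tau>\<bar> * ((\<integral>\<omega>. (S \<omega>)\<^sup>2 \<partial>M) + c\<^sup>2 * C) - 2 * c * (h \<tau> * (\<integral>\<omega>. S \<omega> * X \<tau> \<omega> \<partial>M))" for \<tau>
    proof -
      have "(a \<tau>)\<^sup>2 * (\<integral>\<omega>. (X \<tau> \<omega>)\<^sup>2 \<partial>M) \<le> c\<^sup>2 * C"
      proof -
        have "(a \<tau>)\<^sup>2 \<le> c\<^sup>2" by (simp add: a_def power_mult_distrib sgn_real_def)
        then show ?thesis using X_bound by (intro mult_mono) auto
      qed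
      then have "(\<integral>\<omega>. (R \<omega>)\<^sup>2 \<partial>M) + (c\<^sup>2 * C + 1)
          \<le> (\<integral>\<omega>. (S \<omega>)\<^sup>2 \<partial>M) + c\<^sup>2 * C - 2 * a \<tau> * (\<integral>\<omega>. S \<omega> * X \<tau> \<omega> \<partial>M)"
        using less[of \<tau>] unfolding expand by linarith
      then have "\<bar>h \<tau>\<bar> * ((\<integral>\<omega>. (R \<omega>)\<^sup>2 \<partial>M) + (c\<^sup>2 * C + 1))
          \<le> \<bar>h \<tau>\<bar> * ((\<integral>\<omega>. (S \<omega>)\<^sup>2 \<partial>M) + c\<^sup>2 * C - 2 * a \<tau> * (\<integral>\<omega>. S \<omega> * X \<tau> \<omega> \<partial>M))"
        by (rule mult_left_mono) simp
      also have "\<dots> = \<bar>h \<tau>\<bar> * ((\<integral>\<omega>. (S \<omega>)\<^sup>2 \<partial>M) + c\<^sup>2 * C) - 2 * c * ((\<bar>h \<tau>\<bar> * sgn (h \<tau>)) * (\<integral>\<omega>. S \<omega> * X \<tau> \<omega> \<partial>M))"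
        by (simp add: a_def algebra_simps)
      finally show ?thesis by (simp add: abs_mult_sgn)
    qed
    have U: "S \<in> borel_measurable M" "integrable M (\<lambda>\<omega>. (norm (S \<omega>))\<^sup>2)"
      using Ssq by (auto simp: square_integrable_def)
    have hint: "integrable lborel (\<lambda>\<tau>. \<bar>h \<tau>\<bar>)" "integrable lborel (\<lambda>\<tau>. h \<tau> * (\<integral>\<omega>. S \<omega> * X \<tau> \<omega> \<partial>M))"
      using h stoch_int_integrand_integrable[OF h U] by simp_all
    have "c * ((\<integral>\<omega>. (R \<omega>)\<^sup>2 \<partial>M) + (c\<^sup>2 * C + 1)) = (\<integral>\<tau>. \<bar>h \<tau>\<bar> * ((\<integral>\<omega>. (R \<omega>)\<^sup>2 \<partial>M) + (c\<^sup>2 * C + 1)) \<partial>lborel)"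
      by (simp only: integral_mult_left_zero c_def[symmetric])
    also have "\<dots> \<le> (\<integral>\<tau>. \<bar>h \<tau>\<bar> * ((\<integral>\<omega>. (S \<omega>)\<^sup>2 \<partial>M) + c\<^sup>2 * C) - 2 * c * (h \<tau> * (\<integral>\<omega>. S \<omega> * X \<tau> \<omega> \<partial>M)) \<partial>lborel)"
      using hint by (intro integral_mono pointwise) auto
    also have "\<dots> = c * ((\<integral>\<omega>. (S \<omega>)\<^sup>2 \<partial>M) + c\<^sup>2 * C) - 2 * c * (\<integral>\<omega>. S \<omega> * Y \<omega> \<partial>M)"
      using hint stoch_int_Fubini[OF h U] by (simp add: c_def[symmetric] Y_def)
    finally have "c * ((\<integral>\<omega>. (R \<omega>)\<^sup>2 \<partial>M) + (c\<^sup>2 * C + 1)) \<le> c * ((\<integral>\<omega>. (S \<omega>)\<^sup>2 \<partial>M) + c\<^sup>2 * C - 2 * (\<integral>\<omega>. S \<omega> * Y \<omega> \<partial>M))"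
      by (simp add: algebra_simps)
    then have "(\<integral>\<omega>. (R \<omega>)\<^sup>2 \<partial>M) + 1 \<le> (\<integral>\<omega>. (S \<omega>)\<^sup>2 \<partial>M) - 2 * (\<integral>\<omega>. S \<omega> * Y \<omega> \<partial>M)"
      using c by simp
    also have "\<dots> = (\<integral>\<omega>. (S \<omega>)\<^sup>2 - 2 * (S \<omega> * Y \<omega>) \<partial>M)" using int by simp
    \<comment> \<open>Since S = R + Y, the cross terms cancel: the next sample removes on average
      exactly the \<open>Y\<close> that was added to the error.\<close>
    also have "\<dots> = (\<integral>\<omega>. (R \<omega>)\<^sup>2 - (Y \<omega>)\<^sup>2 \<partial>M)"
      by (intro Bochner_Integration.integral_cong refl) (simp add: S_def power2_eq_square algebra_simps)
    also have "\<dots> \<le> (\<integral>\<omega>. (R \<omega>)\<^sup>2 \<partial>M)" using int by simp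
    finally show False by simp
  qed
  then obtain \<tau> where \<tau>: "(\<integral>\<omega>. (S \<omega> - a \<tau> * X \<tau> \<omega>)\<^sup>2 \<partial>M) \<le> (\<integral>\<omega>. (R \<omega>)\<^sup>2 \<partial>M) + (c\<^sup>2 * C + 1)" by blast
  have "(\<lambda>\<omega>. 1 * Z \<omega> + a \<tau> * X \<tau> \<omega>) \<in> lin_span (insert \<tau> J) X"
    using Z J lin_span_mono[of "insert \<tau> J" J X] by (intro lin_span_lincomb lin_span_base) auto
  moreover have "real (Suc N) * Y \<omega> - (1 * Z \<omega> + a \<tau> * X \<tau> \<omega>) = S \<omega> - a \<tau> * X \<tau> \<omega>" for \<omega>
    by (simp add: S_def R_def algebra_simps)
  moreover have "(\<integral>\<omega>. (S \<omega> - a \<tau> * X \<tau> \<omega>)\<^sup>2 \<partial>M) \<le> real (Suc N) * (c\<^sup>2 * C + 1)"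
    using \<tau> le by (simp add: R_def algebra_simps)
  ultimately show ?case
    using J unfolding c_def[symmetric] Y_def[symmetric]
    by (intro exI[of _ "insert \<tau> J"] exI[of _ "\<lambda>\<omega>. 1 * Z \<omega> + a \<tau> * X \<tau> \<omega>"]) (simp only: finite_insert)
qed

text \<open>The squared error of N samples grows only linearly in N, so division of the sum by N
  leaves an error of order 1/N.\<close>

lemma stoch_int_approx:
  fixes h :: "real \<Rightarrow> real"
  assumes h: "integrable lborel h" and e: "0 < e"
  shows "\<exists>J Z. finite J \<and> Z \<in> lin_span J X \<and> (\<integral>\<omega>. (stoch_int h \<omega> - Z \<omega>)\<^sup>2 \<partial>M) \<le> e"
\<comment> \<open>A kernel that vanishes almost everywhere provides no sampling density, but its
  integral is zero on every path.\<close>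
proof (cases "(\<integral>\<tau>. \<bar>h \<tau>\<bar> \<partial>lborel) = 0")
  case True
  then have "AE \<tau> in lborel. h \<tau> = 0"
    using h by (subst (asm) integral_nonneg_eq_0_iff_AE) auto
  then have "AE \<tau> in lborel. h \<tau> * of_real (X \<tau> \<omega>) = 0" for \<omega> by eventually_elim simp
  then have "stoch_int h \<omega> = 0" for \<omega> unfolding stoch_int_def by (rule integral_eq_zero_AE)
  moreover have "(\<lambda>_. 0) \<in> lin_span {} X" by (simp add: lin_span_def)
  ultimately show ?thesis using e by (intro exI[of _ "{}"] exI[of _ "\<lambda>_. 0"]) simp
next
  case False
  let ?K = "(\<integral>\<tau>. \<bar>h \<tau>\<bar> \<partial>lborel)\<^sup>2 * C + 1"
  obtain N\<^sub>0 :: nat where "?K / e < real N\<^sub>0" using reals_Archimedean2 by blast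
  then obtain N :: nat where N: "?K / e < real N" "0 < N" by (intro that[of "Suc N\<^sub>0"]) auto
  have "0 < (\<integral>\<tau>. \<bar>h \<tau>\<bar> \<partial>lborel)" using False by (simp add: order_less_le integral_nonneg)
  from stoch_int_empirical[OF h this, of N] obtain J Z where J: "finite J" and Z: "Z \<in> lin_span J X"
    and le: "(\<integral>\<omega>. (real N * stoch_int h \<omega> - Z \<omega>)\<^sup>2 \<partial>M) \<le> real N * ?K" by blast
  have "(\<lambda>\<omega>. (1 / real N) * Z \<omega> + 0 * Z \<omega>) \<in> lin_span J X" by (intro lin_span_lincomb Z)
  moreover have "(\<integral>\<omega>. (stoch_int h \<omega> - ((1 / real N) * Z \<omega> + 0 * Z \<omega>))\<^sup>2 \<partial>M) \<le> e"
  proof -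
    have "(\<integral>\<omega>. (stoch_int h \<omega> - ((1 / real N) * Z \<omega> + 0 * Z \<omega>))\<^sup>2 \<partial>M)
        = (\<integral>\<omega>. (1 / (real N)\<^sup>2) * (real N * stoch_int h \<omega> - Z \<omega>)\<^sup>2 \<partial>M)"
      using N(2) by (intro Bochner_Integration.integral_cong refl) (simp add: field_simps power2_eq_square)
    also have "\<dots> = (1 / (real N)\<^sup>2) * (\<integral>\<omega>. (real N * stoch_int h \<omega> - Z \<omega>)\<^sup>2 \<partial>M)" by simp
    also have "\<dots> \<le> (1 / (real N)\<^sup>2) * (real N * ?K)" by (intro mult_left_mono le) simp
    also have "\<dots> = ?K / real N" using N(2) by (simp add: power2_eq_square)
    also have "\<dots> \<le> e" using N e by (simp add: field_simps)
    finally show ?thesis .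
  qed
  ultimately show ?thesis using J by blast
qed

end

lemma cmod_iexp_diff_le: "cmod (iexp a - iexp b) \<le> \<bar>a - b\<bar>"
proof -
  have "iexp a - iexp b = iexp b * (iexp (a - b) - 1)"
    by (simp add: algebra_simps flip: exp_add)
  then have "cmod (iexp a - iexp b) = cmod (iexp (a - b) - 1)" by (simp add: norm_mult)
  also have "\<dots> \<le> \<bar>a - b\<bar>" using iexp_approx1[of "a - b" 0] by simp
  finally show ?thesis .
qed

text \<open>Mean, second moment and characteristic function are all continuous under convergence in
  mean square, so the formula for the Gaussian approximants passes to the limit.\<close>

lemma (in second_order_process) stoch_int_gaussian:
  fixes h :: "real \<Rightarrow> real"
  assumes gauss: "gaussian_process M X" and h: "integrable lborel h"
    and centred: "expectation (stoch_int h) = 0"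
  shows "(\<integral>\<omega>. iexp (stoch_int h \<omega>) \<partial>M) = exp (- (\<integral>\<omega>. (stoch_int h \<omega>)\<^sup>2 \<partial>M) / 2)"
proof -
  define Y where "Y = stoch_int h"
  define v where "v = (\<integral>\<omega>. (Y \<omega>)\<^sup>2 \<partial>M)"
  have Ysq: "square_integrable M Y"
    using stoch_int_square_integrable[OF h] stoch_int_measurable[OF h] by (simp add: square_integrable_def Y_def)
  define e where "e n = inverse (real (Suc n))" for n
  have e: "0 < e n" "e \<longlonglongrightarrow> 0" for n
    using LIMSEQ_inverse_real_of_nat by (simp_all add: e_def[abs_def])
  have "\<exists>Z. gaussian_variable M Z \<and> (\<integral>\<omega>. (Y \<omega> - Z \<omega>)\<^sup>2 \<partial>M) \<le> (e n)\<^sup>2" for n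
  proof -
    obtain J Z where J: "finite J" and Z: "Z \<in> lin_span J X" and le: "(\<integral>\<omega>. (Y \<omega> - Z \<omega>)\<^sup>2 \<partial>M) \<le> (e n)\<^sup>2"
      using stoch_int_approx[OF h, of "(e n)\<^sup>2"] e(1)[of n] unfolding Y_def by auto
    have "gaussian_variable M Z"
      using gauss J Z unfolding gaussian_process_def lin_span_def by auto
    then show ?thesis using le by blast
  qed
  then obtain Z where Z: "\<And>n. gaussian_variable M (Z n)" and le: "\<And>n. (\<integral>\<omega>. (Y \<omega> - Z n \<omega>)\<^sup>2 \<partial>M) \<le> (e n)\<^sup>2"
    by metis
  have Zsq: "square_integrable M (Z n)" for n using gaussian_variable_square_integrable[OF Z] .
  have Dsq: "square_integrable M (\<lambda>\<omega>. Y \<omega> - Z n \<omega>)" for n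
    using square_integrable_add[OF Ysq square_integrable_cmult[OF Zsq, of "-1"]] by simp
  have [measurable]: "Y \<in> borel_measurable M" "Z n \<in> borel_measurable M" for n
    using Ysq Zsq by (auto simp: square_integrable_def)
  note int = square_integrable_integrable[OF Ysq] square_integrable_integrable[OF Zsq] square_integrable_integrable[OF Dsq]
    square_integrable_integrable_power2[OF Ysq] square_integrable_integrable_power2[OF Zsq] square_integrable_integrable_power2[OF Dsq]
    square_integrable_integrable_mult[OF Ysq Dsq]
  have L1: "(\<integral>\<omega>. \<bar>Y \<omega> - Z n \<omega>\<bar> \<partial>M) \<le> e n" for n
    using square_integrable_mult_abs_le[OF _ Dsq[of n] e(1) le, of "\<lambda>_. 1"]
    by (simp add: square_integrable_def prob_space)
  have mean: "\<bar>expectation (Z n)\<bar> \<le> e n" for n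
  proof -
    have "expectation (Z n) = - (\<integral>\<omega>. Y \<omega> - Z n \<omega> \<partial>M)"
      using int centred by (simp add: Y_def)
    also have "\<bar>\<dots>\<bar> \<le> (\<integral>\<omega>. \<bar>Y \<omega> - Z n \<omega>\<bar> \<partial>M)" using integral_abs_bound[of M "\<lambda>\<omega>. Y \<omega> - Z n \<omega>"] by simp
    finally show ?thesis using L1[of n] by linarith
  qed
  have second: "\<bar>(\<integral>\<omega>. (Z n \<omega>)\<^sup>2 \<partial>M) - v\<bar> \<le> e n * (v + 1) + (e n)\<^sup>2" for n
  proof -
    have "(\<integral>\<omega>. (Z n \<omega>)\<^sup>2 \<partial>M) = (\<integral>\<omega>. (Y \<omega>)\<^sup>2 - 2 * (Y \<omega> * (Y \<omega> - Z n \<omega>)) + (Y \<omega> - Z n \<omega>)\<^sup>2 \<partial>M)"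
      by (intro Bochner_Integration.integral_cong refl) (simp add: power2_eq_square algebra_simps)
    also have "\<dots> = v - 2 * (\<integral>\<omega>. Y \<omega> * (Y \<omega> - Z n \<omega>) \<partial>M) + (\<integral>\<omega>. (Y \<omega> - Z n \<omega>)\<^sup>2 \<partial>M)"
      using int by (simp add: v_def)
    finally have eq: "(\<integral>\<omega>. (Z n \<omega>)\<^sup>2 \<partial>M) = \<dots>" .
    have "\<bar>\<integral>\<omega>. Y \<omega> * (Y \<omega> - Z n \<omega>) \<partial>M\<bar> \<le> (\<integral>\<omega>. \<bar>Y \<omega> * (Y \<omega> - Z n \<omega>)\<bar> \<partial>M)" by (rule integral_abs_bound)
    also have "\<dots> \<le> e n * (v + 1) / 2"
      unfolding v_def by (rule square_integrable_mult_abs_le[OF Ysq Dsq e(1) le])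
    finally have "\<bar>\<integral>\<omega>. Y \<omega> * (Y \<omega> - Z n \<omega>) \<partial>M\<bar> \<le> e n * (v + 1) / 2" .
    moreover have "0 \<le> (\<integral>\<omega>. (Y \<omega> - Z n \<omega>)\<^sup>2 \<partial>M)" by simp
    ultimately show ?thesis unfolding eq using le[of n] by linarith
  qed
  have charZ: "cmod ((\<integral>\<omega>. iexp (Z n \<omega>) \<partial>M) - (\<integral>\<omega>. iexp (Y \<omega>) \<partial>M)) \<le> e n" for n
  proof -
    have i: "integrable M (\<lambda>\<omega>. iexp (Z n \<omega>))" "integrable M (\<lambda>\<omega>. iexp (Y \<omega>))"
      by (intro integrable_const_bound[of _ 1]; simp)+
    have "cmod ((\<integral>\<omega>. iexp (Z n \<omega>) \<partial>M) - (\<integral>\<omega>. iexp (Y \<omega>) \<partial>M)) = cmod (\<integral>\<omega>. iexp (Z n \<omega>) - iexp (Y \<omega>) \<partial>M)"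
      using i by simp
    also have "\<dots> \<le> (\<integral>\<omega>. cmod (iexp (Z n \<omega>) - iexp (Y \<omega>)) \<partial>M)" by (rule integral_norm_bound)
    also have "\<dots> \<le> (\<integral>\<omega>. \<bar>Y \<omega> - Z n \<omega>\<bar> \<partial>M)"
      using int cmod_iexp_diff_le[of "Z n _" "Y _"] i by (intro integral_mono) (auto simp: abs_minus_commute)
    also note L1
    finally show ?thesis .
  qed
  have e2: "(\<lambda>n. e n * (v + 1) + (e n)\<^sup>2) \<longlonglongrightarrow> 0"
    using tendsto_add[OF tendsto_mult[OF e(2) tendsto_const[of "v + 1"]] tendsto_power[OF e(2), of 2]] by simp
  have "(\<lambda>n. expectation (Z n)) \<longlonglongrightarrow> 0"
    using mean by (intro Lim_null_comparison[OF _ e(2)]) auto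
  moreover have "(\<lambda>n. (\<integral>\<omega>. (Z n \<omega>)\<^sup>2 \<partial>M) - v) \<longlonglongrightarrow> 0"
    using second by (intro Lim_null_comparison[OF _ e2]) auto
  then have "(\<lambda>n. \<integral>\<omega>. (Z n \<omega>)\<^sup>2 \<partial>M) \<longlonglongrightarrow> v" by (rule LIM_zero_cancel)
  ultimately have "(\<lambda>n. iexp (expectation (Z n)) * exp (- ((\<integral>\<omega>. (Z n \<omega>)\<^sup>2 \<partial>M) - (expectation (Z n))\<^sup>2) / 2))
     \<longlonglongrightarrow> iexp 0 * exp (- (v - 0\<^sup>2) / 2)"
    by (intro tendsto_intros) simp_all
  moreover have "(\<integral>\<omega>. iexp (Z n \<omega>) \<partial>M) = iexp (expectation (Z n)) * exp (- ((\<integral>\<omega>. (Z n \<omega>)\<^sup>2 \<partial>M) - (expectation (Z n))\<^sup>2) / 2)" for n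
    using gaussian_variable_char[OF Z[of n]] int by (simp add: variance_eq)
  ultimately have "(\<lambda>n. \<integral>\<omega>. iexp (Z n \<omega>) \<partial>M) \<longlonglongrightarrow> complex_of_real (exp (- v / 2))" by simp
  moreover have "(\<lambda>n. (\<integral>\<omega>. iexp (Z n \<omega>) \<partial>M) - (\<integral>\<omega>. iexp (Y \<omega>) \<partial>M)) \<longlonglongrightarrow> 0"
    using charZ by (intro Lim_null_comparison[OF _ e(2)]) auto
  then have "(\<lambda>n. \<integral>\<omega>. iexp (Z n \<omega>) \<partial>M) \<longlonglongrightarrow> (\<integral>\<omega>. iexp (Y \<omega>) \<partial>M)" by (rule LIM_zero_cancel)
  ultimately show ?thesis unfolding Y_def[symmetric] v_def[symmetric] by (rule LIMSEQ_unique[rotated])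
qed

subsection \<open>Combinations and circularity of stochastic integrals\<close>

text \<open>Almost sure only: linearity on a path requires every single integrand to be integrable
  there.\<close>

lemma (in second_order_process) AE_stoch_int_sum:
  fixes g :: "'s \<Rightarrow> real \<Rightarrow> 'b::{real_normed_field, banach, second_countable_topology}" and c :: "'s \<Rightarrow> 'b"
  assumes T: "finite T" and g: "\<And>s. s \<in> T \<Longrightarrow> integrable lborel (g s)"
  shows "AE \<omega> in M. stoch_int (\<lambda>\<tau>. \<Sum>s\<in>T. c s * g s \<tau>) \<omega> = (\<Sum>s\<in>T. c s * stoch_int (g s) \<omega>)"
proof -
  have "AE \<omega> in M. \<forall>s\<in>T. integrable lborel (\<lambda>\<tau>. g s \<tau> * of_real (X \<tau> \<omega>))"
    using T AE_integrable_integrand[OF g] by (intro AE_finite_allI) auto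
  then show ?thesis
  proof eventually_elim
    case (elim \<omega>)
    have "stoch_int (\<lambda>\<tau>. \<Sum>s\<in>T. c s * g s \<tau>) \<omega> = (\<integral>\<tau>. (\<Sum>s\<in>T. c s * (g s \<tau> * of_real (X \<tau> \<omega>))) \<partial>lborel)"
      by (simp add: stoch_int_def sum_distrib_right mult.assoc)
    also have "\<dots> = (\<Sum>s\<in>T. c s * stoch_int (g s) \<omega>)"
      using elim by (simp add: stoch_int_def)
    finally show ?case .
  qed
qed

lemma (in second_order_process) AE_stoch_int_Re:
  assumes g: "integrable lborel g"
  shows "AE \<omega> in M. stoch_int (\<lambda>\<tau>. Re (g \<tau>)) \<omega> = Re (stoch_int g \<omega>)"
  using AE_integrable_integrand[OF g]
proof eventually_elim
  case (elim \<omega>)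
  then show ?case using integral_Re[OF elim] by (simp add: stoch_int_def)
qed

lemma (in second_order_process) expectation_stoch_int:
  fixes h :: "real \<Rightarrow> real"
  assumes h: "integrable lborel h" and mean: "\<And>\<tau>. expectation (X \<tau>) = m"
  shows "expectation (stoch_int h) = m * (\<integral>\<tau>. h \<tau> \<partial>lborel)"
  using stoch_int_Fubini[OF h, of "\<lambda>_. 1"] mean by (simp add: mult.commute)

text \<open>The real part of a complex combination is again a stochastic integral, with the real
  kernel \<open>h\<close>. Kernels of integral zero make it centred whatever the mean m of the
  process.\<close>

lemma (in second_order_process) stoch_int_combination_gaussian:
  fixes W :: "'s \<Rightarrow> 'a \<Rightarrow> complex" and g :: "'s \<Rightarrow> real \<Rightarrow> complex"
  assumes gauss: "gaussian_process M X" and mean: "\<And>\<tau>. expectation (X \<tau>) = m"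
    and T: "finite T" and g: "\<And>s. s \<in> T \<Longrightarrow> integrable lborel (g s)" "\<And>s. s \<in> T \<Longrightarrow> (\<integral>\<tau>. g s \<tau> \<partial>lborel) = 0"
    and W: "\<And>s. s \<in> T \<Longrightarrow> W s \<in> borel_measurable M" "\<And>s. s \<in> T \<Longrightarrow> AE \<omega> in M. W s \<omega> = stoch_int (g s) \<omega>"
  shows "(\<integral>\<omega>. iexp (Re (\<Sum>s\<in>T. c s * W s \<omega>)) \<partial>M) = exp (- (\<integral>\<omega>. (Re (\<Sum>s\<in>T. c s * W s \<omega>))\<^sup>2 \<partial>M) / 2)"
proof -
  define G where "G \<tau> = (\<Sum>s\<in>T. c s * g s \<tau>)" for \<tau>
  define h where "h \<tau> = Re (G \<tau>)" for \<tau>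
  have G: "integrable lborel G" "(\<integral>\<tau>. G \<tau> \<partial>lborel) = 0"
    using g by (simp_all add: G_def[abs_def])
  have h: "integrable lborel h" "(\<integral>\<tau>. h \<tau> \<partial>lborel) = 0"
    using integral_Re[OF G(1)] G by (simp_all add: h_def[abs_def])
  have [measurable]: "stoch_int h \<in> borel_measurable M" "\<And>s. s \<in> T \<Longrightarrow> W s \<in> borel_measurable M"
    using h W by auto
  have "AE \<omega> in M. stoch_int G \<omega> = (\<Sum>s\<in>T. c s * stoch_int (g s) \<omega>)"
    unfolding G_def[abs_def] by (rule AE_stoch_int_sum[OF T g(1)])
  moreover have "AE \<omega> in M. \<forall>s\<in>T. W s \<omega> = stoch_int (g s) \<omega>"
    using T W by (intro AE_finite_allI) auto
  ultimately have eq: "AE \<omega> in M. Re (\<Sum>s\<in>T. c s * W s \<omega>) = stoch_int h \<omega>"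
    using AE_stoch_int_Re[OF G(1)]
  proof eventually_elim
    case (elim \<omega>)
    have "(\<Sum>s\<in>T. c s * W s \<omega>) = stoch_int G \<omega>"
      using elim(1,2) by simp
    then show ?case using elim(3) by (simp add: h_def[abs_def])
  qed
  have "(\<integral>\<omega>. iexp (Re (\<Sum>s\<in>T. c s * W s \<omega>)) \<partial>M) = (\<integral>\<omega>. iexp (stoch_int h \<omega>) \<partial>M)"
  proof (rule integral_cong_AE)
    show "AE \<omega> in M. iexp (Re (\<Sum>s\<in>T. c s * W s \<omega>)) = iexp (stoch_int h \<omega>)"
      using eq by eventually_elim (simp only:)
  qed measurable
  also have "\<dots> = exp (- (\<integral>\<omega>. (stoch_int h \<omega>)\<^sup>2 \<partial>M) / 2)"
    using expectation_stoch_int[OF h(1) mean] h(2) by (intro stoch_int_gaussian gauss h) simp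
  also have "(\<integral>\<omega>. (stoch_int h \<omega>)\<^sup>2 \<partial>M) = (\<integral>\<omega>. (Re (\<Sum>s\<in>T. c s * W s \<omega>))\<^sup>2 \<partial>M)"
  proof (rule integral_cong_AE)
    show "AE \<omega> in M. (stoch_int h \<omega>)\<^sup>2 = (Re (\<Sum>s\<in>T. c s * W s \<omega>))\<^sup>2"
      using eq by eventually_elim (simp only:)
  qed measurable
  finally show ?thesis .
qed

lemma integrable_iexp_mult:
  assumes [measurable]: "integrable lborel q" "(\<lambda>l. \<theta> l) \<in> borel_measurable lborel"
  shows "integrable lborel (\<lambda>l. q l * iexp (\<theta> l))"
proof (rule Bochner_Integration.integrable_bound[OF assms(1)])
  have [measurable]: "q \<in> borel_measurable lborel" using assms(1) by simp
  show "(\<lambda>l. q l * iexp (\<theta> l)) \<in> borel_measurable lborel" by measurable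
qed (simp add: norm_mult)

text \<open>The exponential has modulus 1, so the product of g and q dominates the integrand. The
  parameter a takes the values 1 and -1 for the two signs of the frequency.\<close>

lemma
  fixes g q :: "real \<Rightarrow> complex"
  assumes g: "integrable lborel g" and q: "integrable lborel q"
  shows Fubini_iexp: "(\<integral>\<tau>. g \<tau> * (\<integral>l. q l * iexp (a * \<tau> * l) \<partial>lborel) \<partial>lborel)
      = (\<integral>l. q l * (\<integral>\<tau>. g \<tau> * iexp (a * \<tau> * l) \<partial>lborel) \<partial>lborel)"
    and integrable_mult_iexp_transform: "integrable lborel (\<lambda>\<tau>. g \<tau> * (\<integral>l. q l * iexp (a * \<tau> * l) \<partial>lborel))"
proof -
  have [measurable]: "g \<in> borel_measurable lborel" "q \<in> borel_measurable lborel" using g q by simp_all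
  let ?f = "\<lambda>\<tau> l. g \<tau> * (q l * iexp (a * \<tau> * l))"
  have "integrable (lborel \<Otimes>\<^sub>M lborel) (\<lambda>(\<tau>, l). ?f \<tau> l)"
  proof (rule lborel_pair.Fubini_integrable)
    show "(\<lambda>(\<tau>, l). ?f \<tau> l) \<in> borel_measurable (lborel \<Otimes>\<^sub>M lborel)" by measurable
    show "integrable lborel (\<lambda>\<tau>. \<integral>l. norm (case (\<tau>, l) of (\<tau>, l) \<Rightarrow> ?f \<tau> l) \<partial>lborel)"
      using g by (simp add: norm_mult)
    show "AE \<tau> in lborel. integrable lborel (\<lambda>l. case (\<tau>, l) of (\<tau>, l) \<Rightarrow> ?f \<tau> l)"
    proof (rule AE_I2)
      fix \<tau>
      have "integrable lborel (\<lambda>l. q l * iexp (a * \<tau> * l))"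
        using q by (rule integrable_iexp_mult) measurable
      then show "integrable lborel (\<lambda>l. case (\<tau>, l) of (\<tau>, l) \<Rightarrow> ?f \<tau> l)" by simp
    qed
  qed
  note int = this
  have 1: "(\<integral>l. ?f \<tau> l \<partial>lborel) = g \<tau> * (\<integral>l. q l * iexp (a * \<tau> * l) \<partial>lborel)" for \<tau>
    by simp
  have "(\<integral>\<tau>. q l * (g \<tau> * iexp (a * \<tau> * l)) \<partial>lborel) = q l * (\<integral>\<tau>. g \<tau> * iexp (a * \<tau> * l) \<partial>lborel)" for l
    by simp
  then have 2: "(\<integral>\<tau>. ?f \<tau> l \<partial>lborel) = q l * (\<integral>\<tau>. g \<tau> * iexp (a * \<tau> * l) \<partial>lborel)" for l
    by (simp only: mult.left_commute)
  show "(\<integral>\<tau>. g \<tau> * (\<integral>l. q l * iexp (a * \<tau> * l) \<partial>lborel) \<partial>lborel)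
      = (\<integral>l. q l * (\<integral>\<tau>. g \<tau> * iexp (a * \<tau> * l) \<partial>lborel) \<partial>lborel)"
    using lborel_pair.integral_fst[OF int] lborel_pair.integral_snd[OF int] unfolding 1 2 by simp
  show "integrable lborel (\<lambda>\<tau>. g \<tau> * (\<integral>l. q l * iexp (a * \<tau> * l) \<partial>lborel))"
    using lborel_pair.integrable_fst[OF int] unfolding 1 .
qed

text \<open>Two applications of Fubini express E V^2 as the integral of p times the transforms of g
  at l and at -l, whose product vanishes by hypothesis. The constant k, the squared mean in the
  application, is removed by the zero integral of g.\<close>

lemma (in second_order_process) stoch_int_circular:
  fixes g p :: "real \<Rightarrow> complex"
  assumes cov: "\<And>\<sigma> \<tau>. complex_of_real (\<integral>\<omega>. X \<sigma> \<omega> * X \<tau> \<omega> \<partial>M) = k + (\<integral>l. p l * iexp ((\<sigma> - \<tau>) * l) \<partial>lborel)"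
    and p: "integrable lborel p" and g: "integrable lborel g" and g0: "(\<integral>\<tau>. g \<tau> \<partial>lborel) = 0"
    and F: "\<And>l. (\<integral>\<tau>. g \<tau> * iexp (1 * \<tau> * l) \<partial>lborel) * (\<integral>\<tau>. g \<tau> * iexp (- 1 * \<tau> * l) \<partial>lborel) = 0"
  shows "(\<integral>\<omega>. (stoch_int g \<omega>)\<^sup>2 \<partial>M) = 0"
proof -
  define V where "V = stoch_int g"
  have [measurable]: "V \<in> borel_measurable M" "g \<in> borel_measurable lborel" "p \<in> borel_measurable lborel"
    using g p by (simp_all add: V_def)
  \<comment> \<open>The spectral density of the cross-covariance between \<open>V\<close> and the
    process.\<close>
  define q where "q l = p l * (\<integral>\<tau>. g \<tau> * iexp (- 1 * \<tau> * l) \<partial>lborel)" for l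
  have VX: "(\<integral>\<omega>. V \<omega> * of_real (X \<sigma> \<omega>) \<partial>M) = (\<integral>l. q l * iexp (1 * \<sigma> * l) \<partial>lborel)" for \<sigma>
  proof -
    have U: "(\<lambda>\<omega>. complex_of_real (X \<sigma> \<omega>)) \<in> borel_measurable M" "integrable M (\<lambda>\<omega>. (norm (complex_of_real (X \<sigma> \<omega>)))\<^sup>2)"
      using X_sq by (auto simp: square_integrable_def)
    have pi: "integrable lborel (\<lambda>l. p l * iexp (\<sigma> * l))" using p by (rule integrable_iexp_mult) measurable
    have "(\<integral>\<omega>. V \<omega> * of_real (X \<sigma> \<omega>) \<partial>M) = (\<integral>\<tau>. g \<tau> * complex_of_real (\<integral>\<omega>. X \<sigma> \<omega> * X \<tau> \<omega> \<partial>M) \<partial>lborel)"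
      using stoch_int_Fubini[OF g U] by (simp add: V_def mult.commute flip: integral_complex_of_real)
    also have "\<dots> = (\<integral>\<tau>. g \<tau> * k + g \<tau> * (\<integral>l. (p l * iexp (\<sigma> * l)) * iexp (- 1 * \<tau> * l) \<partial>lborel) \<partial>lborel)"
    proof -
      have "iexp ((\<sigma> - \<tau>) * l) = iexp (\<sigma> * l) * iexp (- 1 * \<tau> * l)" for \<tau> l
        by (simp add: left_diff_distrib right_diff_distrib flip: exp_add)
      then show ?thesis unfolding cov by (simp only: distrib_left mult.assoc)
    qed
    also have "\<dots> = (\<integral>\<tau>. g \<tau> * (\<integral>l. (p l * iexp (\<sigma> * l)) * iexp (- 1 * \<tau> * l) \<partial>lborel) \<partial>lborel)"
      using g g0 integrable_mult_iexp_transform[OF g pi, of "- 1"] by simp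
    also have "\<dots> = (\<integral>l. (p l * iexp (\<sigma> * l)) * (\<integral>\<tau>. g \<tau> * iexp (- 1 * \<tau> * l) \<partial>lborel) \<partial>lborel)"
      by (rule Fubini_iexp[OF g pi])
    also have "\<dots> = (\<integral>l. q l * iexp (1 * \<sigma> * l) \<partial>lborel)"
      by (intro Bochner_Integration.integral_cong refl) (simp add: q_def mult_ac)
    finally show ?thesis .
  qed
  have qi: "integrable lborel q"
  proof (rule Bochner_Integration.integrable_bound)
    show "integrable lborel (\<lambda>l. p l * complex_of_real (\<integral>\<tau>. cmod (g \<tau>) \<partial>lborel))" using p by simp
    have "(\<lambda>(l, \<tau>). g \<tau> * iexp (- 1 * \<tau> * l)) \<in> borel_measurable (lborel \<Otimes>\<^sub>M lborel)" by measurable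
    then have [measurable]: "(\<lambda>l. \<integral>\<tau>. g \<tau> * iexp (- 1 * \<tau> * l) \<partial>lborel) \<in> borel_measurable lborel"
      by (rule lborel.borel_measurable_lebesgue_integral)
    show "q \<in> borel_measurable lborel" unfolding q_def[abs_def] by measurable
    have "cmod (\<integral>\<tau>. g \<tau> * iexp (- 1 * \<tau> * l) \<partial>lborel) \<le> (\<integral>\<tau>. cmod (g \<tau>) \<partial>lborel)" for l
      using integral_norm_bound[of lborel "\<lambda>\<tau>. g \<tau> * iexp (- 1 * \<tau> * l)"] by (simp add: norm_mult)
    then show "AE l in lborel. norm (q l) \<le> norm (p l * complex_of_real (\<integral>\<tau>. cmod (g \<tau>) \<partial>lborel))"
      by (auto simp: q_def norm_mult integral_nonneg intro!: mult_left_mono)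
  qed
  have U: "V \<in> borel_measurable M" "integrable M (\<lambda>\<omega>. (norm (V \<omega>))\<^sup>2)"
    using stoch_int_measurable[OF g] stoch_int_square_integrable[OF g] by (simp_all add: V_def square_integrable_def)
  have "(\<integral>\<omega>. V \<omega> * V \<omega> \<partial>M) = (\<integral>\<tau>. g \<tau> * (\<integral>l. q l * iexp (1 * \<tau> * l) \<partial>lborel) \<partial>lborel)"
    unfolding VX[symmetric] using stoch_int_Fubini[OF g U] by (simp add: V_def)
  also have "\<dots> = (\<integral>l. q l * (\<integral>\<tau>. g \<tau> * iexp (1 * \<tau> * l) \<partial>lborel) \<partial>lborel)"
    by (rule Fubini_iexp[OF g qi])
  also have "\<dots> = 0"
  proof -
    have "q l * (\<integral>\<tau>. g \<tau> * iexp (1 * \<tau> * l) \<partial>lborel) = 0" for l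
      using F[of l] by (auto simp: q_def)
    then show ?thesis by (simp only: Bochner_Integration.integral_zero)
  qed
  finally show ?thesis by (simp add: V_def power2_eq_square)
qed

section \<open>The wavelet transform as a stochastic integral\<close>

definition wavelet_kernel :: "(real \<Rightarrow> complex) \<Rightarrow> real \<Rightarrow> real \<Rightarrow> real \<Rightarrow> complex" where
  "wavelet_kernel \<psi> t s \<tau> = complex_of_real (1 / s) * cnj (\<psi> ((\<tau> - t) / s))"

lemma integrable_wavelet_kernel:
  assumes \<psi>: "integrable lborel \<psi>" and s: "0 < s"
  shows "integrable lborel (wavelet_kernel \<psi> t s)"
proof -
  have "integrable lborel (\<lambda>x. cnj (\<psi> (- t / s + (1 / s) * x)))"
    using lborel_integrable_real_affine[OF \<psi>, of "1 / s" "- t / s"] s by simp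
  moreover have "- t / s + (1 / s) * x = (x - t) / s" for x by (simp add: diff_divide_distrib)
  ultimately show ?thesis unfolding wavelet_kernel_def[abs_def] by simp
qed

text \<open>Substituting \<open>\<tau> = t + s * u\<close> turns translation into a phase and
  dilation into the argument \<open>s * l\<close>; conjugating the wavelet reverses the sign of the
  frequency.\<close>

lemma wavelet_kernel_fourier:
  assumes s: "0 < s"
  shows "(\<integral>\<tau>. wavelet_kernel \<psi> t s \<tau> * iexp (\<tau> * l) \<partial>lborel) = iexp (t * l) * cnj (fourier \<psi> (s * l))"
proof -
  have "(\<integral>\<tau>. wavelet_kernel \<psi> t s \<tau> * iexp (\<tau> * l) \<partial>lborel)
    = \<bar>s\<bar> *\<^sub>R (\<integral>u. wavelet_kernel \<psi> t s (t + s * u) * iexp ((t + s * u) * l) \<partial>lborel)"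
    using s by (intro lborel_integral_real_affine) simp
  also have "\<dots> = (\<integral>u. s *\<^sub>R (wavelet_kernel \<psi> t s (t + s * u) * iexp ((t + s * u) * l)) \<partial>lborel)"
    using s by simp
  also have "\<dots> = (\<integral>u. iexp (t * l) * cnj (exp (- \<i> * complex_of_real (u * (s * l))) * \<psi> u) \<partial>lborel)"
  proof (intro Bochner_Integration.integral_cong refl)
    fix u
    have "iexp ((t + s * u) * l) = iexp (t * l) * cnj (exp (- \<i> * complex_of_real (u * (s * l))))"
      by (simp add: exp_cnj algebra_simps flip: exp_add)
    then show "s *\<^sub>R (wavelet_kernel \<psi> t s (t + s * u) * iexp ((t + s * u) * l))
       = iexp (t * l) * cnj (exp (- \<i> * complex_of_real (u * (s * l))) * \<psi> u)"
      using s by (simp add: wavelet_kernel_def scaleR_conv_of_real)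
  qed
  also have "\<dots> = iexp (t * l) * cnj (fourier \<psi> (s * l))"
    by (simp add: fourier_def del: complex_cnj_mult)
  finally show ?thesis .
qed

subsection \<open>The wavelet transform of the noise\<close>

lemma stationary_process_integral:
  assumes stat: "stationary_process M X" and [measurable]: "\<And>\<tau>. X \<tau> \<in> borel_measurable M"
    and J: "finite J" and \<phi>[measurable]: "\<phi> \<in> borel_measurable (PiM J (\<lambda>_. borel))"
  shows "(\<integral>\<omega>. \<phi> (\<lambda>j\<in>J. X (j + h) \<omega>) \<partial>M) = (\<integral>\<omega>. (\<phi> (\<lambda>j\<in>J. X j \<omega>) :: real) \<partial>M)"
proof -
  have "(\<integral>\<omega>. \<phi> (\<lambda>j\<in>J. X (j + h) \<omega>) \<partial>M) = (\<integral>x. \<phi> x \<partial>distr M (PiM J (\<lambda>_. borel)) (\<lambda>\<omega>. \<lambda>j\<in>J. X (j + h) \<omega>))"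
    by (subst integral_distr) auto
  also have "\<dots> = (\<integral>x. \<phi> x \<partial>distr M (PiM J (\<lambda>_. borel)) (\<lambda>\<omega>. \<lambda>j\<in>J. X j \<omega>))"
    using stat J by (simp add: stationary_process_def)
  also have "\<dots> = (\<integral>\<omega>. \<phi> (\<lambda>j\<in>J. X j \<omega>) \<partial>M)"
    by (subst integral_distr) auto
  finally show ?thesis .
qed

lemma (in prob_space) gaussian_process_square_integrable:
  assumes "gaussian_process M X"
  shows "square_integrable M (X \<tau>)"
proof -
  have "gaussian_variable M (X \<tau>)"
    using assms[unfolded gaussian_process_def, rule_format, of "{\<tau>}" "\<lambda>_. 1"] by simp
  then show ?thesis by (rule gaussian_variable_square_integrable)
qed

text \<open>Shifting both times by \<tau> reduces products to time 0. The squared mean remains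
  because the covariance is centred while the process need not be.\<close>

lemma (in prob_space)
  assumes gauss: "gaussian_process M X" and stat: "stationary_process M X"
  shows stationary_expectation: "expectation (X \<tau>) = expectation (X 0)"
    and stationary_product: "(\<integral>\<omega>. X \<sigma> \<omega> * X \<tau> \<omega> \<partial>M) = covariance M (X (\<sigma> - \<tau>)) (X 0) + (expectation (X 0))\<^sup>2"
proof -
  have sq: "square_integrable M (X \<tau>)" for \<tau> using gauss by (rule gaussian_process_square_integrable)
  have [measurable]: "X \<tau> \<in> borel_measurable M" for \<tau> using sq by (rule square_integrable_measurable)
  have mean: "expectation (X \<tau>) = expectation (X 0)" for \<tau>
    using stationary_process_integral[OF stat _ _, of "{0}" "\<lambda>x. x 0" \<tau>] by simp
  then show "expectation (X \<tau>) = expectation (X 0)" .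
  have "(\<integral>\<omega>. X \<sigma> \<omega> * X \<tau> \<omega> \<partial>M) = (\<integral>\<omega>. X (\<sigma> - \<tau>) \<omega> * X 0 \<omega> \<partial>M)"
    using stationary_process_integral[OF stat _ _, of "{\<sigma> - \<tau>, 0}" "\<lambda>x. x (\<sigma> - \<tau>) * x 0" \<tau>] by simp
  moreover have "covariance M (X (\<sigma> - \<tau>)) (X 0) = (\<integral>\<omega>. X (\<sigma> - \<tau>) \<omega> * X 0 \<omega> \<partial>M) - (expectation (X 0))\<^sup>2"
  proof -
    let ?m = "expectation (X 0)"
    have "covariance M (X (\<sigma> - \<tau>)) (X 0)
      = (\<integral>\<omega>. X (\<sigma> - \<tau>) \<omega> * X 0 \<omega> - ?m * X (\<sigma> - \<tau>) \<omega> - ?m * X 0 \<omega> + ?m * ?m \<partial>M)"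
      unfolding covariance_def mean[of "\<sigma> - \<tau>"]
      by (intro Bochner_Integration.integral_cong refl) (simp add: algebra_simps)
    also have "\<dots> = (\<integral>\<omega>. X (\<sigma> - \<tau>) \<omega> * X 0 \<omega> \<partial>M) - ?m * expectation (X (\<sigma> - \<tau>)) - ?m * ?m + ?m * ?m"
      using square_integrable_integrable[OF sq] square_integrable_integrable_mult[OF sq sq] by (simp add: prob_space)
    finally show ?thesis by (simp add: mean[of "\<sigma> - \<tau>"] power2_eq_square)
  qed
  ultimately show "(\<integral>\<omega>. X \<sigma> \<omega> * X \<tau> \<omega> \<partial>M) = covariance M (X (\<sigma> - \<tau>)) (X 0) + (expectation (X 0))\<^sup>2" by simp
qed

lemma awt_eq_wavelet_kernel:
  "awt \<psi> f t s = (\<integral>\<tau>. wavelet_kernel \<psi> t s \<tau> * complex_of_real (f \<tau>) \<partial>lborel)"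
  unfolding awt_def awt_integrand_def wavelet_kernel_def by (simp only: mult_ac)

text \<open>
  Analyticity enters only here: \<open>fourier \<psi>\<close> vanishes at one of \<open>s * l\<close> and \<open>- s * l\<close> for every
  frequency \<open>l\<close>, so the transform of the noise is circular, and \<open>fourier \<psi> 0 = 0\<close> removes the
  mean of the noise.
\<close>
lemma noise_awt_concentration:
  fixes M :: "'a measure" and \<Phi> :: "real \<Rightarrow> 'a \<Rightarrow> real" and W :: "real \<Rightarrow> 'a \<Rightarrow> complex"
  assumes M: "prob_space M" and gauss: "gaussian_process M \<Phi>" and stat: "stationary_process M \<Phi>"
    and spec: "has_spectral_density M \<Phi> p"
    and \<psi>: "integrable lborel \<psi>" "\<And>w. w \<le> 0 \<Longrightarrow> fourier \<psi> w = 0"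
    and joint: "(\<lambda>(\<tau>, \<omega>). \<Phi> \<tau> \<omega>) \<in> borel_measurable (lborel \<Otimes>\<^sub>M M)"
    and W: "\<And>s. 0 < s \<Longrightarrow> W s \<in> borel_measurable M"
      "\<And>s. 0 < s \<Longrightarrow> AE \<omega> in M. W s \<omega> = awt \<psi> (\<lambda>\<tau>. \<Phi> \<tau> \<omega>) t s"
    and S: "finite S" "S \<subseteq> {0<..}" and s\<^sub>0: "0 < s\<^sub>0"
    and sd: "\<And>s. s \<in> S \<Longrightarrow> sqrt (\<integral>\<omega>. (cmod (W s \<omega>))\<^sup>2 \<partial>M) \<le> \<sigma>" "0 \<le> \<sigma>"
    and \<sigma>: "0 < sqrt (\<integral>\<omega>. (cmod (W s\<^sub>0 \<omega>))\<^sup>2 \<partial>M) + \<sigma>" and r: "0 \<le> r"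
  shows "measure M {\<omega> \<in> space M. (\<integral>\<omega>. norm_max (\<lambda>s. W s \<omega>) s\<^sub>0 S \<partial>M) + r \<le> norm_max (\<lambda>s. W s \<omega>) s\<^sub>0 S}
    \<le> exp (- (r\<^sup>2 / (sqrt (\<integral>\<omega>. (cmod (W s\<^sub>0 \<omega>))\<^sup>2 \<partial>M) + \<sigma>)\<^sup>2))"
proof -
  interpret prob_space M by fact
  have sq: "square_integrable M (\<Phi> \<tau>)" for \<tau> using gauss by (rule gaussian_process_square_integrable)
  interpret second_order_process M \<Phi> "(\<integral>\<omega>. (\<Phi> 0 \<omega>)\<^sup>2 \<partial>M)"
  proof
    show "(\<integral>\<omega>. (\<Phi> \<tau> \<omega>)\<^sup>2 \<partial>M) \<le> (\<integral>\<omega>. (\<Phi> 0 \<omega>)\<^sup>2 \<partial>M)" for \<tau>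
      using stationary_product[OF gauss stat, of \<tau> \<tau>] stationary_product[OF gauss stat, of 0 0]
      by (simp add: power2_eq_square)
  qed (fact joint sq)+
  have mean: "expectation (\<Phi> \<tau>) = expectation (\<Phi> 0)" for \<tau> using stationary_expectation[OF gauss stat] .
  define g where "g s = wavelet_kernel \<psi> t s" for s
  have g: "integrable lborel (g s)" if "0 < s" for s
    unfolding g_def using \<psi>(1) that by (rule integrable_wavelet_kernel)
  have ghat: "(\<integral>\<tau>. g s \<tau> * iexp (\<tau> * l) \<partial>lborel) = iexp (t * l) * cnj (fourier \<psi> (s * l))" if "0 < s" for s l
    unfolding g_def using that by (rule wavelet_kernel_fourier)
  have g0: "(\<integral>\<tau>. g s \<tau> \<partial>lborel) = 0" if "0 < s" for s
    using ghat[OF that, of 0] \<psi>(2)[of 0] by simp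
  have Wg: "AE \<omega> in M. W s \<omega> = stoch_int (g s) \<omega>" if "0 < s" for s
    using W(2)[OF that] by (simp add: awt_eq_wavelet_kernel stoch_int_def g_def)
  have circular: "(\<integral>\<omega>. (W s \<omega>)\<^sup>2 \<partial>M) = 0" if s: "0 < s" for s
  proof -
    have [measurable]: "W s \<in> borel_measurable M" "stoch_int (g s) \<in> borel_measurable M"
      using W s g by auto
    have "(\<integral>\<omega>. (W s \<omega>)\<^sup>2 \<partial>M) = (\<integral>\<omega>. (stoch_int (g s) \<omega>)\<^sup>2 \<partial>M)"
      using Wg[OF s] by (intro integral_cong_AE) auto
    also have "\<dots> = 0"
    proof (rule stoch_int_circular[OF _ _ g[OF s] g0[OF s]])
      show "complex_of_real (\<integral>\<omega>. \<Phi> \<sigma> \<omega> * \<Phi> \<tau> \<omega> \<partial>M)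
         = complex_of_real ((expectation (\<Phi> 0))\<^sup>2) + (\<integral>l. complex_of_real (p l) * iexp ((\<sigma> - \<tau>) * l) \<partial>lborel)" for \<sigma> \<tau>
        using spec unfolding stationary_product[OF gauss stat, of \<sigma> \<tau>] has_spectral_density_def
        by (simp only: of_real_add add.commute mult.commute)
      show "integrable lborel (\<lambda>l. complex_of_real (p l))"
        using spec by (simp add: has_spectral_density_def)
      show "(\<integral>\<tau>. g s \<tau> * iexp (1 * \<tau> * l) \<partial>lborel) * (\<integral>\<tau>. g s \<tau> * iexp (- 1 * \<tau> * l) \<partial>lborel) = 0" for l
      proof -
        have "fourier \<psi> (s * l) = 0 \<or> fourier \<psi> (s * - l) = 0"
          using \<psi>(2)[of "s * l"] \<psi>(2)[of "s * - l"] s by (cases "l \<le> 0") (auto simp: mult_le_0_iff)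
        then show ?thesis using ghat[OF s, of l] ghat[OF s, of "- l"] by auto
      qed
    qed
    finally show ?thesis .
  qed
  have cmod_sq: "square_integrable M (\<lambda>\<omega>. cmod (W s \<omega>))" if s: "0 < s" for s
  proof -
    have [measurable]: "W s \<in> borel_measurable M" "stoch_int (g s) \<in> borel_measurable M"
      using W s g by auto
    have "integrable M (\<lambda>\<omega>. (cmod (stoch_int (g s) \<omega>))\<^sup>2)"
      using stoch_int_square_integrable[OF g[OF s]] by (simp add: square_integrable_def)
    then have "integrable M (\<lambda>\<omega>. (cmod (W s \<omega>))\<^sup>2)"
      using Wg[OF s] by (subst integrable_cong_AE[where g = "\<lambda>\<omega>. (cmod (stoch_int (g s) \<omega>))\<^sup>2"]) auto
    then show ?thesis by (simp add: square_integrable_def)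
  qed
  have Re_Im_sq: "square_integrable M (\<lambda>\<omega>. Re (W s \<omega>))" "square_integrable M (\<lambda>\<omega>. Im (W s \<omega>))" if s: "0 < s" for s
  proof -
    have [measurable]: "W s \<in> borel_measurable M" using W s by auto
    have int: "integrable M (\<lambda>\<omega>. (cmod (W s \<omega>))\<^sup>2)" using cmod_sq[OF s] by (simp add: square_integrable_def)
    show "square_integrable M (\<lambda>\<omega>. Re (W s \<omega>))" "square_integrable M (\<lambda>\<omega>. Im (W s \<omega>))"
      unfolding square_integrable_def
      by (auto intro!: Bochner_Integration.integrable_bound[OF int] simp: cmod_power2)
  qed
  have pos: "0 < s" if "s \<in> insert s\<^sub>0 S" for s using that S s\<^sub>0 by auto
  show ?thesis
  proof (rule circular_gaussian_norm_max_concentration[OF S(1)])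
    show "(\<integral>\<omega>. iexp (Re (\<Sum>s\<in>insert s\<^sub>0 S. c s * W s \<omega>)) \<partial>M)
        = exp (- (\<integral>\<omega>. (Re (\<Sum>s\<in>insert s\<^sub>0 S. c s * W s \<omega>))\<^sup>2 \<partial>M) / 2)" for c
      using pos S(1) by (intro stoch_int_combination_gaussian[OF gauss mean _ g g0 W(1) Wg]) auto
  qed (use pos Re_Im_sq circular sd \<sigma> r in auto)
qed

section \<open>From a displaced maximizer to a large noise value\<close>

lemma sup_off_upper: "s \<in> {0<..} - I \<Longrightarrow> ennreal (g s) \<le> sup_off I g"
  unfolding sup_off_def by (rule SUP_upper)

text \<open>At \<open>s\<^sub>f\<close> the noisy modulus is at least |wf| - |w|; at
  \<open>s\<^sub>Y\<close> it is at most the supremum of |wf| off \<open>I\<close> plus |w|. The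
  resulting inequality is strict, so continuity of w allows \<open>s\<^sub>Y\<close> to be replaced
  by a nearby point of D.\<close>

lemma argmax_off_interval_imp:
  fixes wf w :: "real \<Rightarrow> complex"
  assumes sf: "s\<^sub>f \<in> argmax_scales (\<lambda>s. (cmod (wf s))\<^sup>2)" "s\<^sub>f \<in> I"
    and sY: "argmax_scales (\<lambda>s. (cmod (wf s + w s))\<^sup>2) = {s\<^sub>Y}" "s\<^sub>Y \<notin> I"
    and cont: "continuous_on {0<..} w"
    and D: "D \<subseteq> {0<..} - I" "{0<..} - I \<subseteq> closure D"
  shows "\<exists>d\<in>D. cmod (wf s\<^sub>f) - enn2real (sup_off I (\<lambda>s. cmod (wf s))) < cmod (w s\<^sub>f) + cmod (w d)"
proof -
  let ?B = "sup_off I (\<lambda>s. cmod (wf s))"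
  have sf0: "0 < s\<^sub>f" and sf_all: "\<forall>s. 0 < s \<longrightarrow> \<not> (cmod (wf s\<^sub>f))\<^sup>2 < (cmod (wf s))\<^sup>2"
    using sf(1) by (auto simp: argmax_scales_def is_arg_max_def)
  have sf_max: "cmod (wf s) \<le> cmod (wf s\<^sub>f)" if "0 < s" for s
    using sf_all that by (meson norm_ge_zero not_less power2_le_imp_le)
  have "is_arg_max (\<lambda>s. (cmod (wf s + w s))\<^sup>2) (\<lambda>r. 0 < r) s\<^sub>Y"
    using sY(1) unfolding argmax_scales_def by blast
  then have sY0: "0 < s\<^sub>Y" and sY_all: "\<forall>s. 0 < s \<longrightarrow> \<not> (cmod (wf s\<^sub>Y + w s\<^sub>Y))\<^sup>2 < (cmod (wf s + w s))\<^sup>2"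
    by (auto simp: is_arg_max_def)
  have sY_max: "cmod (wf s + w s) \<le> cmod (wf s\<^sub>Y + w s\<^sub>Y)" if "0 < s" for s
    using sY_all that by (meson norm_ge_zero not_less power2_le_imp_le)
  \<comment> \<open>Uniqueness of the noisy maximizer makes the comparison strict:
    \<open>s\<^sub>f\<close> lies in \<open>I\<close>, so it differs from \<open>s\<^sub>Y\<close>
    and is beaten somewhere.\<close>
  have "s\<^sub>f \<notin> argmax_scales (\<lambda>s. (cmod (wf s + w s))\<^sup>2)" using sY sf(2) by auto
  then obtain y where y: "0 < y" "(cmod (wf s\<^sub>f + w s\<^sub>f))\<^sup>2 < (cmod (wf y + w y))\<^sup>2"
    using sf0 by (auto simp: argmax_scales_def is_arg_max_def)
  then have "cmod (wf s\<^sub>f + w s\<^sub>f) < cmod (wf y + w y)"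
    using power2_less_imp_less norm_ge_zero by blast
  also have "\<dots> \<le> cmod (wf s\<^sub>Y + w s\<^sub>Y)" using y by (intro sY_max)
  also have "\<dots> \<le> cmod (wf s\<^sub>Y) + cmod (w s\<^sub>Y)" by (rule norm_triangle_ineq)
  finally have 1: "cmod (wf s\<^sub>f + w s\<^sub>f) < cmod (wf s\<^sub>Y) + cmod (w s\<^sub>Y)" .
  have 2: "cmod (wf s\<^sub>f) \<le> cmod (wf s\<^sub>f + w s\<^sub>f) + cmod (w s\<^sub>f)"
    using norm_triangle_ineq4[of "wf s\<^sub>f + w s\<^sub>f" "w s\<^sub>f"] by simp
  have "?B \<le> ennreal (cmod (wf s\<^sub>f))"
    unfolding sup_off_def using sf_max by (intro SUP_least ennreal_leI) auto
  then have "?B < \<top>" by (rule le_less_trans) simp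
  moreover have "ennreal (cmod (wf s\<^sub>Y)) \<le> ?B"
    using sY0 sY(2) by (intro sup_off_upper) auto
  ultimately have 3: "cmod (wf s\<^sub>Y) \<le> enn2real ?B"
    by (metis enn2real_ennreal enn2real_mono norm_ge_zero)
  have lt: "cmod (wf s\<^sub>f) - enn2real ?B - cmod (w s\<^sub>f) < cmod (w s\<^sub>Y)" using 1 2 3 by linarith
  have "s\<^sub>Y \<in> closure D" using D(2) sY0 sY(2) by auto
  then obtain x where x: "\<And>n. x n \<in> D" "x \<longlonglongrightarrow> s\<^sub>Y" unfolding closure_sequential by auto
  have "(\<lambda>n. w (x n)) \<longlonglongrightarrow> w s\<^sub>Y"
  proof (rule continuous_on_tendsto_compose[OF cont x(2)])
    show "\<forall>\<^sub>F n in sequentially. x n \<in> {0<..}"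
      using x(1) D(1) by (intro always_eventually) auto
  qed (use sY0 in simp)
  then have "(\<lambda>n. cmod (w (x n))) \<longlonglongrightarrow> cmod (w s\<^sub>Y)" by (rule tendsto_norm)
  then have "\<forall>\<^sub>F n in sequentially. cmod (wf s\<^sub>f) - enn2real ?B - cmod (w s\<^sub>f) < cmod (w (x n))"
    using lt by (rule order_tendstoD)
  then obtain n where "cmod (wf s\<^sub>f) - enn2real ?B - cmod (w s\<^sub>f) < cmod (w (x n))"
    by (meson eventually_sequentially order_refl)
  then show ?thesis using x(1)[of n] by (intro bexI[of _ "x n"]) auto
qed

text \<open>The finite maximum lies pointwise below \<open>sup_off\<close>; monotonicity of the
  nonnegative integral is the only property applied to the uncountable supremum.\<close>

lemma integral_norm_max_le_mean_off:
  assumes M: "prob_space M" and S: "finite S" "S \<subseteq> {0<..} - I"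
    and W: "\<And>s. s \<in> insert s\<^sub>0 S \<Longrightarrow> W t s \<in> borel_measurable M"
  shows "ennreal (\<integral>\<omega>. norm_max (\<lambda>s. W t s \<omega>) s\<^sub>0 S \<partial>M) \<le> mean_off M I W t s\<^sub>0"
proof -
  have [measurable]: "(\<lambda>\<omega>. norm_max (\<lambda>s. W t s \<omega>) s\<^sub>0 S) \<in> borel_measurable M" "W t s\<^sub>0 \<in> borel_measurable M"
    using S W by (auto intro: norm_max_measurable)
  let ?Max = "\<lambda>\<omega>. Max (insert 0 ((\<lambda>s. cmod (W t s \<omega>)) ` S))"
  have Max: "?Max \<omega> = norm_max (\<lambda>s. W t s \<omega>) s\<^sub>0 S - cmod (W t s\<^sub>0 \<omega>)" for \<omega>
    by (simp add: norm_max_def)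
  have [measurable]: "?Max \<in> borel_measurable M" unfolding Max by measurable
  have Max0: "0 \<le> ?Max \<omega>" for \<omega> using S by (intro Max_ge) auto
  have "ennreal (\<integral>\<omega>. norm_max (\<lambda>s. W t s \<omega>) s\<^sub>0 S \<partial>M) \<le> (\<integral>\<^sup>+\<omega>. ennreal (norm_max (\<lambda>s. W t s \<omega>) s\<^sub>0 S) \<partial>M)"
    \<comment> \<open>If \<open>norm_max\<close> is not integrable, its Bochner integral is 0 by
      convention and the bound is trivial.\<close>
    by (cases "integrable M (\<lambda>\<omega>. norm_max (\<lambda>s. W t s \<omega>) s\<^sub>0 S)")
      (auto intro: ennreal_integral_le_nn_integral simp: not_integrable_integral_eq)
  also have "\<dots> = (\<integral>\<^sup>+\<omega>. ennreal (cmod (W t s\<^sub>0 \<omega>)) + ennreal (?Max \<omega>) \<partial>M)"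
    using Max0 by (simp add: norm_max_def ennreal_plus)
  also have "\<dots> = (\<integral>\<^sup>+\<omega>. ennreal (cmod (W t s\<^sub>0 \<omega>)) \<partial>M) + (\<integral>\<^sup>+\<omega>. ennreal (?Max \<omega>) \<partial>M)"
    by (intro nn_integral_add) measurable
  also have "\<dots> \<le> mean_off M I W t s\<^sub>0"
    unfolding mean_off_def
  proof (intro add_left_mono nn_integral_mono)
    fix \<omega>
    have "?Max \<omega> \<in> insert 0 ((\<lambda>s. cmod (W t s \<omega>)) ` S)" using S by (intro Max_in) auto
    then consider "?Max \<omega> = 0" | s where "s \<in> S" "?Max \<omega> = cmod (W t s \<omega>)" by auto
    then show "ennreal (?Max \<omega>) \<le> sup_off I (\<lambda>s. cmod (W t s \<omega>))"
    proof cases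
      case 2
      then show ?thesis using S(2) sup_off_upper[of s I "\<lambda>s. cmod (W t s \<omega>)"] by auto
    qed simp
  qed
  finally show ?thesis .
qed

theorem theorem3:
  fixes M :: "'a measure"
    and \<Phi> :: "real \<Rightarrow> 'a \<Rightarrow> real" and p :: "real \<Rightarrow> real"
    and \<psi> :: "real \<Rightarrow> complex"
    and N :: nat and A \<phi> :: "nat \<Rightarrow> real \<Rightarrow> real" and \<epsilon> \<delta> :: real
    and f :: "real \<Rightarrow> real"
    and W\<Phi> W\<^sub>Y :: "real \<Rightarrow> real \<Rightarrow> 'a \<Rightarrow> complex"
    and t s\<^sub>f :: real and s\<^sub>Y :: "'a \<Rightarrow> real"
    and I :: "real set"
  assumes "prob_space M"
    and "adaptive_harmonic_model N A \<phi> \<epsilon> \<delta>"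
    and "f = ahm_signal N A \<phi>"
    and "noise_conditions M \<Phi> p"
    and "regular_analytic_wavelet \<psi>"
    and "awt_well_defined \<psi> f"
    and "continuous_awt_version M \<psi> \<Phi> W\<Phi>"
    and "W\<^sub>Y = (\<lambda>u s \<omega>. awt \<psi> f u s + W\<Phi> u s \<omega>)"
    and "argmax_scales (scalogram (awt \<psi> f) t) = {s\<^sub>f}"
    and "s\<^sub>Y \<in> borel_measurable M"
    and "AE \<omega> in M. argmax_scales (scalogram (\<lambda>u s. W\<^sub>Y u s \<omega>) t) = {s\<^sub>Y \<omega>}"
    and "is_interval I" and "I \<subseteq> {0<..}" and "s\<^sub>f \<in> I"
    and "mean_off M I W\<Phi> t s\<^sub>f < ennreal (gap_off I (awt \<psi> f) t s\<^sub>f)"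
  shows "measure M {\<omega> \<in> space M. s\<^sub>Y \<omega> \<in> I} \<ge>
    1 - exp (- ((gap_off I (awt \<psi> f) t s\<^sub>f - enn2real (mean_off M I W\<Phi> t s\<^sub>f))\<^sup>2
                / (enn2real (sd_off M I W\<Phi> t s\<^sub>f))\<^sup>2))"
proof -
  interpret prob_space M by fact
  define W where "W = W\<Phi> t"
  define wf where "wf = awt \<psi> f t"
  define \<Delta> where "\<Delta> = gap_off I (awt \<psi> f) t s\<^sub>f"
  define \<mu> where "\<mu> = enn2real (mean_off M I W\<Phi> t s\<^sub>f)"
  define \<sigma>\<^sub>0 where "\<sigma>\<^sub>0 = sqrt (\<integral>\<omega>. (cmod (W s\<^sub>f \<omega>))\<^sup>2 \<partial>M)"
  define sup_sd where "sup_sd = sup_off I (\<lambda>s. sqrt (\<integral>\<omega>. (cmod (W s \<omega>))\<^sup>2 \<partial>M))"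
  define \<sigma> where "\<sigma> = enn2real sup_sd"
  have sd: "sd_off M I W\<Phi> t s\<^sub>f = ennreal \<sigma>\<^sub>0 + sup_sd"
    by (simp add: sd_off_def \<sigma>\<^sub>0_def sup_sd_def W_def)
  have \<sigma>\<^sub>0: "0 \<le> \<sigma>\<^sub>0" by (simp add: \<sigma>\<^sub>0_def)
  show ?thesis
  proof (cases "enn2real (sd_off M I W\<Phi> t s\<^sub>f) = 0")
    \<comment> \<open>Covers both \<sigma> = 0 and an infinite supremum, which
      \<open>enn2real\<close> sends to 0: division by zero makes the exponent 0, and the claimed
      lower bound is 1 - 1 = 0.\<close>
    case True
    then show ?thesis by simp
  next
    case False
    then have "sup_sd \<noteq> \<top>" by (auto simp: sd)
    then have sup_sd: "sup_sd = ennreal \<sigma>" by (simp add: \<sigma>_def less_top)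
    have \<sigma>: "0 \<le> \<sigma>" by (simp add: \<sigma>_def)
    have sd_eq: "enn2real (sd_off M I W\<Phi> t s\<^sub>f) = \<sigma>\<^sub>0 + \<sigma>"
      using \<sigma> \<sigma>\<^sub>0 by (simp add: sd sup_sd flip: ennreal_plus)
    have pos: "0 < \<sigma>\<^sub>0 + \<sigma>" using False \<sigma> \<sigma>\<^sub>0 unfolding sd_eq by linarith
    have mean: "mean_off M I W\<Phi> t s\<^sub>f < ennreal \<Delta>" using assms(15) by (simp add: \<Delta>_def)
    have \<mu>: "mean_off M I W\<Phi> t s\<^sub>f = ennreal \<mu>"
      using less_trans[OF mean ennreal_less_top] by (simp add: \<mu>_def)
    have \<mu>0: "0 \<le> \<mu>" by (simp add: \<mu>_def)
    have \<mu>\<Delta>: "\<mu> < \<Delta>" using mean \<mu>0 unfolding \<mu> by (simp add: ennreal_less_iff)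
    have W_meas: "W s \<in> borel_measurable M" and W_ae: "AE \<omega> in M. W s \<omega> = awt \<psi> (\<lambda>\<tau>. \<Phi> \<tau> \<omega>) t s" if "0 < s" for s
      using assms(7) that by (auto simp: continuous_awt_version_def W_def)
    have W_cont: "continuous_on {0<..} (\<lambda>s. W s \<omega>)" if "\<omega> \<in> space M" for \<omega>
    proof -
      have "continuous_on (UNIV \<times> {0<..}) (\<lambda>(t, s). W\<Phi> t s \<omega>)"
        using assms(7) that by (simp add: continuous_awt_version_def)
      moreover have "continuous_on {0<..} (\<lambda>s. (t, s))" by (intro continuous_intros)
      ultimately have "continuous_on {0<..} (\<lambda>s. case (t, s) of (t, s) \<Rightarrow> W\<Phi> t s \<omega>)"
        by (rule continuous_on_compose2) auto
      then show ?thesis by (simp add: W_def)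
    qed
    have sf: "s\<^sub>f \<in> argmax_scales (\<lambda>s. (cmod (wf s))\<^sup>2)"
      using assms(9) by (simp add: scalogram_def[abs_def] wf_def)
    then have sf0: "0 < s\<^sub>f" by (simp add: argmax_scales_def is_arg_max_def)
    obtain D where D: "countable D" "D \<subseteq> {0<..} - I" "{0<..} - I \<subseteq> closure D"
      by (rule separable)
    \<comment> \<open>Finite sets that increase to D along an enumeration.\<close>
    define Dn where "Dn n = {d \<in> D. to_nat_on D d < n}" for n
    have Dn: "finite (Dn n)" "Dn n \<subseteq> {0<..} - I" for n
      using D(2) finite_vimage_IntI[OF _ inj_on_to_nat_on[OF D(1)], of "{..<n}"]
      by (auto simp: Dn_def vimage_def Int_def conj_commute)
    define B where "B n = {\<omega> \<in> space M. \<Delta> \<le> norm_max (\<lambda>s. W s \<omega>) s\<^sub>f (Dn n)}" for n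
    have [measurable]: "(\<lambda>\<omega>. norm_max (\<lambda>s. W s \<omega>) s\<^sub>f (Dn n)) \<in> borel_measurable M" for n
      using Dn W_meas sf0 by (intro norm_max_measurable) auto
    have B_meas: "B n \<in> sets M" for n unfolding B_def by measurable
    have B_le: "measure M (B n) \<le> exp (- ((\<Delta> - \<mu>)\<^sup>2 / (\<sigma>\<^sub>0 + \<sigma>)\<^sup>2))" for n
    proof -
      let ?e = "\<integral>\<omega>. norm_max (\<lambda>s. W s \<omega>) s\<^sub>f (Dn n) \<partial>M"
      have "ennreal ?e \<le> mean_off M I W\<Phi> t s\<^sub>f"
        unfolding W_def using Dn W_meas sf0
        by (intro integral_norm_max_le_mean_off prob_space_axioms) (auto simp: W_def)
      then have e: "?e \<le> \<mu>" using \<mu>0 by (simp add: \<mu>)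
      \<comment> \<open>The deviation is counted from the actual mean of the finite maximum;
        rewriting \<Delta> in this way exhibits \<open>B n\<close> as a deviation event, and
        \<open>?e \<le> \<mu>\<close> weakens the bound to one independent of n.\<close>
      have "measure M {\<omega> \<in> space M. ?e + (\<Delta> - ?e) \<le> norm_max (\<lambda>s. W s \<omega>) s\<^sub>f (Dn n)}
         \<le> exp (- ((\<Delta> - ?e)\<^sup>2 / (sqrt (\<integral>\<omega>. (cmod (W s\<^sub>f \<omega>))\<^sup>2 \<partial>M) + \<sigma>)\<^sup>2))"
      proof (rule noise_awt_concentration[OF prob_space_axioms])
        show "gaussian_process M \<Phi>" "stationary_process M \<Phi>" "has_spectral_density M \<Phi> p"
          using assms(4) by (simp_all add: noise_conditions_def)
        show "integrable lborel \<psi>" "\<And>w. w \<le> 0 \<Longrightarrow> fourier \<psi> w = 0"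
          using assms(5) by (simp_all add: regular_analytic_wavelet_def)
        show "(\<lambda>(\<tau>, \<omega>). \<Phi> \<tau> \<omega>) \<in> borel_measurable (lborel \<Otimes>\<^sub>M M)"
          using assms(7) by (simp add: continuous_awt_version_def)
        show "sqrt (\<integral>\<omega>. (cmod (W s \<omega>))\<^sup>2 \<partial>M) \<le> \<sigma>" if "s \<in> Dn n" for s
        proof -
          have "ennreal (sqrt (\<integral>\<omega>. (cmod (W s \<omega>))\<^sup>2 \<partial>M)) \<le> sup_sd"
            unfolding sup_sd_def using Dn(2) that by (intro sup_off_upper) auto
          then show ?thesis using \<sigma> by (simp add: sup_sd)
        qed
      qed (use Dn W_meas W_ae sf0 \<sigma> pos e \<mu>\<Delta> in \<open>auto simp: \<sigma>\<^sub>0_def\<close>)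
      also have "\<dots> \<le> exp (- ((\<Delta> - \<mu>)\<^sup>2 / (\<sigma>\<^sub>0 + \<sigma>)\<^sup>2))"
        using e \<mu>\<Delta> by (auto simp: \<sigma>\<^sub>0_def[symmetric] intro!: divide_right_mono power_mono)
      finally show ?thesis by (simp add: B_def)
    qed
    have "incseq B"
    proof (rule incseq_SucI)
      fix n
      have "norm_max w s\<^sub>f (Dn n) \<le> norm_max w s\<^sub>f (Dn (Suc n))" for w
        unfolding norm_max_def using Dn(1)[of "Suc n"]
        by (intro add_left_mono Max_mono insert_mono image_mono) (auto simp: Dn_def)
      then show "B n \<subseteq> B (Suc n)" by (auto simp: B_def intro: order_trans)
    qed
    then have "(\<lambda>n. measure M (B n)) \<longlonglongrightarrow> measure M (\<Union>n. B n)"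
      using B_meas by (intro finite_Lim_measure_incseq) auto
    then have union_le: "measure M (\<Union>n. B n) \<le> exp (- ((\<Delta> - \<mu>)\<^sup>2 / (\<sigma>\<^sub>0 + \<sigma>)\<^sup>2))"
      using B_le by (intro LIMSEQ_le_const2) auto
    have I_meas[measurable]: "I \<in> sets borel"
      using assms(12) by (rule real_interval_borel_measurable)
    have [measurable]: "s\<^sub>Y \<in> borel_measurable M" by fact
    have E: "{\<omega> \<in> space M. s\<^sub>Y \<omega> \<in> I} \<in> sets M" by measurable
    \<comment> \<open>A maximizer off \<open>I\<close> yields a single scale d in D that already
      pushes the noise above the gap, and d lies in some \<open>Dn n\<close>.\<close>
    have "AE \<omega> in M. \<omega> \<in> space M - {\<omega> \<in> space M. s\<^sub>Y \<omega> \<in> I} \<longrightarrow> \<omega> \<in> (\<Union>n. B n)"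
      using assms(11) AE_space
    proof eventually_elim
      case (elim \<omega>)
      show ?case
      proof
        assume "\<omega> \<in> space M - {\<omega> \<in> space M. s\<^sub>Y \<omega> \<in> I}"
        then have nI: "s\<^sub>Y \<omega> \<notin> I" by auto
        have "argmax_scales (\<lambda>s. (cmod (wf s + W s \<omega>))\<^sup>2) = {s\<^sub>Y \<omega>}"
          using elim(1) by (simp add: scalogram_def[abs_def] assms(8) wf_def W_def)
        from argmax_off_interval_imp[OF sf assms(14) this nI W_cont[OF elim(2)] D(2,3)]
        obtain d where d: "d \<in> D" "\<Delta> < cmod (W s\<^sub>f \<omega>) + cmod (W d \<omega>)"
          by (auto simp: \<Delta>_def gap_off_def wf_def)
        \<comment> \<open>The successor is needed because \<open>Dn n\<close> collects indices
          strictly below n.\<close>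
        define n where "n = Suc (to_nat_on D d)"
        have "cmod (W d \<omega>) \<le> Max (insert 0 ((\<lambda>s. cmod (W s \<omega>)) ` Dn n))"
          using d(1) Dn(1) by (intro Max_ge) (auto simp: Dn_def n_def)
        then have "\<omega> \<in> B n" using d(2) elim(2) by (simp add: B_def norm_max_def)
        then show "\<omega> \<in> (\<Union>n. B n)" by blast
      qed
    qed
    then have "measure M (space M - {\<omega> \<in> space M. s\<^sub>Y \<omega> \<in> I}) \<le> measure M (\<Union>n. B n)"
      using B_meas by (intro finite_measure_mono_AE) auto
    then have "1 - measure M {\<omega> \<in> space M. s\<^sub>Y \<omega> \<in> I} \<le> exp (- ((\<Delta> - \<mu>)\<^sup>2 / (\<sigma>\<^sub>0 + \<sigma>)\<^sup>2))"
      using union_le prob_compl[OF E] by simp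
    then show ?thesis unfolding sd_eq \<Delta>_def[symmetric] \<mu>_def[symmetric] by simp
  qed
qed

end
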